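(* The product of two supercharacters of $U$ decomposes as a sum of supercharacters of $U$. In other words, the subspace $\operatorname{scf}(U)$ is a subalgebra of $\operatorname{cf}(U)$; moreover, $\operatorname{scf}(U)$ is finitely generated, as an algebra, by the elementary characters $\xi_{\alpha,r}$ ($\alpha\in\Phi$, $r\in\mathbb{F}_q^\times$) of $U$.
   Context: Let $p\ge 3$ be a prime, $q=p^e$ ($e\ge 1$), $\mathbb{F}_q$ the field with $q$ elements, and $n\ge 1$. Let $G$ be one of $Sp_{2n}(q)$ (symplectic case), $O_{2n}(q)$ (even orthogonal case), $O_{2n+1}(q)$ (odd orthogonal case); put $m=2n$ in the first two cases and $m=2n+1$ in the third. Let $U_m(q)$ be the group of unipotent upper-triangular $m\times m$ matrices over $\mathbb{F}_q$, and $U=G\cap U_m(q)$, a Sylow $p$-subgroup of $G$. Explicitly, with $J$ the $n\times n$ matrix with 1's on the anti-diagonal and 0's elsewhere, $U$ consists of all block matrices $\begin{pmatrix} x & xu & xz \\ 0 & I_r & -u^TJ \\ 0 & 0 & Jx^{-T}J\end{pmatrix}$ with $x\in U_n(q)$, $u$ an $n\times r$ matrix and $z$ an $n\times n$ matrix over $\mathbb{F}_q$, where: $r=0$ and $Jz^T-zJ=0$ in the symplectic case; $r=0$ and $Jz^T+zJ=0$ in the even orthogonal case; $r=1$ and $Jz^T+zJ=-uu^T$ in the odd orthogonal case. Rows and columns of $m\times m$ matrices are indexed, in order, by $1,\dots,n,-n,\dots,-1$ if $m=2n$ and by $1,\dots,n,0,-n,\dots,-1$ if $m=2n+1$; this order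 is denoted $\prec$, so $1\prec\cdots\prec n\prec 0\prec -n\prec\cdots\prec -1$. Roots: $\Phi=\{\varepsilon_i\pm\varepsilon_j:1\le i<j\le n\}\cup\Phi'$, with $\Phi'=\{2\varepsilon_i:1\le i\le n\}$ (symplectic), $\Phi'=\emptyset$ (even orthogonal), $\Phi'=\{\varepsilon_i:1\le i\le n\}$ (odd orthogonal), where $\varepsilon_1,\dots,\varepsilon_n$ are the coordinate functions on the diagonal torus. Entries: for $i<j$, $\mathcal{E}(\varepsilon_i-\varepsilon_j)=\{(i,j),(-j,-i)\}$, $\mathcal{E}(\varepsilon_i+\varepsilon_j)=\{(i,-j),(j,-i)\}$; $\mathcal{E}(2\varepsilon_i)=\{(i,-i)\}$ (symplectic); $\mathcal{E}(\varepsilon_i)=\{(i,0),(0,-i)\}$ (odd orthogonal). For $\Psi\subseteq\Phi$, $\mathcal{E}(\Psi)=\bigcup_{\alpha\in\Psi}\mathcal{E}(\alpha)$, and $\mathcal{E}=\mathcal{E}(\Phi)$. For each $\alpha\in\Phi$ there is exactly one $(i,j)\in\mathcal{E}(\alpha)$ with $1\le i\le n$ and $i\prec j\preceq -i$. A subset of $\mathcal{E}$ is basic if it contains at most one entry from each row and at most one entry from each column; $D\subseteq\Phi$ is a basic subset if $\mathcal{E}(D)$ is basic. Supercharacters: for $i<j$, $U_{\varepsilon_i-\varepsilon_j}=\{x\in U: x_{i,k}=0,\ i<k<j\}$; $U_{\varepsilon_i+\varepsilon_j}=\{x\in U:x_{i,k}=x_{j,l}=0,\ i<k\le n,\ j\prec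 l\preceq 0\}$; and for $\alpha=2\varepsilon_i$ (symplectic) or $\alpha=\varepsilon_i$ (odd orthogonal), $U_\alpha=\{x\in U:x_{i,k}=0,\ i<k\le n\}$. Fix a nontrivial linear character $\vartheta\colon\mathbb{F}_q^+\to\mathbb{C}^\times$. For $\alpha\in\Phi$, $r\in\mathbb{F}_q^\times$, $\lambda_{\alpha,r}(x)=\vartheta(rx_{i,j})$ (with $(i,j)$ the distinguished entry of $\mathcal{E}(\alpha)$ above) is a linear character of $U_\alpha$, and the elementary character is the induced character $\xi_{\alpha,r}=(\lambda_{\alpha,r})^U$. For a basic subset $D\subseteq\Phi$ and a map $\phi\colon D\to\mathbb{F}_q^\times$, the supercharacter is $\xi_{D,\phi}=\prod_{\alpha\in D}\xi_{\alpha,\phi(\alpha)}$ (the trivial character $1_U$ if $D=\emptyset$). $\operatorname{cf}(U)$ is the complex algebra (under pointwise multiplication) of class functions on $U$; $\operatorname{scf}(U)$ is the subspace spanned by all supercharacters $\xi_{D,\phi}$. "A sum of supercharacters" means a linear combination of supercharacters with nonnegative integer coefficients. *)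

theory Defs
  imports
    Complex_Main
    "HOL-Computational_Algebra.Primes"
    "HOL-Library.FuncSet"
    "HOL-Library.Function_Algebras"
    "Jordan_Normal_Form.Matrix"
begin

datatype series = Symplectic | EvenOrthogonal | OddOrthogonal

definition middle_dim :: "series \<Rightarrow> nat" where
  "middle_dim T = (case T of OddOrthogonal \<Rightarrow> 1 | _ \<Rightarrow> 0)"

definition mat_dim :: "series \<Rightarrow> nat \<Rightarrow> nat" where
  "mat_dim T n = 2 * n + middle_dim T"

definition antidiag :: "nat \<Rightarrow> 'a::{zero,one} mat" where
  "antidiag n = mat n n (\<lambda>(i, j). if i + j + 1 = n then 1 else 0)"

definition unitriangular :: "nat \<Rightarrow> 'a::{zero,one} mat set" where
  "unitriangular n =
    {x \<in> carrier_mat n n. upper_triangular x \<and> (\<forall>i<n. x $$ (i, i) = 1)}"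

fun block_condition :: "series \<Rightarrow> nat \<Rightarrow> 'a::field mat \<Rightarrow> 'a mat \<Rightarrow> bool" where
  "block_condition Symplectic n u z \<longleftrightarrow>
    antidiag n * transpose_mat z - z * antidiag n = 0\<^sub>m n n"
| "block_condition EvenOrthogonal n u z \<longleftrightarrow>
    antidiag n * transpose_mat z + z * antidiag n = 0\<^sub>m n n"
| "block_condition OddOrthogonal n u z \<longleftrightarrow>
    antidiag n * transpose_mat z + z * antidiag n = - (u * transpose_mat u)"

text \<open>
  The block matrix with block rows \<open>(x, x u, x z)\<close>, \<open>(0, I\<^sub>r, - u\<^sup>T J)\<close>,
  \<open>(0, 0, J y\<^sup>T J)\<close>, where \<open>y\<close> stands for the inverse of \<open>x\<close>.  In the even-dimensional
  cases \<open>r = 0\<close> and the middle row and column of blocks are empty.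
\<close>
definition block_element ::
    "series \<Rightarrow> nat \<Rightarrow> 'a::field mat \<Rightarrow> 'a mat \<Rightarrow> 'a mat \<Rightarrow> 'a mat \<Rightarrow> 'a mat" where
  "block_element T n x y u z =
    (let r = middle_dim T in
      four_block_mat
        (four_block_mat x (x * u) (0\<^sub>m r n) (1\<^sub>m r))
        ((x * z) @\<^sub>r (- (transpose_mat u * antidiag n)))
        (0\<^sub>m n (n + r))
        (antidiag n * transpose_mat y * antidiag n))"

definition U_set :: "series \<Rightarrow> nat \<Rightarrow> 'a::field mat set" where
  "U_set T n =
    {block_element T n x y u z | x y u z.
       x \<in> unitriangular n \<and> y \<in> carrier_mat n n \<and> inverts_mat x y \<and>
       u \<in> carrier_mat n (middle_dim T) \<and> z \<in> carrier_mat n n \<and>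
       block_condition T n u z}"

definition U_group :: "series \<Rightarrow> nat \<Rightarrow> 'a::field mat monoid" where
  "U_group T n = \<lparr>carrier = U_set T n, monoid.mult = (*), one = 1\<^sub>m (mat_dim T n)\<rparr>"

text \<open>
  Rows and columns are labelled by the integers \<open>1, \<dots>, n, (0,) -n, \<dots>, -1\<close>, in this order.
  The order relation is defined on all integers; in particular \<open>0\<close> is comparable with the
  other labels also in the even-dimensional cases, where it is not itself a label.
\<close>
definition labels :: "series \<Rightarrow> nat \<Rightarrow> int set" where
  "labels T n =
    {1..int n} \<union> {- int n..-1} \<union> (if T = OddOrthogonal then {0} else {})"

definition prec :: "int \<Rightarrow> int \<Rightarrow> bool" (infix "\<prec>" 50) where
  "i \<prec> j \<longleftrightarrow> (0 < i \<and> (j \<le> 0 \<or> i < j)) \<or> (i = 0 \<and> j < 0) \<or> (i < j \<and> j < 0)"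

definition preceq :: "int \<Rightarrow> int \<Rightarrow> bool" (infix "\<preceq>" 50) where
  "i \<preceq> j \<longleftrightarrow> i \<prec> j \<or> i = j"

text \<open>The 0-based matrix position of a label, and the entry of a matrix at a pair of labels.\<close>
definition position :: "series \<Rightarrow> nat \<Rightarrow> int \<Rightarrow> nat" where
  "position T n i =
    nat (if 0 < i then i - 1 else if i = 0 then int n else int (mat_dim T n) + i)"

definition entry :: "series \<Rightarrow> nat \<Rightarrow> 'a mat \<Rightarrow> int \<Rightarrow> int \<Rightarrow> 'a" where
  "entry T n x i j = x $$ (position T n i, position T n j)"

text \<open>
  The constructors stand for \<open>\<epsilon>\<^sub>i - \<epsilon>\<^sub>j\<close>, \<open>\<epsilon>\<^sub>i + \<epsilon>\<^sub>j\<close>, \<open>2 \<epsilon>\<^sub>i\<close> and \<open>\<epsilon>\<^sub>i\<close>, respectively.  On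
  the root sets below (where \<open>i < j\<close>) these expressions denote pairwise distinct roots.
\<close>
datatype root = Diff int int | Sum int int | Long int | Short int

definition roots :: "series \<Rightarrow> nat \<Rightarrow> root set" where
  "roots T n =
    {Diff i j | i j. 1 \<le> i \<and> i < j \<and> j \<le> int n} \<union>
    {Sum i j | i j. 1 \<le> i \<and> i < j \<and> j \<le> int n} \<union>
    (case T of
       Symplectic \<Rightarrow> {Long i | i. 1 \<le> i \<and> i \<le> int n}
     | EvenOrthogonal \<Rightarrow> {}
     | OddOrthogonal \<Rightarrow> {Short i | i. 1 \<le> i \<and> i \<le> int n})"

fun root_entries :: "root \<Rightarrow> (int \<times> int) set" where
  "root_entries (Diff i j) = {(i, j), (-j, -i)}"
| "root_entries (Sum i j) = {(i, -j), (j, -i)}"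
| "root_entries (Long i) = {(i, -i)}"
| "root_entries (Short i) = {(i, 0), (0, -i)}"

definition main_entry :: "nat \<Rightarrow> root \<Rightarrow> int \<times> int" where
  "main_entry n \<alpha> =
    (THE (i, j). (i, j) \<in> root_entries \<alpha> \<and> 1 \<le> i \<and> i \<le> int n \<and> i \<prec> j \<and> j \<preceq> - i)"

lemma main_entry_eqs:
  "1 \<le> i \<Longrightarrow> i < j \<Longrightarrow> j \<le> int n \<Longrightarrow> main_entry n (Diff i j) = (i, j)"
  "1 \<le> i \<Longrightarrow> i < j \<Longrightarrow> j \<le> int n \<Longrightarrow> main_entry n (Sum i j) = (i, -j)"
  "1 \<le> i \<Longrightarrow> i \<le> int n \<Longrightarrow> main_entry n (Long i) = (i, -i)"
  "1 \<le> i \<Longrightarrow> i \<le> int n \<Longrightarrow> main_entry n (Short i) = (i, 0)"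
  unfolding main_entry_def
  by (rule the_equality; force simp: prec_def preceq_def)+

definition basic_entries :: "(int \<times> int) set \<Rightarrow> bool" where
  "basic_entries E \<longleftrightarrow> inj_on fst E \<and> inj_on snd E"

definition basic_subset :: "series \<Rightarrow> nat \<Rightarrow> root set \<Rightarrow> bool" where
  "basic_subset T n D \<longleftrightarrow> D \<subseteq> roots T n \<and> basic_entries (\<Union>(root_entries ` D))"

definition root_subgroup :: "series \<Rightarrow> nat \<Rightarrow> root \<Rightarrow> 'a::field mat set" where
  "root_subgroup T n \<alpha> = {x \<in> U_set T n.
    (case \<alpha> of
       Diff i j \<Rightarrow> (\<forall>k. i < k \<and> k < j \<longrightarrow> entry T n x i k = 0)
     | Sum i j \<Rightarrow>
         (\<forall>k. i < k \<and> k \<le> int n \<longrightarrow> entry T n x i k = 0) \<and>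
         (\<forall>l\<in>labels T n. j \<prec> l \<and> l \<preceq> 0 \<longrightarrow> entry T n x j l = 0)
     | Long i \<Rightarrow> (\<forall>k. i < k \<and> k \<le> int n \<longrightarrow> entry T n x i k = 0)
     | Short i \<Rightarrow> (\<forall>k. i < k \<and> k \<le> int n \<longrightarrow> entry T n x i k = 0))}"

definition nontrivial_additive_character :: "('a::ab_group_add \<Rightarrow> complex) \<Rightarrow> bool" where
  "nontrivial_additive_character \<theta> \<longleftrightarrow>
    (\<forall>a. \<theta> a \<noteq> 0) \<and> (\<forall>a b. \<theta> (a + b) = \<theta> a * \<theta> b) \<and> (\<exists>a. \<theta> a \<noteq> 1)"

text \<open>
  Complex functions on a group \<open>G\<close> are represented by functions on the ambient type that vanish
  outside the carrier, so that equality and the pointwise algebra operations are those of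
  functions on \<open>G\<close>; the unit of the algebra is then \<open>trivial_character G\<close>, not the constant 1.
\<close>
definition trivial_character :: "('g, 'm) monoid_scheme \<Rightarrow> 'g \<Rightarrow> complex" where
  "trivial_character G g = (if g \<in> carrier G then 1 else 0)"

definition class_functions :: "('g, 'm) monoid_scheme \<Rightarrow> ('g \<Rightarrow> complex) set" where
  "class_functions G =
    {f. (\<forall>g. g \<notin> carrier G \<longrightarrow> f g = 0) \<and>
        (\<forall>g\<in>carrier G. \<forall>t\<in>carrier G. f (t \<otimes>\<^bsub>G\<^esub> g \<otimes>\<^bsub>G\<^esub> inv\<^bsub>G\<^esub> t) = f g)}"

definition induced ::
    "('g, 'm) monoid_scheme \<Rightarrow> 'g set \<Rightarrow> ('g \<Rightarrow> complex) \<Rightarrow> 'g \<Rightarrow> complex" where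
  "induced G H f g =
    (if g \<in> carrier G
     then (\<Sum>t\<in>carrier G.
             let h = t \<otimes>\<^bsub>G\<^esub> g \<otimes>\<^bsub>G\<^esub> inv\<^bsub>G\<^esub> t in if h \<in> H then f h else 0)
          / of_nat (card H)
     else 0)"

definition root_character ::
    "series \<Rightarrow> nat \<Rightarrow> ('a::field \<Rightarrow> complex) \<Rightarrow> root \<Rightarrow> 'a \<Rightarrow> 'a mat \<Rightarrow> complex" where
  "root_character T n \<theta> \<alpha> r x = (case main_entry n \<alpha> of (i, j) \<Rightarrow> \<theta> (r * entry T n x i j))"

definition elementary_character ::
    "series \<Rightarrow> nat \<Rightarrow> ('a::field \<Rightarrow> complex) \<Rightarrow> root \<Rightarrow> 'a \<Rightarrow> 'a mat \<Rightarrow> complex" where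
  "elementary_character T n \<theta> \<alpha> r =
    induced (U_group T n) (root_subgroup T n \<alpha>) (root_character T n \<theta> \<alpha> r)"

definition elementary_characters ::
    "series \<Rightarrow> nat \<Rightarrow> ('a::field \<Rightarrow> complex) \<Rightarrow> ('a mat \<Rightarrow> complex) set" where
  "elementary_characters T n \<theta> =
    {elementary_character T n \<theta> \<alpha> r | \<alpha> r. \<alpha> \<in> roots T n \<and> r \<noteq> 0}"

text \<open>The trivial character serves as the value of the product for empty \<open>D\<close>.\<close>
definition supercharacter ::
    "series \<Rightarrow> nat \<Rightarrow> ('a::field \<Rightarrow> complex) \<Rightarrow> root set \<Rightarrow> (root \<Rightarrow> 'a) \<Rightarrow>
      'a mat \<Rightarrow> complex" where
  "supercharacter T n \<theta> D \<phi> =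
    trivial_character (U_group T n) * (\<Prod>\<alpha>\<in>D. elementary_character T n \<theta> \<alpha> (\<phi> \<alpha>))"

definition super_indices :: "series \<Rightarrow> nat \<Rightarrow> (root set \<times> (root \<Rightarrow> 'a::field)) set" where
  "super_indices T n = {(D, \<phi>). basic_subset T n D \<and> \<phi> \<in> D \<rightarrow>\<^sub>E - {0}}"

definition supercharacters ::
    "series \<Rightarrow> nat \<Rightarrow> ('a::field \<Rightarrow> complex) \<Rightarrow> ('a mat \<Rightarrow> complex) set" where
  "supercharacters T n \<theta> = {supercharacter T n \<theta> D \<phi> | D \<phi>. (D, \<phi>) \<in> super_indices T n}"

definition sum_of_supercharacters ::
    "series \<Rightarrow> nat \<Rightarrow> ('a::field \<Rightarrow> complex) \<Rightarrow> ('a mat \<Rightarrow> complex) \<Rightarrow> bool" where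
  "sum_of_supercharacters T n \<theta> f \<longleftrightarrow>
    (\<exists>c :: root set \<times> (root \<Rightarrow> 'a) \<Rightarrow> nat.
       f = (\<Sum>(D, \<phi>)\<in>super_indices T n. of_nat (c (D, \<phi>)) * supercharacter T n \<theta> D \<phi>))"

lemma finite_roots: "finite (roots T n)"
proof -
  let ?I = "{1..int n}"
  have "roots T n \<subseteq> (\<lambda>(i, j). Diff i j) ` (?I \<times> ?I) \<union> (\<lambda>(i, j). Sum i j) ` (?I \<times> ?I)
      \<union> Long ` ?I \<union> Short ` ?I"
    by (force simp: roots_def split: series.splits)
  then show ?thesis
    by (rule finite_subset) auto
qed

text \<open>Hence the sum defining \<open>sum_of_supercharacters\<close> is a genuine finite sum.\<close>
lemma finite_super_indices:
  "finite (super_indices T n :: (root set \<times> (root \<Rightarrow> 'a::{field,finite})) set)"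
proof -
  have "finite (SIGMA D:Pow (roots T n). D \<rightarrow>\<^sub>E (- {0} :: 'a set))"
    by (intro finite_SigmaI finite_PiE) (auto intro: finite_subset finite_roots)
  then show ?thesis
    by (rule finite_subset[rotated]) (auto simp: super_indices_def basic_subset_def)
qed

definition fun_scale :: "complex \<Rightarrow> ('g \<Rightarrow> complex) \<Rightarrow> 'g \<Rightarrow> complex" where
  "fun_scale c f = (\<lambda>g. c * f g)"

interpretation cfun: vector_space fun_scale
  by unfold_locales (auto simp: fun_scale_def algebra_simps)

definition scf ::
    "series \<Rightarrow> nat \<Rightarrow> ('a::field \<Rightarrow> complex) \<Rightarrow> ('a mat \<Rightarrow> complex) set" where
  "scf T n \<theta> = cfun.span (supercharacters T n \<theta>)"

definition cf_subalgebra :: "('g, 'm) monoid_scheme \<Rightarrow> ('g \<Rightarrow> complex) set \<Rightarrow> bool" where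
  "cf_subalgebra G S \<longleftrightarrow>
    S \<subseteq> class_functions G \<and> cfun.subspace S \<and> trivial_character G \<in> S \<and>
    (\<forall>f\<in>S. \<forall>g\<in>S. f * g \<in> S)"

text \<open>The smallest (unital) subalgebra containing a given set of class functions.\<close>
definition generated_cf_subalgebra ::
    "('g, 'm) monoid_scheme \<Rightarrow> ('g \<Rightarrow> complex) set \<Rightarrow> ('g \<Rightarrow> complex) set" where
  "generated_cf_subalgebra G E = cf_subalgebra G hull E"

end

theory Submission
  imports Defs "Jordan_Normal_Form.Determinant" "HOL-Number_Theory.Residues"
begin

text \<open>
  Evaluated at \<open>g\<close>, an elementary character is a sum of values of \<open>\<theta>\<close> over row vectors
  fixed by \<open>g\<close> up to a given column (\<open>entry_sum\<close>), and for the long roots a Weil-type Gauss sum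
  of a quadratic form over vectors in the standard Lagrangian subspace (\<open>long_sum\<close>).  If two
  such sums share a row, subtracting fixed vectors (for long roots, completing the square) turns
  their product into a nonnegative combination of products of lower total weight.  Fourier duality
  together with the invariant form identifies the sum at an entry with the sum at the reflected
  entry, so column clashes are row clashes.  By induction on the weight every product of elementary
  characters becomes a sum of products without clashes, that is, of supercharacters.
\<close>

section \<open>Fourier duality for strictly triangular bilinear forms\<close>

text \<open>All identities are checked value by value at a fixed g, so neither irreducible
  constituents nor inner products of characters occur. What makes this possible is that the block
  description of \<open>U\<close> amounts to being unitriangular and preserving the form
  \<open>pairing\<close>: the first n rows can be prescribed freely up to column n + mid, and what
  an elementary character reads further right in a conjugate is recovered through the form. The
  obstacle is the antidiagonal, which reflection maps to itself, so that duality gives no help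
  there. In the orthogonal types no root sits on it; fixed vectors are isotropic, the sum does not
  depend on r, and as a count of fixed vectors it expands along its own row. In the symplectic type
  the sum at the antidiagonal is bilinear while the character of the long root is quadratic, and
  polarization splits the former into a long sum and a Weil sum. Odd characteristic enters in
  solving the block condition by halving, in isotropy, and in the polarization identities for long
  sums.\<close>

definition vecs :: "nat set \<Rightarrow> (nat \<Rightarrow> 'a::zero) set" where
  "vecs A = {a. \<forall>k. k \<notin> A \<longrightarrow> a k = 0}"

lemma finite_vecs: "finite A \<Longrightarrow> finite (vecs A :: (nat \<Rightarrow> 'a::{zero,finite}) set)"
  using finite_set_of_finite_funs[of A "UNIV :: 'a set" 0]
  by (auto simp: vecs_def intro: finite_subset[rotated])

lemma vecs_empty: "vecs {} = {0}"
  by (auto simp: vecs_def fun_eq_iff)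

lemma sum_vecs_insert:
  fixes f :: "(nat \<Rightarrow> 'a::{zero,finite}) \<Rightarrow> 'b::comm_monoid_add"
  assumes "x \<notin> A" "finite A"
  shows "(\<Sum>a\<in>vecs (insert x A). f a) = (\<Sum>t\<in>UNIV. \<Sum>a\<in>vecs A. f (a(x := t)))"
proof -
  have "(\<Sum>a\<in>vecs (insert x A). f a) = (\<Sum>(t, a)\<in>UNIV \<times> vecs A. f (a(x := t)))"
    by (rule sum.reindex_bij_witness[of _ "\<lambda>(t, a). a(x := t)" "\<lambda>a. (a x, a(x := 0))"])
      (use assms in \<open>auto simp: vecs_def fun_eq_iff\<close>)
  then show ?thesis
    by (simp add: sum.cartesian_product)
qed

text \<open>For unitriangular \<open>g\<close>, these are the row vector \<open>a (g - 1)\<close> and the column vector \<open>(g - 1) d\<close>.\<close>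
definition act :: "'a::semiring_0 mat \<Rightarrow> (nat \<Rightarrow> 'a) \<Rightarrow> nat \<Rightarrow> 'a" where
  "act g a k = (\<Sum>i<k. a i * g $$ (i, k))"

definition colact :: "nat \<Rightarrow> 'a::semiring_0 mat \<Rightarrow> (nat \<Rightarrow> 'a) \<Rightarrow> nat \<Rightarrow> 'a" where
  "colact m g d l = (\<Sum>k\<in>{l<..<m}. g $$ (l, k) * d k)"

definition bil :: "nat \<Rightarrow> 'a::semiring_0 mat \<Rightarrow> (nat \<Rightarrow> 'a) \<Rightarrow> (nat \<Rightarrow> 'a) \<Rightarrow> 'a" where
  "bil m g a d = (\<Sum>k<m. act g a k * d k)"

lemma act_add: "act g (a + b) k = act g a k + act g b k"
  by (simp add: act_def sum.distrib algebra_simps)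

lemma act_diff: "act g (a - b) k = act g a k - act g (b :: nat \<Rightarrow> 'a::ring) k"
  by (simp add: act_def sum_subtractf algebra_simps)

lemma act_scale: "act g (\<lambda>i. t * a i) k = t * act g a k"
  by (simp add: act_def sum_distrib_left algebra_simps)

lemma act_zero [simp]: "act g 0 k = 0"
  by (simp add: act_def)

lemma act_cong: "(\<And>i. i < k \<Longrightarrow> a i = b i) \<Longrightarrow> act g a k = act g b k"
  by (simp add: act_def)

lemma colact_scale: "colact m g (\<lambda>i. t * a i) k = t * colact m g (a :: nat \<Rightarrow> 'a::comm_semiring_0) k"
  by (simp add: colact_def sum_distrib_left algebra_simps)

lemma bil_add_left: "bil m g (a + b) d = bil m g a d + bil m g b d"
  by (simp add: bil_def act_add sum.distrib algebra_simps)

lemma bil_add_right: "bil m g a (d + c) = bil m g a d + bil m g a c"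
  by (simp add: bil_def sum.distrib algebra_simps)

lemma bil_colact:
  "bil m g a d = (\<Sum>l<m. a l * colact m g d (l :: nat) :: 'a::semiring_0)"
proof -
  have "bil m g a d = (\<Sum>k<m. \<Sum>l<m. if l < k then a l * g $$ (l, k) * d k else 0)"
    unfolding bil_def act_def sum_distrib_right
    apply (rule sum.cong[OF refl])
    subgoal for k by (rule sum.mono_neutral_cong_left) auto
    done
  also have "\<dots> = (\<Sum>l<m. \<Sum>k<m. if l < k then a l * g $$ (l, k) * d k else 0)"
    by (rule sum.swap)
  also have "\<dots> = (\<Sum>l<m. a l * colact m g d l)"
    unfolding colact_def sum_distrib_left
    by (rule sum.cong[OF refl], rule sum.mono_neutral_cong_right) (auto simp: mult.assoc)
  finally show ?thesis .
qed

lemma sum_vecs_support: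
  assumes "d \<in> vecs I" "I \<subseteq> {..<m}"
  shows "(\<Sum>l<m. c l * d l :: 'a::semiring_0) = (\<Sum>l\<in>I. c l * d l)"
  by (rule sum.mono_neutral_right) (use assms in \<open>auto simp: vecs_def\<close>)

text \<open>The leading coordinate is i, normalised to 1, and \<open>g\<close> fixes the vector in
  every column before j. Column j of a (g - 1) is thus the first one left free; the characters are
  evaluated there.\<close>

definition fixers_from :: "'a::comm_ring_1 mat \<Rightarrow> nat \<Rightarrow> nat \<Rightarrow> (nat \<Rightarrow> 'a) set" where
  "fixers_from g i j = {a. a i = 1 \<and> a \<in> vecs {i..<j} \<and> (\<forall>k<j. act g a k = 0)}"

definition fixers :: "'a::comm_ring_1 mat \<Rightarrow> nat \<Rightarrow> nat \<Rightarrow> (nat \<Rightarrow> 'a) set" where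
  "fixers g i j = {a \<in> vecs {i<..<j}. \<forall>k<j. act g a k = 0}"

lemma finite_fixers_from [simp]: "finite (fixers_from g i j :: (nat \<Rightarrow> 'a::{field,finite}) set)"
  unfolding fixers_from_def by (rule finite_subset[OF _ finite_vecs[of "{i..<j}"]]) auto

lemma finite_fixers [simp]: "finite (fixers g i j :: (nat \<Rightarrow> 'a::{field,finite}) set)"
  unfolding fixers_def by (rule finite_subset[OF _ finite_vecs[of "{i<..<j}"]]) auto

text \<open>Column l of a (g - 1) involves only coordinates before l, so truncation at j keeps all
  conditions before j. A vector fixed further out can therefore serve as base point of this affine
  space.\<close>

lemma fixers_from_translate:
  fixes g :: "'a::field mat"
  assumes "b \<in> fixers_from g i k" "i < j" "j \<le> k"
  shows "fixers_from g i j = (\<lambda>c. (\<lambda>l. if l < j then b l else 0) + c) ` fixers g i j"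
proof -
  let ?b = "\<lambda>l. if l < j then b l else 0"
  have b: "?b i = 1" "?b \<in> vecs {i..<j}" "\<And>l. l < j \<Longrightarrow> act g ?b l = 0"
  proof -
    fix l assume "l < j"
    then have "act g ?b l = act g b l"
      by (intro act_cong) auto
    with \<open>l < j\<close> show "act g ?b l = 0"
      using assms by (auto simp: fixers_from_def)
  qed (use assms in \<open>auto simp: fixers_from_def vecs_def\<close>)
  have "a \<in> (\<lambda>c. ?b + c) ` fixers g i j" if "a \<in> fixers_from g i j" for a
  proof (rule image_eqI)
    show "a = ?b + (a - ?b)" by simp
    show "a - ?b \<in> fixers g i j"
      using that b unfolding fixers_from_def fixers_def
      by (auto simp: act_diff vecs_def simp del: fun_diff_def)
        (metis fun_diff_def greaterThanLessThan_iff atLeastLessThan_iff diff_self le_neq_implies_less)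
  qed
  moreover have "?b + c \<in> fixers_from g i j" if "c \<in> fixers g i j" for c
    using that b assms(2) unfolding fixers_from_def fixers_def
    by (auto simp: act_add vecs_def)
  ultimately show ?thesis by blast
qed

text \<open>Scaling invariance makes every vector with nonzero coordinate at x a unique multiple of
  one with coordinate 1. Iterated, this sorts fixed vectors by their first or last nonzero
  coordinate.\<close>

lemma sum_split_at_zero:
  fixes f :: "(nat \<Rightarrow> 'a::{field,finite}) \<Rightarrow> complex"
  assumes "finite S" and S: "\<And>t a. t \<noteq> 0 \<Longrightarrow> a \<in> S \<Longrightarrow> (\<lambda>k. t * a k) \<in> S"
  shows "(\<Sum>a\<in>S. f a) =
    (\<Sum>a\<in>{a\<in>S. a x = 0}. f a) + (\<Sum>t\<in>-{0}. \<Sum>a\<in>{a\<in>S. a x = 1}. f (\<lambda>k. t * a k))"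
proof -
  have "(\<Sum>a\<in>S. f a) = (\<Sum>a\<in>{a\<in>S. a x = 0}. f a) + (\<Sum>a\<in>{a\<in>S. a x \<noteq> 0}. f a)"
    using assms(1) by (subst sum.union_disjoint[symmetric]) (auto intro: sum.cong)
  also have "(\<Sum>a\<in>{a\<in>S. a x \<noteq> 0}. f a) = (\<Sum>(t, a)\<in>(-{0}) \<times> {a\<in>S. a x = 1}. f (\<lambda>k. t * a k))"
    by (rule sum.reindex_bij_witness[of _ "\<lambda>(t, a). (\<lambda>k. t * a k)" "\<lambda>a. (a x, \<lambda>k. inverse (a x) * a k)"])
      (auto simp: fun_eq_iff mult.assoc[symmetric] intro: S)
  finally show ?thesis
    using assms(1) by (simp add: sum.cartesian_product)
qed

locale additive_character =
  fixes \<theta> :: "'a::{field,finite} \<Rightarrow> complex"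
  assumes character: "nontrivial_additive_character \<theta>"
begin

lemma \<theta>_add: "\<theta> (a + b) = \<theta> a * \<theta> b" and \<theta>_nonzero [simp]: "\<theta> a \<noteq> 0"
  using character by (auto simp: nontrivial_additive_character_def)

lemma \<theta>_0 [simp]: "\<theta> 0 = 1"
  using \<theta>_add[of 0 0] by simp

text \<open>Translation by a permutes the field, so the product of all values is multiplied by the
  power of \<open>\<theta> a\<close> to the order of the field and yet unchanged. Hence
  \<open>\<theta> a\<close> is a root of unity.\<close>

lemma norm_\<theta>: "norm (\<theta> a) = 1"
proof -
  have "(\<Prod>x\<in>UNIV. \<theta> x) = (\<Prod>x\<in>UNIV. \<theta> (a + x))"
    by (rule prod.reindex_bij_witness[of _ "\<lambda>x. a + x" "\<lambda>x. x - a"]) auto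
  also have "\<dots> = \<theta> a ^ (card (UNIV :: 'a set)) * (\<Prod>x\<in>UNIV. \<theta> x)"
    by (simp add: \<theta>_add prod.distrib)
  finally have "\<theta> a ^ (card (UNIV :: 'a set)) = 1"
    by simp
  then show ?thesis
    using power_eq_1_iff[of "norm (\<theta> a)"] by (metis finite_UNIV_card_ge_0 finite norm_ge_zero norm_one
      norm_power power_eq_imp_eq_base power_one zero_le_one)
qed

lemma \<theta>_minus: "\<theta> (- a) = cnj (\<theta> a)"
proof -
  have "\<theta> a * cnj (\<theta> a) = 1"
    using norm_\<theta>[of a] complex_norm_square[of "\<theta> a"] by simp
  moreover have "\<theta> a * \<theta> (- a) = 1"
    by (simp flip: \<theta>_add)
  ultimately show ?thesis
    by (metis \<theta>_nonzero mult_left_cancel)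
qed

lemma sum_\<theta>: "(\<Sum>t\<in>UNIV. \<theta> (c * t)) = (if c = 0 then of_nat (card (UNIV :: 'a set)) else 0)"
proof (cases "c = 0")
  case False
  obtain b where b: "\<theta> b \<noteq> 1"
    using character by (auto simp: nontrivial_additive_character_def)
  have "(\<Sum>t\<in>UNIV. \<theta> (c * t)) = (\<Sum>t\<in>UNIV. \<theta> (b + c * t))"
    by (rule sum.reindex_bij_witness[of _ "\<lambda>t. t + b / c" "\<lambda>t. t - b / c"])
      (use False in \<open>auto simp: field_simps\<close>)
  also have "\<dots> = \<theta> b * (\<Sum>t\<in>UNIV. \<theta> (c * t))"
    by (simp add: \<theta>_add sum_distrib_left)
  finally show ?thesis using b False by simp
qed simp

text \<open>Orthogonality, one coordinate at a time. This turns a free summation variable into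
  linear constraints on the other one.\<close>

lemma sum_vecs_\<theta>:
  assumes "finite A"
  shows "(\<Sum>d\<in>vecs A. \<theta> (\<Sum>k\<in>A. c k * d k)) =
    (if \<forall>k\<in>A. c k = 0 then of_nat ((card (UNIV :: 'a set)) ^ card A) else 0)"
  using assms
proof (induction A rule: finite_induct)
  case empty
  then show ?case by (simp add: vecs_empty)
next
  case (insert x A)
  have "(\<Sum>d\<in>vecs (insert x A). \<theta> (\<Sum>k\<in>insert x A. c k * d k)) =
    (\<Sum>t\<in>UNIV. \<Sum>d\<in>vecs A. \<theta> (c x * t) * \<theta> (\<Sum>k\<in>A. c k * d k))"
    unfolding sum_vecs_insert[OF insert(2,1)]
  proof (intro sum.cong refl)
    fix t d
    have "(\<Sum>k\<in>A. c k * (d(x := t)) k) = (\<Sum>k\<in>A. c k * d k)"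
      using insert(2) by (intro sum.cong) auto
    then show "\<theta> (\<Sum>k\<in>insert x A. c k * (d(x := t)) k) = \<theta> (c x * t) * \<theta> (\<Sum>k\<in>A. c k * d k)"
      using insert by (simp add: \<theta>_add)
  qed
  also have "\<dots> = (\<Sum>t\<in>UNIV. \<theta> (c x * t)) * (\<Sum>d\<in>vecs A. \<theta> (\<Sum>k\<in>A. c k * d k))"
    by (simp only: sum_product)
  finally show ?case
    using insert by (auto simp: sum_\<theta>)
qed

text \<open>Multiplied by q^|I|, either side is the double sum over a and d in \<open>vecs I\<close>
  of \<theta>(r (a1 + a) (g - 1) (d0 + d)). Summing over d first forces the row conditions on a1 +
  a, summing over a first forces the column conditions on d0 + d.\<close>

lemma fourier_swap:
  fixes g :: "'a mat" and j k m :: nat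
  assumes "j \<le> m" "r \<noteq> 0"
  defines "I \<equiv> {k..<j}"
  shows "(\<Sum>a\<in>{a\<in>vecs I. \<forall>l\<in>I. act g (a1 + a) l = 0}. \<theta> (r * bil m g (a1 + a) d0)) =
    (\<Sum>d\<in>{d\<in>vecs I. \<forall>l\<in>I. colact m g (d0 + d) l = 0}. \<theta> (r * bil m g a1 (d0 + d)))"
    (is "?L = ?R")
proof -
  let ?S = "\<lambda>a d. \<theta> (r * bil m g (a1 + a) (d0 + d))"
  let ?A = "\<lambda>a. \<theta> (r * bil m g (a1 + a) d0)" and ?B = "\<lambda>d. \<theta> (r * bil m g a1 (d0 + d))"
  define Q :: complex where "Q = of_nat ((card (UNIV :: 'a set)) ^ card I)"
  have I: "I \<subseteq> {..<m}" "finite I"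
    using assms by auto
  have fin: "finite (vecs I :: (nat \<Rightarrow> 'a) set)"
    by (rule finite_vecs) fact
  define S where "S = (\<Sum>a\<in>vecs I. \<Sum>d\<in>vecs I. ?S a d)"
  have "S = (\<Sum>a\<in>vecs I. if \<forall>l\<in>I. act g (a1 + a) l = 0 then ?A a * Q else 0)"
    unfolding S_def
  proof (rule sum.cong[OF refl])
    fix a :: "nat \<Rightarrow> 'a"
    have "(\<Sum>d\<in>vecs I. ?S a d) =
      (\<Sum>d\<in>vecs I. ?A a * \<theta> (\<Sum>l\<in>I. (r * act g (a1 + a) l) * d l))"
    proof (rule sum.cong[OF refl])
      fix d :: "nat \<Rightarrow> 'a" assume "d \<in> vecs I"
      have "r * bil m g (a1 + a) (d0 + d) =
          r * bil m g (a1 + a) d0 + (\<Sum>l\<in>I. (r * act g (a1 + a) l) * d l)"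
        unfolding bil_add_right using sum_vecs_support[OF \<open>d \<in> vecs I\<close> I(1), of "act g (a1 + a)"]
        by (simp add: bil_def distrib_left sum_distrib_left mult.assoc)
      then show "?S a d =
          ?A a * \<theta> (\<Sum>l\<in>I. (r * act g (a1 + a) l) * d l)"
        by (simp add: \<theta>_add)
    qed
    also have "\<dots> = ?A a *
        (if \<forall>l\<in>I. r * act g (a1 + a) l = 0 then Q else 0)"
      unfolding sum_distrib_left[symmetric] sum_vecs_\<theta>[OF I(2)] Q_def ..
    finally show "(\<Sum>d\<in>vecs I. ?S a d) =
      (if \<forall>l\<in>I. act g (a1 + a) l = 0 then ?A a * Q else 0)"
      using assms(2) by auto
  qed
  then have 1: "S = ?L * Q"
    using fin by (simp add: sum.inter_filter sum_distrib_right flip: sum.inter_filter)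
  have "S = (\<Sum>d\<in>vecs I. \<Sum>a\<in>vecs I. ?S a d)"
    unfolding S_def by (rule sum.swap)
  also have "\<dots> = (\<Sum>d\<in>vecs I. if \<forall>l\<in>I. colact m g (d0 + d) l = 0
      then ?B d * Q else 0)"
  proof (rule sum.cong[OF refl])
    fix d :: "nat \<Rightarrow> 'a"
    have "(\<Sum>a\<in>vecs I. ?S a d) =
      (\<Sum>a\<in>vecs I. ?B d * \<theta> (\<Sum>l\<in>I. (r * colact m g (d0 + d) l) * a l))"
    proof (rule sum.cong[OF refl])
      fix a :: "nat \<Rightarrow> 'a" assume "a \<in> vecs I"
      have "r * bil m g (a1 + a) (d0 + d) =
          r * bil m g a1 (d0 + d) + (\<Sum>l\<in>I. (r * colact m g (d0 + d) l) * a l)"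
        unfolding bil_add_left bil_colact[of m g a]
        using sum_vecs_support[OF \<open>a \<in> vecs I\<close> I(1), of "colact m g (d0 + d)"]
        by (simp add: distrib_left sum_distrib_left mult.assoc mult.commute[of "a _"])
      then show "?S a d =
          ?B d * \<theta> (\<Sum>l\<in>I. (r * colact m g (d0 + d) l) * a l)"
        by (simp add: \<theta>_add)
    qed
    also have "\<dots> = ?B d *
        (if \<forall>l\<in>I. r * colact m g (d0 + d) l = 0 then Q else 0)"
      unfolding sum_distrib_left[symmetric] sum_vecs_\<theta>[OF I(2)] Q_def ..
    finally show "(\<Sum>a\<in>vecs I. ?S a d) =
      (if \<forall>l\<in>I. colact m g (d0 + d) l = 0 then ?B d * Q else 0)"
      using assms(2) by auto
  qed
  finally have "S = ?R * Q"
    using fin by (simp add: sum.inter_filter sum_distrib_right flip: sum.inter_filter)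
  with 1 show ?thesis
    by (simp add: Q_def)
qed

end

section \<open>Entry sums\<close>

lemma fixers_scale: "a \<in> fixers g i j \<Longrightarrow> (\<lambda>k. t * a k) \<in> fixers g i j"
  by (auto simp: fixers_def vecs_def act_scale)

lemma fixers_eq_zero: "j \<le> Suc i \<Longrightarrow> fixers g i j = {0}"
  by (force simp: fixers_def vecs_def fun_eq_iff)

lemma fixers_Suc:
  assumes "Suc i < j"
  shows "{a \<in> fixers g i j. a (Suc i) = 0} = fixers g (Suc i) j"
    and "{a \<in> fixers g i j. a (Suc i) = 1} = fixers_from g (Suc i) j"
  using assms by (auto simp: fixers_def fixers_from_def vecs_def Suc_le_eq)
    (metis (no_types, lifting) linorder_neqE_nat not_less_eq)+

text \<open>Rows before k stay unconstrained: in the hybrid sums they are taken care of by row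
  vectors that end at k.\<close>

definition cofixers :: "nat \<Rightarrow> 'a::comm_ring_1 mat \<Rightarrow> nat \<Rightarrow> nat \<Rightarrow> (nat \<Rightarrow> 'a) set" where
  "cofixers m g k j = {d \<in> vecs {k..<j}. \<forall>l\<in>{k..<j}. colact m g d l = 0}"

definition cofixers_to :: "nat \<Rightarrow> 'a::comm_ring_1 mat \<Rightarrow> nat \<Rightarrow> nat \<Rightarrow> (nat \<Rightarrow> 'a) set" where
  "cofixers_to m g k j = {d. d j = 1 \<and> d \<in> vecs {k..j} \<and> (\<forall>l\<in>{k..<j}. colact m g d l = 0)}"

lemma finite_cofixers [simp]: "finite (cofixers m g i j :: (nat \<Rightarrow> 'a::{field,finite}) set)"
  unfolding cofixers_def by (rule finite_subset[OF _ finite_vecs[of "{i..<j}"]]) auto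

lemma finite_cofixers_to [simp]: "finite (cofixers_to m g i j :: (nat \<Rightarrow> 'a::{field,finite}) set)"
  unfolding cofixers_to_def by (rule finite_subset[OF _ finite_vecs[of "{i..j}"]]) auto

lemma colact_eq_zero: "d \<in> vecs {k..l} \<Longrightarrow> colact m g d l = 0"
  by (auto simp: colact_def vecs_def intro!: sum.neutral)

text \<open>Row j of (g - 1) d vanishes by support, so admitting the coordinate j adds no new
  condition.\<close>

lemma cofixers_Suc:
  assumes "k \<le> j"
  shows "{d \<in> cofixers m g k (Suc j). d j = 0} = cofixers m g k j"
    and "{d \<in> cofixers m g k (Suc j). d j = 1} = cofixers_to m g k j"
proof -
  have "colact m g d j = 0" if "d \<in> vecs {k..<Suc j}" for d
    using that by (intro colact_eq_zero[of _ k]) (auto simp: vecs_def)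
  then show "{d \<in> cofixers m g k (Suc j). d j = 1} = cofixers_to m g k j"
    by (auto simp: cofixers_def cofixers_to_def less_Suc_eq atLeastLessThanSuc_atLeastAtMost)
  have "d \<in> vecs {k..<j} \<longleftrightarrow> d \<in> vecs {k..<Suc j} \<and> d j = 0" for d :: "nat \<Rightarrow> 'a"
    using assms by (auto simp: vecs_def less_Suc_eq)
  then show "{d \<in> cofixers m g k (Suc j). d j = 0} = cofixers m g k j"
    using \<open>\<And>d. d \<in> vecs {k..<Suc j} \<Longrightarrow> colact m g d j = 0\<close>
    by (auto simp: cofixers_def less_Suc_eq)
qed

definition unit_fun :: "nat \<Rightarrow> nat \<Rightarrow> 'a::zero_neq_one" where
  "unit_fun i k = (if k = i then 1 else 0)"

lemma fixers_from_Suc: "fixers_from g i (Suc i) = {unit_fun i}"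
proof -
  have "act g (unit_fun i) k = 0" if "k \<le> i" for k
    using that by (auto simp: act_def unit_fun_def intro!: sum.neutral)
  then show ?thesis
    by (auto simp: fixers_from_def vecs_def unit_fun_def fun_eq_iff less_Suc_eq_le)
qed

lemma bil_unit_fun: "i < m \<Longrightarrow> bil m g (unit_fun i) d = colact m (g :: 'a::comm_ring_1 mat) d i"
  by (simp add: bil_colact unit_fun_def if_distrib[of "\<lambda>x. x * _"] sum.delta cong: if_cong)

lemma bil_unit_fun_right: "j < m \<Longrightarrow> bil m g a (unit_fun j) = act (g :: 'a::comm_ring_1 mat) a j"
  by (simp add: bil_def unit_fun_def if_distrib[of "\<lambda>x. _ * x"] sum.delta cong: if_cong)

text \<open>Columns up to k of a (g - 1) see only the part b below k. The conditions before k thus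
  concern b alone, and those from k on are affine conditions on c, in the shape needed for
  \<open>fourier_swap\<close>.\<close>

lemma sum_fixers_from_split:
  fixes f :: "(nat \<Rightarrow> 'a::{field,finite}) \<Rightarrow> complex"
  assumes "i < k" "k \<le> j"
  shows "(\<Sum>a\<in>fixers_from g i j. f a) = (\<Sum>b\<in>fixers_from g i k.
    \<Sum>c\<in>{c \<in> vecs {k..<j}. \<forall>l\<in>{k..<j}. act g (b + c) l = 0}. f (b + c))"
proof -
  let ?C = "\<lambda>b. {c \<in> vecs {k..<j}. \<forall>l\<in>{k..<j}. act g (b + c) l = 0}"
  let ?lo = "\<lambda>a l. if l < k then a l else (0::'a)"
  let ?hi = "\<lambda>a l. if l < k then (0::'a) else a l"
  have fin: "finite (?C b)" for b
    by (rule finite_subset[OF _ finite_vecs[of "{k..<j}"]]) auto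
  have low: "act g (b + c) l = act g b l" if "c \<in> vecs {k..<j}" "l \<le> k" for b c l
    using that by (intro act_cong) (auto simp: vecs_def)
  have sum_eq: "?lo a + ?hi a = a" for a
    by (auto simp: fun_eq_iff)
  have "(\<Sum>a\<in>fixers_from g i j. f a) = (\<Sum>(b, c)\<in>Sigma (fixers_from g i k) ?C. f (b + c))"
  proof (rule sum.reindex_bij_witness[of _ "\<lambda>(b, c). b + c" "\<lambda>a. (?lo a, ?hi a)"])
    fix a assume a: "a \<in> fixers_from g i j"
    have hi: "?hi a \<in> vecs {k..<j}"
      using a by (auto simp: fixers_from_def vecs_def)
    have "act g (?lo a) l = 0" if "l < k" for l
      using that a low[OF hi, of l "?lo a"] assms unfolding sum_eq by (auto simp: fixers_from_def)
    then have "?lo a \<in> fixers_from g i k"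
      using a assms by (auto simp: fixers_from_def vecs_def)
    moreover have "?hi a \<in> ?C (?lo a)"
    proof -
      have "\<forall>l\<in>{k..<j}. act g (?lo a + ?hi a) l = 0"
        unfolding sum_eq using a by (auto simp: fixers_from_def)
      with hi show ?thesis by blast
    qed
    ultimately show "(?lo a, ?hi a) \<in> Sigma (fixers_from g i k) ?C"
      by blast
  next
    fix x assume x: "x \<in> Sigma (fixers_from g i k) ?C"
    then obtain b c where bc: "x = (b, c)" "b \<in> fixers_from g i k" "c \<in> ?C b"
      by blast
    have "act g (b + c) l = 0" if "l < j" for l
      using bc that low[of c l b] by (cases "l < k") (auto simp: fixers_from_def)
    then show "(case x of (b, c) \<Rightarrow> b + c) \<in> fixers_from g i j"
      using bc assms by (auto simp: fixers_from_def vecs_def)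
    show "(?lo (case x of (b, c) \<Rightarrow> b + c), ?hi (case x of (b, c) \<Rightarrow> b + c)) = x"
      using bc by (force simp: fixers_from_def vecs_def fun_eq_iff)
  qed (auto simp: sum_eq)
  then show ?thesis
    using fin by (simp add: sum.Sigma)
qed

context additive_character
begin

text \<open>The value \<open>r = 0\<close> is allowed and counts fixed vectors.\<close>
definition entry_sum :: "'a mat \<Rightarrow> nat \<Rightarrow> nat \<Rightarrow> 'a \<Rightarrow> complex" where
  "entry_sum g i j r = (\<Sum>a\<in>fixers_from g i j. \<theta> (r * act g a j))"

text \<open>The same sum over the direction space of \<open>fixers_from g i j\<close>.\<close>

definition fixer_sum :: "'a mat \<Rightarrow> nat \<Rightarrow> nat \<Rightarrow> 'a \<Rightarrow> complex" where
  "fixer_sum g i j r = (\<Sum>a\<in>fixers g i j. \<theta> (r * act g a j))"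

lemma entry_sum_translate:
  assumes "b \<in> fixers_from g i k" "i < j" "j \<le> k"
  shows "entry_sum g i j r = \<theta> (r * act g b j) * fixer_sum g i j r"
proof -
  let ?b = "\<lambda>l. if l < j then b l else 0"
  have "act g ?b j = act g b j"
    by (intro act_cong) auto
  moreover have "inj_on (\<lambda>c. ?b + c) (fixers g i j)"
    by (rule inj_onI) simp
  ultimately show ?thesis
    unfolding entry_sum_def fixer_sum_def fixers_from_translate[OF assms]
    by (simp add: sum.reindex act_add distrib_left \<theta>_add sum_distrib_left)
qed

lemma sum_nonzero_scale:
  fixes f :: "'a \<Rightarrow> complex"
  assumes "r \<noteq> 0"
  shows "(\<Sum>t\<in>-{0}. f (r * t)) = (\<Sum>t\<in>-{0}. f t)"
  by (rule sum.reindex_bij_witness[of _ "\<lambda>t. t / r" "\<lambda>t. r * t"]) (use assms in auto)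

text \<open>A nonzero fixed vector has a leading coordinate l and a leading scalar t; dividing by t
  gives an element of \<open>fixers_from g l j\<close> and moves t into the character. The zero
  vector contributes the 1. Since t runs over all nonzero scalars, the factor r is absorbed.\<close>

lemma fixer_sum_expand:
  assumes "i < j" "r \<noteq> 0"
  shows "fixer_sum g i j r = 1 + (\<Sum>l\<in>{i<..<j}. \<Sum>t\<in>-{0}. entry_sum g l j t)"
  using assms(1)
proof (induction "j - i" arbitrary: i)
  case (Suc d)
  show ?case
  proof (cases "Suc i < j")
    case False
    then have "{i<..<j} = {}" by auto
    then show ?thesis
      using False by (simp add: fixer_sum_def fixers_eq_zero)
  next
    case True
    have "fixer_sum g i j r = fixer_sum g (Suc i) j r + (\<Sum>t\<in>-{0}. entry_sum g (Suc i) j (r * t))"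
      unfolding fixer_sum_def entry_sum_def
      by (subst sum_split_at_zero[where x = "Suc i"])
        (use True in \<open>auto simp: fixers_Suc fixers_scale act_scale mult.assoc\<close>)
    also have "\<dots> = 1 + (\<Sum>l\<in>{Suc i<..<j}. \<Sum>t\<in>-{0}. entry_sum g l j t)
        + (\<Sum>t\<in>-{0}. entry_sum g (Suc i) j t)"
      using Suc True by (simp add: sum_nonzero_scale[OF assms(2)])
    also have "\<dots> = 1 + (\<Sum>l\<in>insert (Suc i) {Suc i<..<j}. \<Sum>t\<in>-{0}. entry_sum g l j t)"
      by simp
    also have "insert (Suc i) {Suc i<..<j} = {i<..<j}"
      using True by auto
    finally show ?thesis .
  qed
qed simp

text \<open>Each vector b of the second factor serves as base point for the first factor, which
  becomes a character value at b times the linear sum; the exponents at b then add up to r +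
  s.\<close>

lemma entry_sum_mult:
  assumes "i < j" "r \<noteq> 0"
  shows "entry_sum g i j r * entry_sum g i j s = entry_sum g i j (r + s) * fixer_sum g i j r"
proof (cases "fixers_from g i j = {}")
  case True
  then show ?thesis by (simp add: entry_sum_def)
next
  case False
  have "entry_sum g i j r * entry_sum g i j s =
      (\<Sum>b\<in>fixers_from g i j. entry_sum g i j r * \<theta> (s * act g b j))"
    by (simp add: entry_sum_def[of g i j s] sum_distrib_left)
  also have "\<dots> = (\<Sum>b\<in>fixers_from g i j. \<theta> ((r + s) * act g b j) * fixer_sum g i j r)"
    by (intro sum.cong refl)
      (simp add: entry_sum_translate[of _ g i j j] assms distrib_right \<theta>_add)
  finally show ?thesis
    by (simp add: entry_sum_def sum_distrib_right)
qed

text \<open>Coordinates before k stay on the row side, those from k on are Fourier transformed into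
  columns. The cut k = Suc i gives a pure column sum, which can be reflected; the cut k = n fits the
  characters whose subgroup constrains two rows.\<close>

lemma entry_sum_hybrid:
  assumes "i < k" "k \<le> j" "j < m" "r \<noteq> 0"
  shows "entry_sum g i j r =
    (\<Sum>a\<in>fixers_from g i k. \<Sum>d\<in>cofixers_to m g k j. \<theta> (r * bil m g a d))"
proof -
  have "entry_sum g i j r = (\<Sum>b\<in>fixers_from g i k.
      \<Sum>c\<in>{c \<in> vecs {k..<j}. \<forall>l\<in>{k..<j}. act g (b + c) l = 0}. \<theta> (r * bil m g (b + c) (unit_fun j)))"
    unfolding entry_sum_def sum_fixers_from_split[OF assms(1,2)] using assms
    by (simp add: bil_unit_fun_right)
  also have "\<dots> = (\<Sum>b\<in>fixers_from g i k. \<Sum>d\<in>{d \<in> vecs {k..<j}.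
      \<forall>l\<in>{k..<j}. colact m g (unit_fun j + d) l = 0}. \<theta> (r * bil m g b (unit_fun j + d)))"
    by (intro sum.cong[OF refl] fourier_swap) (use assms in auto)
  also have "\<dots> = (\<Sum>a\<in>fixers_from g i k. \<Sum>d\<in>cofixers_to m g k j. \<theta> (r * bil m g a d))"
  proof (rule sum.cong[OF refl])
    fix a
    show "(\<Sum>d\<in>{d \<in> vecs {k..<j}. \<forall>l\<in>{k..<j}. colact m g (unit_fun j + d) l = 0}.
        \<theta> (r * bil m g a (unit_fun j + d))) = (\<Sum>d\<in>cofixers_to m g k j. \<theta> (r * bil m g a d))"
      by (rule sum.reindex_bij_witness[of _ "\<lambda>d. d - unit_fun j" "\<lambda>d. unit_fun j + d"])
        (use assms in \<open>auto simp: cofixers_to_def vecs_def unit_fun_def\<close>)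
  qed
  finally show ?thesis .
qed

text \<open>For r = 0 the character disappears, and the swap is applied with scalar 1 and d0 = 0
  instead. This is why the column vectors carry no normalised last coordinate here.\<close>

lemma entry_sum_zero_hybrid:
  assumes "i < k" "k \<le> j" "j \<le> m"
  shows "entry_sum g i j 0 =
    (\<Sum>a\<in>fixers_from g i k. \<Sum>d\<in>cofixers m g k j. \<theta> (bil m g a d))"
proof -
  have bil0: "bil m g a 0 = 0" for a
    by (simp add: bil_def)
  have "entry_sum g i j 0 = (\<Sum>b\<in>fixers_from g i k.
      \<Sum>c\<in>{c \<in> vecs {k..<j}. \<forall>l\<in>{k..<j}. act g (b + c) l = 0}. \<theta> (1 * bil m g (b + c) 0))"
    unfolding entry_sum_def sum_fixers_from_split[OF assms(1,2)] by (simp add: bil0)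
  also have "\<dots> = (\<Sum>b\<in>fixers_from g i k. \<Sum>d\<in>{d \<in> vecs {k..<j}.
      \<forall>l\<in>{k..<j}. colact m g (0 + d) l = 0}. \<theta> (1 * bil m g b (0 + d)))"
    by (intro sum.cong[OF refl] fourier_swap) (use assms in auto)
  finally show ?thesis
    by (simp add: cofixers_def)
qed

text \<open>Passing to columns makes the count of fixed vectors a linear sum over
  \<open>cofixers m g (Suc i) j\<close>, which is sorted by the last nonzero coordinate l. The
  counterpart of \<open>fixer_sum_expand\<close>: the entries now lie in row i to the left of j
  instead of in column j below i.\<close>

lemma entry_sum_zero_expand:
  assumes "i < j" "j \<le> m"
  shows "entry_sum g i j 0 = 1 + (\<Sum>l\<in>{i<..<j}. \<Sum>t\<in>-{0}. entry_sum g i l t)"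
proof -
  have "(\<Sum>d\<in>cofixers m g (Suc i) j. \<theta> (colact m g d i)) =
      1 + (\<Sum>l\<in>{i<..<j}. \<Sum>t\<in>-{0}. entry_sum g i l t)"
    using assms
  proof (induction j)
    case (Suc j)
    show ?case
    proof (cases "i < j")
      case False
      then have "{i<..<Suc j} = {}" "cofixers m g (Suc i) (Suc j) = {0}"
        by (auto simp: cofixers_def vecs_def fun_eq_iff)
      then show ?thesis by (simp add: colact_def)
    next
      case True
      then have ivl: "{i<..<Suc j} = insert j {i<..<j}" by auto
      have "(\<Sum>d\<in>cofixers m g (Suc i) (Suc j). \<theta> (colact m g d i)) =
          (\<Sum>d\<in>cofixers m g (Suc i) j. \<theta> (colact m g d i)) +
          (\<Sum>t\<in>-{0}. \<Sum>d\<in>cofixers_to m g (Suc i) j. \<theta> (t * colact m g d i))"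
        by (subst sum_split_at_zero[where x = j])
          (use True in \<open>auto simp: cofixers_Suc colact_scale\<close>,
           auto simp: cofixers_def vecs_def colact_scale)
      \<comment> \<open>The hybrid formula at k = Suc i, read backwards, turns the column vectors
        ending at j into a row sum again.\<close>
      also have "(\<Sum>t\<in>-{0}. \<Sum>d\<in>cofixers_to m g (Suc i) j. \<theta> (t * colact m g d i)) =
          (\<Sum>t\<in>-{0}. entry_sum g i j t)"
        by (rule sum.cong[OF refl], subst entry_sum_hybrid[of i "Suc i" j m])
          (use True Suc.prems in \<open>auto simp: fixers_from_Suc bil_unit_fun\<close>)
      finally show ?thesis
        using True Suc by (simp add: ivl algebra_simps)
    qed
  qed simp
  then show ?thesis
    using assms by (subst entry_sum_zero_hybrid[of i "Suc i" j m]) (auto simp: fixers_from_Suc bil_unit_fun)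
qed

end

section \<open>The unitriangular group as an isometry group\<close>

lemma unitriangular_inverse:
  fixes x :: "'a::field mat"
  assumes "x \<in> unitriangular n"
  obtains y where "y \<in> carrier_mat n n" "inverts_mat x y" "inverts_mat y x"
proof -
  have x: "x \<in> carrier_mat n n" "upper_triangular x" "diag_mat x = map (\<lambda>_. 1) [0..<n]"
    using assms by (auto simp: unitriangular_def diag_mat_def)
  then have "det x = 1"
    by (simp add: det_upper_triangular map_replicate_const)
  with x(1) have "x \<in> Units (ring_mat TYPE('a) n undefined)"
    by (intro det_non_zero_imp_unit) auto
  then show ?thesis
    using x(1) that by (auto simp: Units_def ring_mat_def inverts_mat_def)
qed

lemma index_mult_sum:
  "A \<in> carrier_mat p q \<Longrightarrow> B \<in> carrier_mat q s \<Longrightarrow> i < p \<Longrightarrow> j < s \<Longrightarrow>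
    (A * B) $$ (i, j) = (\<Sum>l<q. A $$ (i, l) * B $$ (l, j))"
  by (auto simp: scalar_prod_def intro!: sum.cong)

lemma antidiag_carrier [simp]: "antidiag n \<in> carrier_mat n n"
  by (simp add: antidiag_def)

lemma antidiag_left:
  fixes A :: "'a::field mat"
  assumes "A \<in> carrier_mat n c" "i < n" "j < c"
  shows "(antidiag n * A) $$ (i, j) = A $$ (n - 1 - i, j)"
proof -
  have eq: "i + l + 1 = n \<longleftrightarrow> l = n - 1 - i" for l
    using assms by auto
  show ?thesis
    using assms
    by (subst index_mult_sum[OF antidiag_carrier, where s = c])
      (simp_all add: antidiag_def eq[simplified] if_distrib[of "\<lambda>x. x * _"] cong: if_cong)
qed

lemma antidiag_right:
  fixes A :: "'a::field mat"
  assumes "A \<in> carrier_mat c n" "i < c" "j < n"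
  shows "(A * antidiag n) $$ (i, j) = A $$ (i, n - 1 - j)"
proof -
  have eq: "l + j + 1 = n \<longleftrightarrow> l = n - 1 - j" for l
    using assms by auto
  show ?thesis
    using assms
    by (subst index_mult_sum[OF _ antidiag_carrier, where p = c])
      (simp_all add: antidiag_def eq[simplified] if_distrib[of "\<lambda>x. _ * x"] cong: if_cong)
qed

lemma four_block_index:
  assumes "A \<in> carrier_mat p p'" "B \<in> carrier_mat p q'" "C \<in> carrier_mat q p'" "D \<in> carrier_mat q q'"
    and "i < p + q" "j < p' + q'"
  shows "four_block_mat A B C D $$ (i, j) = (if i < p then if j < p' then A $$ (i, j) else B $$ (i, j - p')
    else if j < p' then C $$ (i - p, j) else D $$ (i - p, j - p'))"
  using assms by (simp add: index_mat_four_block)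

locale classical_type =
  fixes T :: series and n :: nat
begin

abbreviation m :: nat where "m \<equiv> mat_dim T n"
abbreviation mid :: nat where "mid \<equiv> middle_dim T"

definition rf :: "nat \<Rightarrow> nat" where "rf i = m - Suc i"

definition eps :: "'a::field" where "eps = (if T = Symplectic then -1 else 1)"

text \<open>The signs of the Gram matrix. In the odd orthogonal type the middle index n counts with
  the second half, consistently, as \<open>eps\<close> is 1 there.\<close>

definition sg :: "nat \<Rightarrow> 'a::field" where "sg k = (if n \<le> k then eps else 1)"

lemma m_eq: "m = n + mid + n"
  by (simp add: mat_dim_def)

lemma mid_le: "mid \<le> 1" and mid_eps: "mid = 0 \<or> eps = (1 :: 'a::field)"
  by (auto simp: middle_dim_def eps_def split: series.splits)

lemma eps_eps [simp]: "eps * eps = (1 :: 'a::field)"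
  by (simp add: eps_def)

lemma sg_sg [simp]: "sg k * sg k = (1 :: 'a::field)"
  by (simp add: sg_def)

lemma sg_nonzero [simp]: "sg k \<noteq> (0 :: 'a::field)"
  by (simp add: sg_def eps_def)

lemma rf_less [simp]: "i < m \<Longrightarrow> rf i < m"
  by (auto simp: rf_def)

lemma rf_rf [simp]: "i < m \<Longrightarrow> rf (rf i) = i"
  by (auto simp: rf_def)

lemma rf_less_iff: "i < m \<Longrightarrow> j < m \<Longrightarrow> rf i < rf j \<longleftrightarrow> j < i"
  by (auto simp: rf_def)

lemma rf_eq_iff [simp]: "i < m \<Longrightarrow> j < m \<Longrightarrow> rf i = rf j \<longleftrightarrow> j = i"
  by (auto simp: rf_def)

lemma n_less [simp]: "i < n \<Longrightarrow> i < m"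
  by (simp add: m_eq)

lemma rf_ge: "i < n \<Longrightarrow> n + mid \<le> rf i"
  by (simp add: rf_def m_eq)

lemma sum_rf: "(\<Sum>k<m. f (rf k)) = (\<Sum>k<m. f k)"
  by (simp add: rf_def sum.nat_diff_reindex)

lemma index_cases:
  assumes "p < m"
  obtains "p < n" | k where "k < mid" "p = n + k" | a where "a < n" "p = rf a"
proof -
  consider "p < n" | "n \<le> p" "p < n + mid" | "n + mid \<le> p"
    by linarith
  then show ?thesis
  proof cases
    case 2
    then show ?thesis
      using that(2)[of "p - n"] by auto
  next
    case 3
    then have "rf p < n" "p = rf (rf p)"
      using assms by (auto simp: rf_def m_eq)
    then show ?thesis
      using that(3) by blast
  qed (use that in blast)
qed

lemma sum_split: "(\<Sum>k<m. f k) = (\<Sum>k<n. f k) + (\<Sum>k<mid. f (n + k)) + (\<Sum>k<n. f (rf k) :: 'a::field)"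
proof -
  have "(\<Sum>k<m. f k) = (\<Sum>k<n + mid. f k) + (\<Sum>k\<in>{n + mid..<n + mid + n}. f k)"
    by (simp add: m_eq lessThan_atLeast0 sum.atLeastLessThan_concat)
  moreover have "(\<Sum>k<n + mid. f k) = (\<Sum>k<n. f k) + (\<Sum>k\<in>{n..<n + mid}. f k)"
    by (simp add: lessThan_atLeast0 sum.atLeastLessThan_concat)
  moreover have "(\<Sum>k\<in>{n..<n + mid}. f k) = (\<Sum>k<mid. f (n + k))"
    by (rule sum.reindex_bij_witness[of _ "\<lambda>k. n + k" "\<lambda>k. k - n"]) auto
  moreover have "(\<Sum>k\<in>{n + mid..<n + mid + n}. f k) = (\<Sum>k<n. f (rf k))"
    by (rule sum.reindex_bij_witness[of _ rf rf]) (auto simp: rf_def m_eq)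
  ultimately show ?thesis by simp
qed

text \<open>The invariant form on row vectors: hyperbolic planes on the positions k and
  \<open>rf k\<close>, plus the product of the middle coordinates in the odd orthogonal
  type.\<close>

definition pairing :: "(nat \<Rightarrow> 'a::field) \<Rightarrow> (nat \<Rightarrow> 'a) \<Rightarrow> 'a" where
  "pairing a b = (\<Sum>k<m. sg k * a k * b (rf k))"

lemma rf_mid: "k < mid \<Longrightarrow> rf (n + k) = n + k"
  using mid_le by (auto simp: rf_def m_eq)

lemma pairing_split:
  "pairing a b = (\<Sum>k<n. a k * b (rf k)) + (\<Sum>k<mid. a (n + k) * b (n + k)) +
    eps * (\<Sum>k<n. a (rf k) * b k :: 'a::field)"
proof -
  have "sg (rf k) = (eps :: 'a)" if "k < n" for k
    using rf_ge[OF that] by (simp add: sg_def)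
  moreover have "sg (n + k) = (1 :: 'a)" if "k < mid" for k
    using mid_eps[where ?'a = 'a] that by (simp add: sg_def)
  moreover have "sg k = (1 :: 'a)" if "k < n" for k
    using that by (simp add: sg_def)
  ultimately show ?thesis
    unfolding pairing_def sum_split
    by (simp add: rf_mid sum_distrib_left mult.assoc)
qed

lemma pairing_commute: "pairing b a = eps * (pairing a b :: 'a::field)"
proof -
  have "eps * (eps * c) = c" for c :: 'a
    by (simp flip: mult.assoc)
  then show ?thesis
    using mid_eps[where ?'a = 'a]
    by (auto simp: pairing_split distrib_left mult.commute[of "b _"])
qed

abbreviation row_fun :: "'a mat \<Rightarrow> nat \<Rightarrow> nat \<Rightarrow> 'a" where
  "row_fun g i \<equiv> \<lambda>k. g $$ (i, k)"

lemma block_element_entries: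
  fixes x y u z :: "'a::field mat"
  assumes x: "x \<in> carrier_mat n n" and y: "y \<in> carrier_mat n n" and u: "u \<in> carrier_mat n mid"
    and z: "z \<in> carrier_mat n n"
  defines "g \<equiv> block_element T n x y u z"
  shows "g \<in> carrier_mat m m"
    and "i < n \<Longrightarrow> j < n \<Longrightarrow> g $$ (i, j) = x $$ (i, j)"
    and "i < n \<Longrightarrow> k < mid \<Longrightarrow> g $$ (i, n + k) = (\<Sum>l<n. x $$ (i, l) * u $$ (l, k))"
    and "i < n \<Longrightarrow> b < n \<Longrightarrow> g $$ (i, rf b) = (\<Sum>l<n. x $$ (i, l) * z $$ (l, n - 1 - b))"
    and "k < mid \<Longrightarrow> j < n \<Longrightarrow> g $$ (n + k, j) = 0"
    and "k < mid \<Longrightarrow> k' < mid \<Longrightarrow> g $$ (n + k, n + k') = (if k = k' then 1 else 0)"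
    and "k < mid \<Longrightarrow> b < n \<Longrightarrow> g $$ (n + k, rf b) = - u $$ (b, k)"
    and "a < n \<Longrightarrow> j < n + mid \<Longrightarrow> g $$ (rf a, j) = 0"
    and "a < n \<Longrightarrow> b < n \<Longrightarrow> g $$ (rf a, rf b) = y $$ (b, a)"
proof -
  let ?A = "four_block_mat x (x * u) (0\<^sub>m mid n) (1\<^sub>m mid)"
  let ?B = "(x * z) @\<^sub>r (- (transpose_mat u * antidiag n))"
  let ?D = "antidiag n * transpose_mat y * antidiag n"
  have A: "?A \<in> carrier_mat (n + mid) (n + mid)" and B: "?B \<in> carrier_mat (n + mid) n"
    and D: "?D \<in> carrier_mat n n"
    using x y u z by (auto simp: antidiag_def)
  have g: "g = four_block_mat ?A ?B (0\<^sub>m n (n + mid)) ?D"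
    by (simp add: g_def block_element_def Let_def)
  show car: "g \<in> carrier_mat m m"
    unfolding g m_eq using four_block_carrier_mat[OF A D] by (simp add: add.commute)
  have ind: "g $$ (p, q) = (if p < n + mid then if q < n + mid then ?A $$ (p, q) else ?B $$ (p, q - (n + mid))
      else if q < n + mid then 0 else ?D $$ (p - (n + mid), q - (n + mid)))" if "p < m" "q < m" for p q
    unfolding g using that four_block_index[OF A B zero_carrier_mat D, where i = p and j = q]
    by (auto simp: m_eq)
  have Ai: "?A $$ (p, q) = (if p < n then if q < n then x $$ (p, q) else (x * u) $$ (p, q - n)
      else if q < n then 0 else if p = q then 1 else 0)" if "p < n + mid" "q < n + mid" for p q
    using that four_block_index[OF x mult_carrier_mat[OF x u] zero_carrier_mat one_carrier_mat, where i = p and j = q]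
    by auto
  have Bi: "?B $$ (p, q) = (if p < n then (x * z) $$ (p, q) else - (transpose_mat u * antidiag n) $$ (p - n, q))"
    if "p < n + mid" "q < n" for p q
  proof -
    have V: "- (transpose_mat u * antidiag n) \<in> carrier_mat mid n"
      using u by (auto simp: antidiag_def)
    have um: "(- (transpose_mat u * antidiag n)) $$ (p - n, q) = - (transpose_mat u * antidiag n) $$ (p - n, q)"
      if "\<not> p < n"
      using \<open>p < n + mid\<close> \<open>q < n\<close> that u by (intro index_uminus_mat) (auto simp: antidiag_def)
    have B_eq: "?B = four_block_mat (x * z) (0\<^sub>m n 0) (- (transpose_mat u * antidiag n)) (0\<^sub>m mid 0)"
      using x u by (simp add: append_rows_def)
    show ?thesis
      unfolding B_eq
      using that um four_block_index[OF mult_carrier_mat[OF x z] zero_carrier_mat V zero_carrier_mat, where i = p and j = q]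
        by auto
  qed
  have rfsub: "rf b - (n + mid) = n - 1 - b" "n - 1 - b < n" "n - 1 - (n - 1 - b) = b" "rf b < m"
    "n + mid \<le> rf b" if "b < n" for b
    using that by (auto simp: rf_def m_eq)
  show "g $$ (i, j) = x $$ (i, j)" if "i < n" "j < n"
    using that by (simp add: ind Ai)
  show "g $$ (i, n + k) = (\<Sum>l<n. x $$ (i, l) * u $$ (l, k))" if "i < n" "k < mid"
    using that m_eq by (simp add: ind Ai index_mult_sum[OF x u])
  show "g $$ (i, rf b) = (\<Sum>l<n. x $$ (i, l) * z $$ (l, n - 1 - b))" if "i < n" "b < n"
    using that rfsub[OF that(2)] by (simp add: ind Bi index_mult_sum[OF x z])
  show "g $$ (n + k, j) = 0" if "k < mid" "j < n"
    using that m_eq by (simp add: ind Ai)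
  show "g $$ (n + k, n + k') = (if k = k' then 1 else 0)" if "k < mid" "k' < mid"
    using that m_eq by (simp add: ind Ai)
  show "g $$ (n + k, rf b) = - u $$ (b, k)" if "k < mid" "b < n"
    using that rfsub[OF that(2)] m_eq u
    by (simp add: ind Bi antidiag_right[where c = mid])
  show "g $$ (rf a, j) = 0" if "a < n" "j < n + mid"
    using that rfsub[OF that(1)] m_eq by (simp add: ind)
  show "g $$ (rf a, rf b) = y $$ (b, a)" if "a < n" "b < n"
  proof -
    have "antidiag n * transpose_mat y \<in> carrier_mat n n"
      using y by (auto simp: antidiag_def)
    then show ?thesis
      using rfsub[OF that(1)] rfsub[OF that(2)] y
      by (simp add: ind antidiag_right[where c = n] antidiag_left[where c = n] del: index_mult_mat)
  qed
qed

text \<open>In terms of Z = z J all three types read Z^T + eps Z + u u^T = 0. This uniform shape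
  lets \<open>eps\<close> and \<open>mid\<close> replace most case distinctions on the type.\<close>

lemma block_condition_iff:
  fixes u z :: "'a::field mat"
  assumes u: "u \<in> carrier_mat n mid" and z: "z \<in> carrier_mat n n"
  shows "block_condition T n u z \<longleftrightarrow> (\<forall>a<n. \<forall>b<n.
    z $$ (b, n - 1 - a) + eps * z $$ (a, n - 1 - b) + (\<Sum>k<mid. u $$ (a, k) * u $$ (b, k)) = 0)"
proof -
  have zt: "transpose_mat z \<in> carrier_mat n n" and ut: "transpose_mat u \<in> carrier_mat mid n"
    using u z by auto
  have l: "(antidiag n * transpose_mat z) $$ (a, b) = z $$ (b, n - 1 - a)" if "a < n" "b < n" for a b
    using antidiag_left[OF zt that] that z by simp
  have r: "(z * antidiag n) $$ (a, b) = z $$ (a, n - 1 - b)" if "a < n" "b < n" for a b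
    using antidiag_right[OF z that] .
  have uu: "(u * transpose_mat u) $$ (a, b) = (\<Sum>k<mid. u $$ (a, k) * u $$ (b, k))" if "a < n" "b < n" for a b
    using index_mult_sum[OF u ut that] u that by simp
  have d: "dim_row (antidiag n :: 'a mat) = n" "dim_col (antidiag n :: 'a mat) = n"
    by (auto simp: antidiag_def)
  show ?thesis
    using z u d
    by (cases T) (auto simp: mat_eq_iff l r uu classical_type.eps_def middle_dim_def eq_neg_iff_add_eq_0
        simp del: index_mult_mat(1))
qed

definition isometric :: "'a::field mat \<Rightarrow> bool" where
  "isometric g \<longleftrightarrow> (\<forall>i<m. \<forall>j<m. pairing (row_fun g i) (row_fun g j) = (if j = rf i then sg i else 0))"

text \<open>Block by block: two upper rows pair to an entry of x (Z^T + eps Z + u u^T) x^T with Z =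
  z J, which the block condition kills; an upper and a lower row give an entry of x y = 1; for an
  upper and a middle row the block - u^T J cancels x u.\<close>

lemma block_element_isometric:
  fixes x y u z :: "'a::field mat"
  assumes x: "x \<in> carrier_mat n n" and y: "y \<in> carrier_mat n n" and u: "u \<in> carrier_mat n mid"
    and z: "z \<in> carrier_mat n n" and xy: "inverts_mat x y" and bc: "block_condition T n u z"
  shows "isometric (block_element T n x y u z)"
proof -
  let ?g = "block_element T n x y u z"
  note g = block_element_entries[OF x y u z]
  have xy': "(\<Sum>l<n. x $$ (i, l) * y $$ (l, j)) = (if i = j then 1 else 0)" if "i < n" "j < n" for i j
    using xy x y that index_mult_sum[OF x y that] by (auto simp: inverts_mat_def)
  let ?P = "\<lambda>i j. pairing (row_fun ?g i) (row_fun ?g j)"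
  have top_top: "?P i j = 0" if "i < n" "j < n" for i j
  proof -
    let ?Z = "\<lambda>l k. z $$ (l, n - 1 - k)"
    let ?u = "\<lambda>l k. u $$ (l, k)"
    have "?P i j = (\<Sum>k<n. x $$ (i, k) * (\<Sum>l<n. x $$ (j, l) * ?Z l k)) +
      (\<Sum>k<mid. (\<Sum>p<n. x $$ (i, p) * ?u p k) * (\<Sum>l<n. x $$ (j, l) * ?u l k)) +
      eps * (\<Sum>l<n. (\<Sum>k<n. x $$ (i, k) * ?Z k l) * x $$ (j, l))"
      using that by (simp add: pairing_split g)
    also have "(\<Sum>k<mid. (\<Sum>p<n. x $$ (i, p) * ?u p k) * (\<Sum>l<n. x $$ (j, l) * ?u l k)) =
      (\<Sum>k<n. \<Sum>l<n. x $$ (i, k) * x $$ (j, l) * (\<Sum>q<mid. ?u k q * ?u l q))"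
    proof -
      have "(\<Sum>k<mid. (\<Sum>p<n. x $$ (i, p) * ?u p k) * (\<Sum>l<n. x $$ (j, l) * ?u l k)) =
          (\<Sum>k<n. \<Sum>q<mid. \<Sum>l<n. x $$ (i, k) * ?u k q * (x $$ (j, l) * ?u l q))"
        unfolding sum_product by (rule sum.swap)
      also have "\<dots> = (\<Sum>k<n. \<Sum>l<n. \<Sum>q<mid. x $$ (i, k) * ?u k q * (x $$ (j, l) * ?u l q))"
        by (rule sum.cong[OF refl], rule sum.swap)
      finally show ?thesis
        by (simp add: sum_distrib_left algebra_simps)
    qed
    also have "(\<Sum>l<n. (\<Sum>k<n. x $$ (i, k) * ?Z k l) * x $$ (j, l)) =
      (\<Sum>k<n. \<Sum>l<n. x $$ (i, k) * x $$ (j, l) * ?Z k l)"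
      unfolding sum_distrib_right by (subst sum.swap) (simp add: algebra_simps)
    finally have "?P i j = (\<Sum>k<n. \<Sum>l<n. x $$ (i, k) * x $$ (j, l) *
        (?Z l k + eps * ?Z k l + (\<Sum>q<mid. ?u k q * ?u l q)))"
      by (simp add: sum_distrib_left sum.distrib algebra_simps)
    also have "\<dots> = 0"
      using bc unfolding block_condition_iff[OF u z] by (intro sum.neutral ballI) simp
    finally show ?thesis .
  qed
  have top_mid: "?P i (n + k) = 0" if "i < n" "k < mid" for i k
  proof -
    have "?P i (n + k) = (\<Sum>l<n. x $$ (i, l) * - u $$ (l, k)) +
      (\<Sum>k'<mid. (\<Sum>l<n. x $$ (i, l) * u $$ (l, k')) * (if k = k' then 1 else 0))"
      using that by (simp add: pairing_split g)
    also have "\<dots> = 0"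
      using that by (simp add: if_distrib sum_negf cong: if_cong)
    finally show ?thesis .
  qed
  have top_bot: "?P i (rf a) = (if i = a then 1 else 0)" if "i < n" "a < n" for i a
    using that by (simp add: pairing_split g xy')
  have mid_mid: "?P (n + k) (n + k) = 1" if "k < mid" for k
    using that by (simp add: pairing_split g if_distrib cong: if_cong)
  have mid_bot: "?P (n + k) (rf a) = 0" if "k < mid" "a < n" for k a
    using that by (simp add: pairing_split g)
  have bot_bot: "?P (rf a) (rf b) = 0" if "a < n" "b < n" for a b
    using that by (simp add: pairing_split g)
  have sgs: "sg i = (1 :: 'a)" "sg (rf i) = (eps :: 'a)" if "i < n" for i
    using that rf_ge[of i] by (auto simp: sg_def)
  have sgm: "sg (n + k) = (1 :: 'a)" if "k < mid" for k
    using mid_eps[where ?'a = 'a] that by (simp add: sg_def)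
  show ?thesis
    unfolding isometric_def
  proof (intro allI impI)
    fix p q assume p: "p < m" and q: "q < m"
    have mm: "k < mid \<Longrightarrow> k' < mid \<Longrightarrow> k = k'" for k k'
      using mid_le by auto
    have rn: "i < n \<Longrightarrow> a < n \<Longrightarrow> i \<noteq> rf a" "k < mid \<Longrightarrow> a < n \<Longrightarrow> n + k \<noteq> rf a" for i a k
      using rf_ge[of a] by auto
    show "?P p q = (if q = rf p then sg p else 0)"
      using p
    proof (cases rule: index_cases)
      case 1
      show ?thesis using q
      proof (cases rule: index_cases)
        case 1
        then show ?thesis using top_top[OF \<open>p < n\<close>] rn \<open>p < n\<close> by auto
      next
        case (2 k)
        then show ?thesis using top_mid[OF \<open>p < n\<close>] rn \<open>p < n\<close> by auto
      next
        case (3 a)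
        then show ?thesis using top_bot[OF \<open>p < n\<close>] sgs \<open>p < n\<close> by auto
      qed
    next
      case (2 k)
      show ?thesis using q
      proof (cases rule: index_cases)
        case 1
        then show ?thesis
          using top_mid[of q k] 2 pairing_commute[of "row_fun ?g p" "row_fun ?g q"] rf_mid by auto
      next
        case (2 k')
        then show ?thesis using mid_mid mm[of k k'] rf_mid sgm \<open>k < mid\<close> \<open>p = n + k\<close> by auto
      next
        case (3 a)
        then show ?thesis using mid_bot[of k a] rf_mid \<open>k < mid\<close> \<open>p = n + k\<close> rn(2)[of k a] by auto
      qed
    next
      case (3 a)
      show ?thesis using q
      proof (cases rule: index_cases)
        case 1
        then show ?thesis
          using top_bot[of q a] 3 pairing_commute[of "row_fun ?g p" "row_fun ?g q"] sgs by auto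
      next
        case (2 k)
        then show ?thesis
          using mid_bot[of k a] 3 pairing_commute[of "row_fun ?g p" "row_fun ?g q"] rf_mid
            rf_rf[of a] by auto
      next
        case (3 b)
        then show ?thesis using bot_bot[of a b] \<open>a < n\<close> \<open>p = rf a\<close> rn(1)[of a b] by auto
      qed
    qed
  qed
qed

lemma cancel_unitriangular:
  fixes x y :: "'a::field mat"
  assumes "x \<in> carrier_mat n n" "y \<in> carrier_mat n n" "inverts_mat y x"
    and "\<And>i. i < n \<Longrightarrow> (\<Sum>k<n. x $$ (i, k) * w k) = 0" and "l < n"
  shows "w l = 0"
proof -
  have yx: "(\<Sum>i<n. y $$ (l, i) * x $$ (i, k)) = (if l = k then 1 else 0)" if "k < n" for k
    using assms that index_mult_sum[OF assms(2,1) \<open>l < n\<close> that] by (auto simp: inverts_mat_def)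
  have "0 = (\<Sum>i<n. y $$ (l, i) * (\<Sum>k<n. x $$ (i, k) * w k))"
    using assms(4) by simp
  also have "\<dots> = (\<Sum>k<n. (\<Sum>i<n. y $$ (l, i) * x $$ (i, k)) * w k)"
    unfolding sum_distrib_left sum_distrib_right mult.assoc by (rule sum.swap)
  also have "\<dots> = w l"
    using \<open>l < n\<close> by (simp add: yx if_distrib[of "\<lambda>x. x * _"] cong: if_cong)
  finally show ?thesis by simp
qed

end

section \<open>Inverses and products of unitriangular matrices\<close>

lemma unitriangularD:
  assumes "x \<in> unitriangular p"
  shows "x \<in> carrier_mat p p" "i < p \<Longrightarrow> x $$ (i, i) = 1" "j < i \<Longrightarrow> i < p \<Longrightarrow> x $$ (i, j) = 0"
  using assms by (auto simp: unitriangular_def)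

lemma unitriangularI:
  assumes "x \<in> carrier_mat p p" "\<And>i. i < p \<Longrightarrow> x $$ (i, i) = 1"
    "\<And>i j. j < i \<Longrightarrow> i < p \<Longrightarrow> x $$ (i, j) = 0"
  shows "x \<in> unitriangular p"
  using assms by (auto simp: unitriangular_def)

text \<open>Back substitution from the last row upwards: row i of x y = 1 expresses the entry of y
  at (i, j) through entries of column j in lower rows, which vanish already when j <= i.\<close>

lemma inverse_unitriangular:
  fixes x y :: "'a::field mat"
  assumes x: "x \<in> unitriangular p" and y: "y \<in> carrier_mat p p" and xy: "inverts_mat x y"
  shows "y \<in> unitriangular p"
proof -
  note xD = unitriangularD[OF x]
  have "y $$ (i, j) = (if i = j then 1 else 0)" if "j \<le> i" "i < p" for i j
    using that
  proof (induction "p - i" arbitrary: i rule: less_induct)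
    case less
    have "(if i = j then 1 else 0) = (\<Sum>l<p. x $$ (i, l) * y $$ (l, j))"
      using index_mult_sum[OF xD(1) y, of i j] xy less.prems xD(1) by (auto simp: inverts_mat_def)
    also have "\<dots> = (\<Sum>l<p. if l = i then y $$ (i, j) else 0)"
    proof (intro sum.cong refl)
      fix l assume "l \<in> {..<p}"
      then show "x $$ (i, l) * y $$ (l, j) = (if l = i then y $$ (i, j) else 0)"
        using less.hyps[of l] less.prems xD by (cases l i rule: linorder_cases) auto
    qed
    finally show ?case
      using less.prems by simp
  qed
  then show ?thesis
    using y by (intro unitriangularI) auto
qed

lemma mult_unitriangular:
  fixes x y :: "'a::field mat"
  assumes x: "x \<in> unitriangular p" and y: "y \<in> unitriangular p"
  shows "x * y \<in> unitriangular p"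
proof -
  note xD = unitriangularD[OF x] and yD = unitriangularD[OF y]
  have "(x * y) $$ (i, j) = (if i = j then 1 else 0)" if "j \<le> i" "i < p" for i j
  proof -
    have "(x * y) $$ (i, j) = (\<Sum>l<p. x $$ (i, l) * y $$ (l, j))"
      using that by (intro index_mult_sum[OF xD(1) yD(1)]) auto
    also have "\<dots> = (\<Sum>l<p. if l = i then y $$ (i, j) else 0)"
    proof (intro sum.cong refl)
      fix l assume "l \<in> {..<p}"
      then show "x $$ (i, l) * y $$ (l, j) = (if l = i then y $$ (i, j) else 0)"
        using that xD yD by (cases l i rule: linorder_cases) auto
    qed
    finally show ?thesis
      using that yD by auto
  qed
  then show ?thesis
    using xD yD by (intro unitriangularI) auto
qed

context classical_type
begin

lemma block_element_unitriangular:
  fixes x y u z :: "'a::field mat"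
  assumes x: "x \<in> unitriangular n" and y: "y \<in> carrier_mat n n" and u: "u \<in> carrier_mat n mid"
    and z: "z \<in> carrier_mat n n" and xy: "inverts_mat x y"
  shows "block_element T n x y u z \<in> unitriangular m"
proof (rule unitriangularI)
  note xD = unitriangularD[OF x] and yD = unitriangularD[OF inverse_unitriangular[OF x y xy]]
  note g = block_element_entries[OF xD(1) y u z]
  show "block_element T n x y u z \<in> carrier_mat m m" by (rule g)
  fix i assume "i < m"
  then show "block_element T n x y u z $$ (i, i) = 1"
    by (cases rule: index_cases) (auto simp: g xD yD)
  fix j assume "j < i"
  with \<open>i < m\<close> have "j < m" by simp
  from \<open>i < m\<close> show "block_element T n x y u z $$ (i, j) = 0"
  proof (cases rule: index_cases)
    case 1
    then show ?thesis using \<open>j < i\<close> by (auto simp: g xD)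
  next
    case (2 k)
    then have "j < n" using mid_le \<open>j < i\<close> by auto
    then show ?thesis using 2 by (auto simp: g)
  next
    case (3 a)
    from \<open>j < m\<close> show ?thesis
    proof (cases rule: index_cases)
      case 1
      then show ?thesis using 3 by (auto simp: g)
    next
      case (2 k)
      then show ?thesis using 3 by (auto simp: g)
    next
      case (3 b)
      then show ?thesis using \<open>j < i\<close> \<open>a < n\<close> \<open>i = rf a\<close> by (auto simp: g yD rf_less_iff)
    qed
  qed
qed

text \<open>The upper rows of g determine x, u and z by solving with x^-1. Pairing them with the
  middle and lower rows forces the remaining blocks, because x can be cancelled; pairing them with
  each other gives the block condition after x is cancelled on both sides.\<close>

lemma U_setI:
  fixes g :: "'a::field mat"
  assumes g: "g \<in> unitriangular m" and iso: "isometric g"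
  shows "g \<in> U_set T n"
proof -
  note gD = unitriangularD[OF g]
  define x where "x = mat n n (\<lambda>(i, j). g $$ (i, j))"
  have x: "x \<in> unitriangular n"
    by (rule unitriangularI) (auto simp: x_def gD)
  obtain y where y: "y \<in> carrier_mat n n" "inverts_mat x y" "inverts_mat y x"
    using unitriangular_inverse[OF x] .
  note xc = unitriangularD(1)[OF x]
  have xe: "x $$ (i, j) = g $$ (i, j)" if "i < n" "j < n" for i j
    using that by (simp add: x_def)
  have xy: "(\<Sum>l<n. x $$ (i, l) * y $$ (l, j)) = (if i = j then 1 else 0)" if "i < n" "j < n" for i j
    using y xc that index_mult_sum[OF xc y(1) that] by (auto simp: inverts_mat_def)
  have solve: "(\<Sum>l<n. x $$ (i, l) * (\<Sum>p<n. y $$ (l, p) * w p)) = w i" if "i < n" for i w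
  proof -
    have "(\<Sum>l<n. x $$ (i, l) * (\<Sum>p<n. y $$ (l, p) * w p)) = (\<Sum>p<n. (\<Sum>l<n. x $$ (i, l) * y $$ (l, p)) * w p)"
      unfolding sum_distrib_left sum_distrib_right mult.assoc by (rule sum.swap)
    then show ?thesis
      using that by (simp add: xy if_distrib[of "\<lambda>x. x * _"] cong: if_cong)
  qed
  define u where "u = mat n mid (\<lambda>(l, k). \<Sum>p<n. y $$ (l, p) * g $$ (p, n + k))"
  \<comment> \<open>The last n columns are taken in matrix order, while \<open>rf\<close> enumerates
    them backwards; hence the index n - 1 - b in \<open>xz\<close>.\<close>
  define z where "z = mat n n (\<lambda>(l, c). \<Sum>p<n. y $$ (l, p) * g $$ (p, n + mid + c))"
  have uz: "u \<in> carrier_mat n mid" "z \<in> carrier_mat n n"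
    by (auto simp: u_def z_def)
  have xu: "(\<Sum>l<n. x $$ (i, l) * u $$ (l, k)) = g $$ (i, n + k)" if "i < n" "k < mid" for i k
    using that solve[of i "\<lambda>p. g $$ (p, n + k)"] by (simp add: u_def)
  have xz: "(\<Sum>l<n. x $$ (i, l) * z $$ (l, n - 1 - b)) = g $$ (i, rf b)" if "i < n" "b < n" for i b
  proof -
    have "rf b = n + mid + (n - 1 - b)"
      using that by (simp add: rf_def m_eq)
    then show ?thesis
      using that solve[of i "\<lambda>p. g $$ (p, rf b)"] by (simp add: z_def)
  qed
  note cancel = cancel_unitriangular[OF xc y(1) y(3)]
  let ?P = "\<lambda>i j. pairing (row_fun g i) (row_fun g j)"
  have P: "?P i j = (if j = rf i then sg i else 0)" if "i < m" "j < m" for i j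
    using iso that by (simp add: isometric_def)
  have nmid: "n + k < m" if "k < mid" for k
    using that by (simp add: m_eq)
  have low: "g $$ (rf a, k) = 0" if "a < n" "k < n + mid" for a k
    using gD(3)[of k "rf a"] that rf_ge[of a] by auto
  have sg1: "sg i = (1 :: 'a)" if "i < n" for i
    using that by (simp add: sg_def)
  have mm: "g $$ (n + k, n + k') = (if k = k' then 1 else 0)" if "k < mid" "k' < mid" for k k'
  proof -
    have "k = k'"
      using that mid_le by linarith
    then show ?thesis
      using gD(2)[OF nmid] that by simp
  qed
  have bottom: "g $$ (rf a, rf b) = y $$ (b, a)" if "a < n" "b < n" for a b
  proof -
    have "(\<lambda>k. g $$ (rf a, rf k) - y $$ (k, a)) b = 0"
    proof (rule cancel[OF _ that(2)])
      fix i assume i: "i < n"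
      have "(\<Sum>k<n. x $$ (i, k) * g $$ (rf a, rf k)) = ?P i (rf a)"
        using i that by (simp add: pairing_split low xe)
      also have "\<dots> = (if i = a then 1 else 0)"
        using i that P[of i "rf a"] sg1 by auto
      finally show "(\<Sum>k<n. x $$ (i, k) * (g $$ (rf a, rf k) - y $$ (k, a))) = 0"
        using xy[OF i that(1)] by (simp add: right_diff_distrib sum_subtractf)
    qed
    then show ?thesis by simp
  qed
  have middle: "g $$ (n + k, rf b) = - u $$ (b, k)" if "k < mid" "b < n" for k b
  proof -
    have "(\<lambda>l. g $$ (n + k, rf l) + u $$ (l, k)) b = 0"
    proof (rule cancel[OF _ that(2)])
      fix i assume i: "i < n"
      have "0 = ?P i (n + k)"
        using i that P[of i "n + k"] nmid rf_ge[of i] by auto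
      also have "\<dots> = (\<Sum>l<n. x $$ (i, l) * g $$ (n + k, rf l)) + g $$ (i, n + k)"
        using i that gD(3)[of _ "n + k"] nmid[of k]
        by (simp add: pairing_split xe mm if_distrib[of "\<lambda>x. _ * x"] cong: if_cong)
      finally show "(\<Sum>l<n. x $$ (i, l) * (g $$ (n + k, rf l) + u $$ (l, k))) = 0"
        using xu[OF i that(1)] by (simp add: distrib_left sum.distrib)
    qed
    then show ?thesis by (simp add: eq_neg_iff_add_eq_0)
  qed
  have g_eq: "g = block_element T n x y u z"
  proof (rule eq_matI)
    note be = block_element_entries[OF xc y(1) uz]
    show "dim_row g = dim_row (block_element T n x y u z)" "dim_col g = dim_col (block_element T n x y u z)"
      using be(1) gD(1) by auto
    fix i j assume "i < dim_row (block_element T n x y u z)" "j < dim_col (block_element T n x y u z)"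
    then have i: "i < m" and j: "j < m"
      using be(1) by auto
    show "g $$ (i, j) = block_element T n x y u z $$ (i, j)"
      using i
    proof (cases rule: index_cases)
      case 1
      show ?thesis
        using j
      proof (cases rule: index_cases)
        case 1
        then show ?thesis using \<open>i < n\<close> by (simp add: be xe)
      qed (use 1 in \<open>simp_all add: be xu xz[simplified]\<close>)
    next
      case (2 k)
      show ?thesis using j
      proof (cases rule: index_cases)
        case 1
        then show ?thesis using 2 nmid by (auto simp: be gD)
      next
        case (2 k')
        then show ?thesis using \<open>k < mid\<close> \<open>i = n + k\<close> by (simp add: be mm)
      next
        case (3 b)
        then show ?thesis using \<open>k < mid\<close> \<open>i = n + k\<close> by (simp add: be middle)
      qed
    next
      case (3 a)
      show ?thesis
        using j 3 by (cases rule: index_cases) (auto simp: be low bottom)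
    qed
  qed
  have "block_condition T n u z"
    unfolding block_condition_iff[OF uz]
  proof (intro allI impI)
    let ?Z = "\<lambda>l k. z $$ (l, n - 1 - k)"
    let ?M = "\<lambda>a b. ?Z b a + eps * ?Z a b + (\<Sum>k<mid. u $$ (a, k) * u $$ (b, k))"
    let ?xZ = "\<lambda>j k. \<Sum>l<n. x $$ (j, l) * ?Z k l"
    let ?ug = "\<lambda>j k. \<Sum>q<mid. u $$ (k, q) * g $$ (j, n + q)"
    fix a b assume ab: "a < n" "b < n"
    \<comment> \<open>Multiplication by x on one side turns part of the condition into entries of g.
      The multiplication on the other side, below, completes it to the pairing of two upper
      rows.\<close>
    have inner: "(\<Sum>l<n. x $$ (j, l) * ?M k l) = g $$ (j, rf k) +
      eps * ?xZ j k + ?ug j k"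
      if "j < n" "k < n" for j k
    proof -
      have "(\<Sum>l<n. x $$ (j, l) * (\<Sum>q<mid. u $$ (k, q) * u $$ (l, q))) =
        (\<Sum>q<mid. u $$ (k, q) * (\<Sum>l<n. x $$ (j, l) * u $$ (l, q)))"
        unfolding sum_distrib_left by (subst sum.swap) (simp add: algebra_simps)
      also have "\<dots> = ?ug j k"
        using that by (simp add: xu)
      finally have uu: "(\<Sum>l<n. x $$ (j, l) * (\<Sum>q<mid. u $$ (k, q) * u $$ (l, q))) =
        ?ug j k" .
      have "(\<Sum>l<n. x $$ (j, l) * (eps * ?Z k l)) = eps * ?xZ j k"
        unfolding sum_distrib_left by (simp add: mult.left_commute)
      then show ?thesis
        using that xz[of j k] uu by (simp add: distrib_left sum.distrib)
    qed
    have "(\<Sum>k<n. x $$ (i, k) * (\<Sum>l<n. x $$ (j, l) * ?M k l)) = 0" if "i < n" "j < n" for i j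
    proof -
      have "(\<Sum>k<n. x $$ (i, k) * (\<Sum>l<n. x $$ (j, l) * ?M k l)) =
          (\<Sum>k<n. x $$ (i, k) * g $$ (j, rf k)) +
          eps * (\<Sum>k<n. x $$ (i, k) * ?xZ j k) +
          (\<Sum>k<n. x $$ (i, k) * ?ug j k)"
      proof -
        have "(\<Sum>k<n. x $$ (i, k) * (eps * ?xZ j k)) =
            eps * (\<Sum>k<n. x $$ (i, k) * ?xZ j k)"
          unfolding sum_distrib_left[of eps "\<lambda>k. x $$ (i, k) * _ k"] by (simp add: mult.left_commute)
        moreover have "(\<Sum>k<n. x $$ (i, k) * (\<Sum>l<n. x $$ (j, l) * ?M k l)) =
            (\<Sum>k<n. x $$ (i, k) * (g $$ (j, rf k) + eps * ?xZ j k +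
              ?ug j k))"
          using that by (intro sum.cong refl arg_cong2[where f = "(*)"] inner) auto
        ultimately show ?thesis
          by (simp only: distrib_left sum.distrib)
      qed
      also have "(\<Sum>k<n. x $$ (i, k) * ?xZ j k) =
          (\<Sum>l<n. x $$ (j, l) * g $$ (i, rf l))"
      proof -
        have "(\<Sum>k<n. x $$ (i, k) * ?xZ j k) =
            (\<Sum>l<n. x $$ (j, l) * (\<Sum>k<n. x $$ (i, k) * ?Z k l))"
          unfolding sum_distrib_left by (subst sum.swap) (simp add: algebra_simps)
        then show ?thesis
          using that by (simp add: xz[simplified])
      qed
      also have "(\<Sum>k<n. x $$ (i, k) * ?ug j k) =
          (\<Sum>q<mid. g $$ (i, n + q) * g $$ (j, n + q))"
      proof -
        have "(\<Sum>k<n. x $$ (i, k) * ?ug j k) =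
            (\<Sum>q<mid. (\<Sum>k<n. x $$ (i, k) * u $$ (k, q)) * g $$ (j, n + q))"
          unfolding sum_distrib_left sum_distrib_right by (subst sum.swap) (simp add: algebra_simps)
        then show ?thesis
          using that by (simp add: xu)
      qed
      also have "(\<Sum>k<n. x $$ (i, k) * g $$ (j, rf k)) + eps * (\<Sum>l<n. x $$ (j, l) * g $$ (i, rf l)) +
          (\<Sum>q<mid. g $$ (i, n + q) * g $$ (j, n + q)) = ?P i j"
        using that by (simp add: pairing_split xe algebra_simps)
      also have "\<dots> = 0"
        using that P[of i j] rf_ge[of i] by auto
      finally show ?thesis .
    qed
    \<comment> \<open>The two factors x are now stripped one after the other.\<close>
    then have "(\<Sum>l<n. x $$ (j, l) * ?M a l) = 0" if "j < n" for j
      by (rule cancel[where w = "\<lambda>k. \<Sum>l<n. x $$ (j, l) * ?M k l", OF _ ab(1)]) (use that in simp_all)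
    then show "?M a b = 0"
      by (rule cancel[where w = "?M a", OF _ ab(2)])
  qed
  then show ?thesis
    unfolding U_set_def using g_eq x y uz by blast
qed

text \<open>The intrinsic description of the group. Closure under products and inverses, and all
  arguments with the form, rest on it rather than on the parametrisation by blocks.\<close>

lemma U_set_iff: "g \<in> U_set T n \<longleftrightarrow> g \<in> unitriangular m \<and> isometric (g :: 'a::field mat)"
proof
  assume "g \<in> U_set T n"
  then show "g \<in> unitriangular m \<and> isometric g"
    unfolding U_set_def
    by (auto intro: block_element_unitriangular block_element_isometric dest: unitriangularD(1))
qed (use U_setI in blast)

end

section \<open>Induced characters\<close>

text \<open>The map f separates exactly the right cosets of H, so X is a model of the coset space
  and F the contribution of a coset. Every fibre has \<open>card H\<close> elements, which cancels
  the denominator in \<open>induced\<close>.\<close>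

lemma (in group) induced_eq_sum:
  assumes fin: "finite (carrier G)" and g: "g \<in> carrier G" and H: "H \<subseteq> carrier G"
    and X: "f ` carrier G = X"
    and fibre: "\<And>s t. s \<in> carrier G \<Longrightarrow> t \<in> carrier G \<Longrightarrow> f s = f t \<longleftrightarrow> s \<otimes> inv t \<in> H"
    and F: "\<And>t. t \<in> carrier G \<Longrightarrow>
      (if t \<otimes> g \<otimes> inv t \<in> H then \<chi> (t \<otimes> g \<otimes> inv t) else 0) = F (f t)"
  shows "induced G H \<chi> g = (\<Sum>x\<in>X. F x)"
proof -
  have "\<one> \<in> H"
    using fibre[of \<one> \<one>] by simp
  then have card_H: "card H \<noteq> 0"
    using finite_subset[OF H fin] by auto
  have card_fibre: "card {t \<in> carrier G. f t = x} = card H" if "x \<in> X" for x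
  proof -
    obtain s where s: "s \<in> carrier G" "x = f s"
      using X \<open>x \<in> X\<close> by auto
    have "bij_betw (\<lambda>h. h \<otimes> s) H {t \<in> carrier G. f t = x}"
    proof (rule bij_betw_byWitness[where f' = "\<lambda>t. t \<otimes> inv s"])
      show "\<forall>h\<in>H. h \<otimes> s \<otimes> inv s = h"
        using H s by (auto simp: m_assoc)
      show "\<forall>t\<in>{t \<in> carrier G. f t = x}. t \<otimes> inv s \<otimes> s = t"
        using s by (auto simp: m_assoc)
      show "(\<lambda>h. h \<otimes> s) ` H \<subseteq> {t \<in> carrier G. f t = x}"
      proof
        fix t assume "t \<in> (\<lambda>h. h \<otimes> s) ` H"
        then obtain h where h: "h \<in> H" "t = h \<otimes> s" by blast
        then have "h \<in> carrier G" using H by blast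
        then have "t \<in> carrier G" "t \<otimes> inv s = h"
          using h s by (auto simp: m_assoc)
        then show "t \<in> {t \<in> carrier G. f t = x}"
          using fibre[of t s] s h by simp
      qed
      show "(\<lambda>t. t \<otimes> inv s) ` {t \<in> carrier G. f t = x} \<subseteq> H"
        using fibre s by auto
    qed
    then show ?thesis
      by (simp add: bij_betw_same_card)
  qed
  have "(\<Sum>t\<in>carrier G. let h = t \<otimes> g \<otimes> inv t in if h \<in> H then \<chi> h else 0) =
      (\<Sum>t\<in>carrier G. F (f t))"
    unfolding Let_def by (rule sum.cong[OF refl F])
  also have "\<dots> = (\<Sum>x\<in>X. \<Sum>t\<in>{t \<in> carrier G. f t = x}. F (f t))"
    unfolding X[symmetric] by (rule sum.image_gen[OF fin])
  also have "\<dots> = (\<Sum>x\<in>X. of_nat (card H) * F x)"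
    by (intro sum.cong refl) (simp add: card_fibre)
  finally show ?thesis
    using g card_H by (simp add: induced_def sum_distrib_left[symmetric])
qed

lemma (in group) induced_class_function:
  "induced G H \<chi> \<in> class_functions G"
proof -
  have "induced G H \<chi> (s \<otimes> g \<otimes> inv s) = induced G H \<chi> g"
    if g: "g \<in> carrier G" and s: "s \<in> carrier G" for g s
  proof -
    let ?F = "\<lambda>h. if h \<in> H then \<chi> h else 0"
    have "(\<Sum>t\<in>carrier G. ?F (t \<otimes> (s \<otimes> g \<otimes> inv s) \<otimes> inv t)) =
        (\<Sum>t\<in>carrier G. ?F (t \<otimes> g \<otimes> inv t))"
      by (rule sum.reindex_bij_witness[of _ "\<lambda>t. t \<otimes> inv s" "\<lambda>t. t \<otimes> s"])
        (use g s in \<open>auto simp: m_assoc inv_mult_group\<close>)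
    then show ?thesis
      using g s by (simp add: induced_def Let_def)
  qed
  then show ?thesis
    by (auto simp: class_functions_def induced_def)
qed

section \<open>Row prefixes as coordinates on right cosets\<close>

lemma mult_row_prefix:
  fixes t y :: "'a::field mat"
  assumes t: "t \<in> unitriangular p" and y: "y \<in> unitriangular p" and ij: "i < j" "i < p"
    and zero: "\<And>k. i < k \<Longrightarrow> k < j \<Longrightarrow> y $$ (i, k) = 0"
  shows "l < j \<Longrightarrow> l < p \<Longrightarrow> (y * t) $$ (i, l) = t $$ (i, l)"
    and "j < p \<Longrightarrow> (y * t) $$ (i, j) = t $$ (i, j) + y $$ (i, j)"
proof -
  note tD = unitriangularD[OF t] and yD = unitriangularD[OF y]
  have ent: "(y * t) $$ (i, l) = (\<Sum>k<p. y $$ (i, k) * t $$ (k, l))" if "i < p" "l < p" for l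
    by (rule index_mult_sum[OF yD(1) tD(1)]) (use that in auto)
  show "(y * t) $$ (i, l) = t $$ (i, l)" if "l < j" "l < p"
  proof -
    have "(\<Sum>k<p. y $$ (i, k) * t $$ (k, l)) = (\<Sum>k<p. if k = i then t $$ (i, l) else 0)"
    proof (intro sum.cong refl)
      fix k assume "k \<in> {..<p}"
      then show "y $$ (i, k) * t $$ (k, l) = (if k = i then t $$ (i, l) else 0)"
        using yD tD zero[of k] that ij
        by (cases k i rule: linorder_cases; cases "k < j") auto
    qed
    then show ?thesis
      using ij that by (simp add: ent)
  qed
  show "(y * t) $$ (i, j) = t $$ (i, j) + y $$ (i, j)" if "j < p"
  proof -
    have "(\<Sum>k<p. y $$ (i, k) * t $$ (k, j)) =
        (\<Sum>k<p. (if k = i then t $$ (i, j) else 0) + (if k = j then y $$ (i, j) else 0))"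
    proof (intro sum.cong refl)
      fix k assume "k \<in> {..<p}"
      then show "y $$ (i, k) * t $$ (k, j) =
          (if k = i then t $$ (i, j) else 0) + (if k = j then y $$ (i, j) else 0)"
        using yD tD zero[of k] that ij
        by (cases k i rule: linorder_cases; cases k j rule: linorder_cases) auto
    qed
    then show ?thesis
      using that ij by (simp add: ent sum.distrib)
  qed
qed

text \<open>The coset of t modulo the matrices with zeros at (i, k), i < k < j, is therefore the
  prefix of length j of row i of t. For the converse the zeros are read off from left to right, each
  column giving one further entry of y.\<close>

lemma mult_row_prefix_iff:
  fixes t y :: "'a::field mat"
  assumes t: "t \<in> unitriangular p" and y: "y \<in> unitriangular p" and "i < j" "j \<le> p"
  shows "(\<forall>k. i < k \<and> k < j \<longrightarrow> y $$ (i, k) = 0) \<longleftrightarrow> (\<forall>l<j. (y * t) $$ (i, l) = t $$ (i, l))"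
proof
  assume "\<forall>k. i < k \<and> k < j \<longrightarrow> y $$ (i, k) = 0"
  then show "\<forall>l<j. (y * t) $$ (i, l) = t $$ (i, l)"
    using mult_row_prefix(1)[OF t y \<open>i < j\<close>] \<open>i < j\<close> \<open>j \<le> p\<close> by auto
next
  assume *: "\<forall>l<j. (y * t) $$ (i, l) = t $$ (i, l)"
  have "y $$ (i, k) = 0" if "i < k" "k < j" for k
    using that
  proof (induction k rule: less_induct)
    case (less k)
    have "(y * t) $$ (i, k) = t $$ (i, k) + y $$ (i, k)"
      by (rule mult_row_prefix(2)[OF t y]) (use less \<open>i < j\<close> \<open>j \<le> p\<close> in auto)
    then show ?case
      using * less.prems by simp
  qed
  then show "\<forall>k. i < k \<and> k < j \<longrightarrow> y $$ (i, k) = 0"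
    by blast
qed

lemma mult_row_act:
  fixes t g :: "'a::field mat"
  assumes t: "t \<in> carrier_mat p p" and g: "g \<in> unitriangular p" and "i < p" "l < p"
  shows "(t * g) $$ (i, l) = t $$ (i, l) + act g (\<lambda>k. t $$ (i, k)) l"
proof -
  note gD = unitriangularD[OF g]
  have "(t * g) $$ (i, l) = (\<Sum>k<p. t $$ (i, k) * g $$ (k, l))"
    using assms by (intro index_mult_sum[OF t gD(1)])
  also have "\<dots> = (\<Sum>k\<in>{..<Suc l}. t $$ (i, k) * g $$ (k, l))"
    by (rule sum.mono_neutral_right) (use gD \<open>l < p\<close> in auto)
  finally show ?thesis
    using gD \<open>l < p\<close> by (simp add: act_def)
qed

definition truncate :: "nat \<Rightarrow> (nat \<Rightarrow> 'a::zero) \<Rightarrow> nat \<Rightarrow> 'a" where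
  "truncate j a k = (if k < j then a k else 0)"

lemma act_truncate: "l \<le> j \<Longrightarrow> act g (truncate j a) l = act g a l"
  by (rule act_cong) (simp add: truncate_def)

text \<open>The prefixes of length j that row i of a unitriangular matrix can have.\<close>

definition row_vecs :: "nat \<Rightarrow> nat \<Rightarrow> (nat \<Rightarrow> 'a::zero_neq_one) set" where
  "row_vecs i j = {a \<in> vecs {i..<j}. a i = 1}"

lemma fixers_from_eq: "fixers_from g i j = {a \<in> row_vecs i j. \<forall>l<j. act g a l = 0}"
  by (auto simp: fixers_from_def row_vecs_def)

lemma finite_row_vecs [simp]: "finite (row_vecs i j :: (nat \<Rightarrow> 'a::{field,finite}) set)"
  unfolding row_vecs_def by (rule finite_subset[OF _ finite_vecs[of "{i..<j}"]]) auto

lemma truncate_row_vecs: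
  "t \<in> unitriangular p \<Longrightarrow> i < j \<Longrightarrow> j \<le> p \<Longrightarrow> truncate j (\<lambda>k. t $$ (i, k)) \<in> row_vecs i j"
  by (auto simp: row_vecs_def vecs_def truncate_def unitriangularD)

lemma truncate_eq_iff: "truncate j a = truncate j b \<longleftrightarrow> (\<forall>l<j. a l = b l)"
  by (auto simp: truncate_def fun_eq_iff)

section \<open>The group U and the invariance of its form\<close>

context classical_type
begin

abbreviation G :: "'a::field mat monoid" where "G \<equiv> U_group T n"
abbreviation U :: "'a::field mat set" where "U \<equiv> U_set T n"

lemma U_unitriangular: "g \<in> U \<Longrightarrow> (g :: 'a::field mat) \<in> unitriangular m"
  and U_isometric: "g \<in> U \<Longrightarrow> isometric (g :: 'a::field mat)"
  by (auto simp: U_set_iff)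

definition gram :: "'a::field mat" where
  "gram = mat m m (\<lambda>(i, k). if k = rf i then sg i else 0)"

lemma gram_carrier [simp]: "gram \<in> carrier_mat m m"
  by (simp add: gram_def)

lemma isometric_iff:
  fixes g :: "'a::field mat"
  assumes g: "g \<in> carrier_mat m m"
  shows "isometric g \<longleftrightarrow> g * gram * transpose_mat g = gram"
proof -
  have gt: "transpose_mat g \<in> carrier_mat m m"
    using g by simp
  have gg: "(g * gram) $$ (i, j) = g $$ (i, rf j) * sg (rf j)" if "i < m" "j < m" for i j
  proof -
    have "(g * gram) $$ (i, j) = (\<Sum>l<m. g $$ (i, l) * gram $$ (l, j))"
      using that by (intro index_mult_sum[OF g gram_carrier])
    also have "\<dots> = (\<Sum>l<m. if l = rf j then g $$ (i, rf j) * sg (rf j) else 0)"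
      using that by (intro sum.cong refl) (auto simp: gram_def)
    finally show ?thesis
      using that by simp
  qed
  have "(g * gram * transpose_mat g) $$ (i, j) = pairing (row_fun g i) (row_fun g j)"
    if "i < m" "j < m" for i j
  proof -
    have "(g * gram * transpose_mat g) $$ (i, j) = (\<Sum>k<m. (g * gram) $$ (i, k) * transpose_mat g $$ (k, j))"
      using that by (intro index_mult_sum[OF mult_carrier_mat[OF g gram_carrier] gt])
    also have "\<dots> = (\<Sum>k<m. sg (rf k) * g $$ (i, rf k) * g $$ (j, rf (rf k)))"
      using that g by (intro sum.cong refl) (simp add: gg)
    also have "\<dots> = pairing (row_fun g i) (row_fun g j)"
      unfolding pairing_def by (rule sum_rf)
    finally show ?thesis .
  qed
  moreover have "dim_row (g * gram * transpose_mat g) = m" "dim_col (g * gram * transpose_mat g) = m"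
    using g by auto
  ultimately show ?thesis
    unfolding isometric_def by (auto simp: mat_eq_iff gram_def)
qed

lemma U_mult:
  fixes g h :: "'a::field mat"
  assumes g: "g \<in> U" and h: "h \<in> U"
  shows "g * h \<in> U"
proof -
  have gc: "g \<in> carrier_mat m m" and hc: "h \<in> carrier_mat m m"
    using assms by (auto simp: U_set_iff unitriangularD)
  have tc: "transpose_mat g \<in> carrier_mat m m" "transpose_mat h \<in> carrier_mat m m"
    using gc hc by auto
  have "(g * h) * gram * transpose_mat (g * h) = g * (h * gram * transpose_mat h) * transpose_mat g"
    using gc hc tc gram_carrier
    by (smt (verit) assoc_mult_mat mult_carrier_mat transpose_mult)
  also have "\<dots> = gram"
    using assms gc hc by (simp add: U_set_iff isometric_iff)
  finally show ?thesis
    using assms gc hc by (simp add: U_set_iff isometric_iff mult_unitriangular)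
qed

lemma U_inverse:
  fixes g :: "'a::field mat"
  assumes g: "g \<in> U"
  shows "\<exists>h\<in>U. h * g = 1\<^sub>m m"
proof -
  have gu: "g \<in> unitriangular m" and gc: "g \<in> carrier_mat m m"
    using assms by (auto simp: U_set_iff unitriangularD)
  obtain h where h: "h \<in> carrier_mat m m" "inverts_mat g h" "inverts_mat h g"
    using unitriangular_inverse[OF gu] .
  have hg: "h * g = 1\<^sub>m m" and gh: "g * h = 1\<^sub>m m"
    using h gc by (auto simp: inverts_mat_def)
  have tc: "transpose_mat g \<in> carrier_mat m m" "transpose_mat h \<in> carrier_mat m m"
    using gc h by auto
  have th: "transpose_mat g * transpose_mat h = 1\<^sub>m m"
    using hg transpose_mult[OF h(1) gc] by simp
  have "h * gram * transpose_mat h = h * (g * gram * transpose_mat g) * transpose_mat h"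
    using g gc by (simp add: U_set_iff isometric_iff)
  also have "\<dots> = (h * g) * gram * (transpose_mat g * transpose_mat h)"
    using gc h(1) tc gram_carrier by (smt (verit) assoc_mult_mat mult_carrier_mat)
  also have "\<dots> = gram"
    unfolding hg th left_mult_one_mat[OF gram_carrier] right_mult_one_mat[OF gram_carrier] ..
  finally have "h \<in> U"
    using h inverse_unitriangular[OF gu] by (simp add: U_set_iff isometric_iff)
  then show ?thesis
    using hg by blast
qed

lemma one_in_U: "(1\<^sub>m m :: 'a::field mat) \<in> U"
  by (auto simp: U_set_iff isometric_iff left_mult_one_mat[OF gram_carrier]
      right_mult_one_mat[OF gram_carrier] intro!: unitriangularI)

lemma U_carrier: "g \<in> U \<Longrightarrow> (g :: 'a::field mat) \<in> carrier_mat m m"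
  by (simp add: U_set_iff unitriangularD)

lemma group_U: "group (G :: 'a::field mat monoid)"
proof (rule groupI)
  show "\<And>x. x \<in> carrier (G :: 'a mat monoid) \<Longrightarrow> \<exists>y\<in>carrier G. y \<otimes>\<^bsub>G\<^esub> x = \<one>\<^bsub>G\<^esub>"
    using U_inverse by (simp add: U_group_def)
  fix x y z :: "'a mat"
  assume "x \<in> carrier G" "y \<in> carrier G" "z \<in> carrier G"
  then have "x \<in> carrier_mat m m" "y \<in> carrier_mat m m" "z \<in> carrier_mat m m"
    by (auto simp: U_group_def U_carrier)
  then show "x \<otimes>\<^bsub>G\<^esub> y \<otimes>\<^bsub>G\<^esub> z = x \<otimes>\<^bsub>G\<^esub> (y \<otimes>\<^bsub>G\<^esub> z)"
    by (auto simp: U_group_def)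
qed (auto simp: U_group_def U_mult one_in_U left_mult_one_mat[OF U_carrier])

lemma U_group_simps [simp]:
  "carrier (U_group T n) = U" "x \<otimes>\<^bsub>U_group T n\<^esub> y = x * y" "\<one>\<^bsub>U_group T n\<^esub> = 1\<^sub>m m"
  by (simp_all add: U_group_def)

lemma finite_U: "finite (U :: 'a::{field,finite} mat set)"
proof (rule finite_subset)
  show "U \<subseteq> (\<lambda>f. mat m m f) ` (({..<m} \<times> {..<m}) \<rightarrow>\<^sub>E (UNIV :: 'a set))"
  proof
    fix g :: "'a mat" assume "g \<in> U"
    then have g: "g \<in> carrier_mat m m"
      by (simp add: U_set_iff unitriangularD)
    show "g \<in> (\<lambda>f. mat m m f) ` (({..<m} \<times> {..<m}) \<rightarrow>\<^sub>E (UNIV :: 'a set))"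
      by (rule image_eqI[of _ _ "restrict (\<lambda>x. g $$ x) ({..<m} \<times> {..<m})"])
        (use g in \<open>auto intro!: eq_matI\<close>)
  qed
qed (auto intro!: finite_PiE)

text \<open>The upper part of x and the middle column v are free coordinates on \<open>U\<close>:
  take u = x^-1 v and let z J be minus half of u u^T, which solves the block condition because u u^T
  is symmetric. When mid is 0 this z is zero.\<close>

lemma U_prescribed:
  fixes f :: "nat \<Rightarrow> nat \<Rightarrow> 'a::field"
  assumes two: "(2 :: 'a) \<noteq> 0"
  shows "\<exists>t\<in>U. \<forall>p<n. \<forall>q<n + mid. p < q \<longrightarrow> t $$ (p, q) = f p q"
proof -
  define x where "x = mat n n (\<lambda>(p, q). if p = q then 1 else if q < p then 0 else f p q)"
  have x: "x \<in> unitriangular n"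
    by (rule unitriangularI) (auto simp: x_def)
  obtain y where y: "y \<in> carrier_mat n n" "inverts_mat x y" "inverts_mat y x"
    using unitriangular_inverse[OF x] .
  note xc = unitriangularD(1)[OF x]
  define v where "v = mat n mid (\<lambda>(p, k). f p (n + k))"
  define u where "u = y * v"
  define z where "z = mat n n (\<lambda>(l, c). - (\<Sum>k<mid. u $$ (l, k) * u $$ (n - 1 - c, k)) / 2)"
  have vc: "v \<in> carrier_mat n mid" and uc: "u \<in> carrier_mat n mid" and zc: "z \<in> carrier_mat n n"
    using y by (auto simp: v_def u_def z_def)
  have "x * u = v"
    using y xc vc assoc_mult_mat[OF xc y(1) vc] by (simp add: u_def inverts_mat_def)
  then have xu: "(\<Sum>l<n. x $$ (p, l) * u $$ (l, k)) = f p (n + k)" if "p < n" "k < mid" for p k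
    using index_mult_sum[OF xc uc that] that by (simp add: v_def)
  have half: "- s / 2 + - s / 2 + s = 0" for s :: 'a
  proof -
    have "- s / 2 + - s / 2 = - (2 * s) / 2"
      unfolding add_divide_distrib[symmetric] by simp
    then show ?thesis using two by simp
  qed
  have "block_condition T n u z"
    unfolding block_condition_iff[OF uc zc]
  proof (intro allI impI)
    fix a b assume "a < n" "b < n"
    then have z: "z $$ (b, n - 1 - a) = - (\<Sum>k<mid. u $$ (a, k) * u $$ (b, k)) / 2"
      "z $$ (a, n - 1 - b) = - (\<Sum>k<mid. u $$ (a, k) * u $$ (b, k)) / 2"
      by (auto simp: z_def mult.commute)
    show "z $$ (b, n - 1 - a) + eps * z $$ (a, n - 1 - b) + (\<Sum>k<mid. u $$ (a, k) * u $$ (b, k)) = 0"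
      unfolding z using mid_eps[where ?'a = 'a] half by auto
  qed
  then have "block_element T n x y u z \<in> U"
    unfolding U_set_def using x y uc zc by blast
  moreover have "block_element T n x y u z $$ (p, q) = f p q" if "p < n" "q < n + mid" "p < q" for p q
  proof (cases "q < n")
    case True
    then show ?thesis
      using that block_element_entries(2)[OF xc y(1) uc zc] by (simp add: x_def)
  next
    case False
    then have "q = n + (q - n)" "q - n < mid"
      using that by auto
    then show ?thesis
      using block_element_entries(3)[OF xc y(1) uc zc, of p "q - n"] xu that by simp
  qed
  ultimately show ?thesis by blast
qed

lemma pairing_cong:
  "(\<And>k. k < m \<Longrightarrow> a k = a' k) \<Longrightarrow> (\<And>k. k < m \<Longrightarrow> b k = b' k) \<Longrightarrow> pairing a b = pairing a' b'"
  by (simp add: pairing_def)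

lemma pairing_add_left: "pairing (a + a') b = pairing a b + pairing a' (b :: nat \<Rightarrow> 'a::field)"
  by (simp add: pairing_def algebra_simps sum.distrib)

lemma pairing_add_right: "pairing a (b + b') = pairing a b + pairing a (b' :: nat \<Rightarrow> 'a::field)"
  by (simp add: pairing_def algebra_simps sum.distrib)

lemma pairing_sum_left:
  "pairing (\<lambda>k. \<Sum>i\<in>I. c i * f i k) b = (\<Sum>i\<in>I. c i * pairing (f i) (b :: nat \<Rightarrow> 'a::field))"
  unfolding pairing_def sum_distrib_left sum_distrib_right
  by (subst sum.swap) (simp add: mult_ac)

lemma pairing_sum_right:
  "pairing b (\<lambda>k. \<Sum>i\<in>I. c i * f i k) = (\<Sum>i\<in>I. c i * pairing (b :: nat \<Rightarrow> 'a::field) (f i))"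
  unfolding pairing_def sum_distrib_left sum_distrib_right
  by (subst sum.swap) (simp add: mult_ac)

text \<open>Every index lies in one of the two zero prefixes, directly or after reflection. Most
  form computations below come down to this count of coordinates.\<close>

lemma pairing_eq_zero:
  fixes a b :: "nat \<Rightarrow> 'a::field"
  assumes "\<And>k. k < m \<Longrightarrow> k < p \<Longrightarrow> a k = 0" "\<And>k. k < m \<Longrightarrow> k < q \<Longrightarrow> b k = 0" "m \<le> p + q"
  shows "pairing a b = 0"
  unfolding pairing_def
proof (intro sum.neutral ballI)
  fix k assume "k \<in> {..<m}"
  then have "k < p \<or> rf k < q" "k < m" "rf k < m"
    using assms(3) by (auto simp: rf_def)
  then show "sg k * a k * b (rf k) = 0"
    using assms by auto
qed

text \<open>The borderline case of the same count: prefixes of lengths p and \<open>rf p\<close> add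
  up to m - 1 and leave one term.\<close>

lemma pairing_single:
  fixes a b :: "nat \<Rightarrow> 'a::field"
  assumes "\<And>k. k < m \<Longrightarrow> k < p \<Longrightarrow> a k = 0" "\<And>k. k < m \<Longrightarrow> k < rf p \<Longrightarrow> b k = 0" "p < m"
  shows "pairing a b = sg p * a p * b (rf p)"
proof -
  have "pairing a b = (\<Sum>k<m. if k = p then sg p * a p * b (rf p) else 0)"
    unfolding pairing_def
  proof (intro sum.cong refl)
    fix k assume "k \<in> {..<m}"
    then have "k < p \<or> rf k < rf p \<or> k = p" "k < m" "rf k < m"
      using assms(3) by (auto simp: rf_less_iff)
    then show "sg k * a k * b (rf k) = (if k = p then sg p * a p * b (rf p) else 0)"
      using assms by auto
  qed
  then show ?thesis
    using assms(3) by simp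
qed

lemma pairing_rows:
  fixes g :: "'a::field mat"
  assumes "g \<in> U" "i < m" "j < m"
  shows "pairing (row_fun g i) (row_fun g j) = (if j = rf i then sg i else 0)"
  using U_isometric[OF assms(1)] assms(2,3) by (simp add: isometric_def)

lemma add_act:
  fixes g :: "'a::field mat"
  assumes "g \<in> U" "k < m"
  shows "a k + act g a k = (\<Sum>i<m. a i * g $$ (i, k))"
proof -
  note gD = unitriangularD[OF U_unitriangular[OF assms(1)]]
  have "(\<Sum>i<m. a i * g $$ (i, k)) = (\<Sum>i\<in>{..<Suc k}. a i * g $$ (i, k))"
    by (rule sum.mono_neutral_right) (use gD \<open>k < m\<close> in auto)
  then show ?thesis
    using gD \<open>k < m\<close> by (simp add: act_def)
qed

text \<open>The right argument is b g, a combination of the rows of g, and row l of g pairs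
  nontrivially only with row \<open>rf l\<close>.\<close>

lemma pairing_row_act:
  fixes g :: "'a::field mat"
  assumes g: "g \<in> U" and l: "l < m"
  shows "pairing (row_fun g l) (b + act g b) = sg l * b (rf l)"
proof -
  have "pairing (row_fun g l) (b + act g b) = pairing (row_fun g l) (\<lambda>k. \<Sum>i<m. b i * g $$ (i, k))"
    by (rule pairing_cong) (simp_all add: add_act[OF g])
  also have "\<dots> = (\<Sum>i<m. if i = rf l then sg l * b i else 0)"
    unfolding pairing_sum_right by (intro sum.cong refl) (simp add: pairing_rows[OF g l])
  finally show ?thesis
    using l by simp
qed

text \<open>Invariance of the form, with b g written as b + b (g - 1), so that expansion isolates
  the terms in which many coordinates vanish.\<close>

lemma pairing_act:
  fixes g :: "'a::field mat"
  assumes g: "g \<in> U"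
  shows "pairing (a + act g a) (b + act g b) = pairing a b"
proof -
  have "pairing (a + act g a) (b + act g b) = pairing (\<lambda>k. \<Sum>i<m. a i * g $$ (i, k)) (b + act g b)"
    by (rule pairing_cong) (simp_all add: add_act[OF g])
  also have "\<dots> = pairing a b"
    unfolding pairing_sum_left pairing_def[of a b]
    by (intro sum.cong refl) (simp add: pairing_row_act[OF g])
  finally show ?thesis .
qed

lemma act_prefix_zero:
  assumes "\<And>k. k < p \<Longrightarrow> a k = 0" "k \<le> p"
  shows "act g a k = 0"
  unfolding act_def using assms by (intro sum.neutral) auto

end

section \<open>Elementary characters as sums over fixed vectors\<close>

lemma vecs_mono: "A \<subseteq> B \<Longrightarrow> vecs A \<subseteq> vecs B"
  by (auto simp: vecs_def)

context classical_type
begin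

text \<open>The column vector representing \<open>pairing _ b\<close>, scaled such that \<open>b (rf j) = 1\<close> gives entry \<open>1\<close> at \<open>j\<close>.\<close>
definition flip :: "nat \<Rightarrow> (nat \<Rightarrow> 'a::field) \<Rightarrow> nat \<Rightarrow> 'a" where
  "flip j b l = (if l < m then sg j * (sg l * b (rf l)) else 0)"

definition unflip :: "nat \<Rightarrow> (nat \<Rightarrow> 'a::field) \<Rightarrow> nat \<Rightarrow> 'a" where
  "unflip j d k = (if k < m then sg j * (sg (rf k) * d (rf k)) else 0)"

lemma flip_unflip: "d \<in> vecs {..<m} \<Longrightarrow> flip j (unflip j d) = (d :: nat \<Rightarrow> 'a::field)"
  by (auto simp: flip_def unflip_def vecs_def fun_eq_iff mult.assoc[symmetric])
    (simp add: mult.commute mult.left_commute)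

lemma unflip_flip: "b \<in> vecs {..<m} \<Longrightarrow> unflip j (flip j b) = (b :: nat \<Rightarrow> 'a::field)"
  by (auto simp: flip_def unflip_def vecs_def fun_eq_iff mult.assoc[symmetric])
    (simp add: mult.commute mult.left_commute)

lemma bil_flip:
  "bil m g a (flip j b) = sg j * pairing (act g a) (b :: nat \<Rightarrow> 'a::field)"
  unfolding bil_def pairing_def sum_distrib_left
  by (intro sum.cong refl) (simp add: flip_def mult_ac)

text \<open>Up to sign, coordinate l of (g - 1) flip is the difference between the pairings of e_l g
  and of e_l with b. By invariance the latter is the pairing of e_l g with b g, so b - b g is left
  as right argument.\<close>

lemma colact_flip:
  fixes g :: "'a::field mat"
  assumes g: "g \<in> U" and l: "l < m"
  shows "colact m g (flip j b) l = - sg j * pairing (row_fun g l) (act g b)"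
proof -
  note gD = unitriangularD[OF U_unitriangular[OF g]]
  let ?d = "flip j b"
  have "?d l + colact m g ?d l = (\<Sum>k\<in>insert l {l<..<m}. g $$ (l, k) * ?d k)"
    using gD l by (simp add: colact_def)
  also have "\<dots> = (\<Sum>k<m. g $$ (l, k) * ?d k)"
    by (rule sum.mono_neutral_left) (use gD l in auto)
  also have "\<dots> = sg j * pairing (row_fun g l) b"
    unfolding pairing_def sum_distrib_left
    by (intro sum.cong refl) (simp add: flip_def mult_ac)
  also have "pairing (row_fun g l) b = sg l * b (rf l) - pairing (row_fun g l) (act g b)"
    using pairing_row_act[OF g l, of b] by (simp add: pairing_add_right eq_diff_eq)
  finally show ?thesis
    using l by (simp add: flip_def[of j b l] right_diff_distrib)
qed

lemma colact_flip_last: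
  fixes g :: "'a::field mat"
  assumes g: "g \<in> U" and i: "i < m" and fixed: "\<And>k. k < rf i \<Longrightarrow> act g b k = 0"
  shows "colact m g (flip j b) i = - (sg i * sg j * act g b (rf i))"
proof -
  note gD = unitriangularD[OF U_unitriangular[OF g]]
  have "pairing (row_fun g i) (act g b) = sg i * g $$ (i, i) * act g b (rf i)"
    by (rule pairing_single) (use gD i fixed in auto)
  then show ?thesis
    using gD i by (simp add: colact_flip[OF g i] mult_ac)
qed

text \<open>Conditions on rows k, ..., m - 1 of the column vector become conditions on columns 0,
  ..., m - k - 1 of the row vector. One direction is a count of zero coordinates; for the other the
  linear system is triangular and is solved from the left.\<close>

lemma colact_flip_eq_zero_iff:
  fixes g :: "'a::field mat"
  assumes g: "g \<in> U" and k: "k \<le> m"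
  shows "(\<forall>l\<in>{k..<m}. colact m g (flip j b) l = 0) \<longleftrightarrow> (\<forall>l<m - k. act g b l = 0)"
proof
  note gD = unitriangularD[OF U_unitriangular[OF g]]
  assume fixed: "\<forall>l<m - k. act g b l = 0"
  show "\<forall>l\<in>{k..<m}. colact m g (flip j b) l = 0"
  proof
    fix l assume l: "l \<in> {k..<m}"
    have "pairing (row_fun g l) (act g b) = 0"
      by (rule pairing_eq_zero[of l _ "m - k"]) (use gD fixed l in auto)
    then show "colact m g (flip j b) l = 0"
      using l by (simp add: colact_flip[OF g])
  qed
next
  assume *: "\<forall>l\<in>{k..<m}. colact m g (flip j b) l = 0"
  have "act g b l = 0" if "l < m - k" for l
    using that
  proof (induction l rule: less_induct)
    case (less l)
    then have "l < m" by simp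
    have "colact m g (flip j b) (rf l) = - (sg (rf l) * sg j * act g b (rf (rf l)))"
      by (rule colact_flip_last[OF g]) (use \<open>l < m\<close> less in auto)
    moreover have "rf l \<in> {k..<m}"
      using less.prems by (auto simp: rf_def)
    ultimately show ?case
      using * \<open>l < m\<close> by auto
  qed
  then show "\<forall>l<m - k. act g b l = 0" by blast
qed

text \<open>Rows from j on impose nothing, by support. With the range extended to m, the conditions
  reflect to a full prefix of columns.\<close>

lemma cofixers_to_alt:
  assumes "j < m"
  shows "cofixers_to m g k j = {d. d j = 1 \<and> d \<in> vecs {k..j} \<and> (\<forall>l\<in>{k..<m}. colact m g d l = 0)}"
proof -
  have "colact m g d l = 0" if "d \<in> vecs {k..j}" "j \<le> l" for d l
    using that by (intro colact_eq_zero[of _ k]) (auto simp: vecs_def)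
  then show ?thesis
    using assms unfolding cofixers_to_def by (auto simp: not_less)
qed

lemma cofixers_alt:
  assumes "j \<le> m"
  shows "cofixers m g k j = {d \<in> vecs {k..<j}. \<forall>l\<in>{k..<m}. colact m g d l = 0}"
proof -
  have "colact m g d l = 0" if "d \<in> vecs {k..<j}" "j \<le> l" for d l
    using that by (intro colact_eq_zero[of _ k]) (auto simp: vecs_def)
  then show ?thesis
    using assms unfolding cofixers_def by (auto simp: not_less)
qed

lemma flip_mem_vecs:
  fixes b :: "nat \<Rightarrow> 'a::field"
  assumes "k \<le> j" "j < m" "b \<in> vecs {rf j..<m - k}"
  shows "flip j b \<in> vecs {k..j}"
proof -
  have "b (rf l) = 0" if "l < m" "\<not> (k \<le> l \<and> l \<le> j)" for l
  proof -
    have "rf l \<notin> {rf j..<m - k}"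
      using that assms by (auto simp: rf_def)
    then show ?thesis using assms(3) by (auto simp: vecs_def)
  qed
  then show ?thesis
    by (auto simp: vecs_def flip_def)
qed

lemma unflip_mem_vecs:
  fixes d :: "nat \<Rightarrow> 'a::field"
  assumes "k \<le> j" "j < m" "d \<in> vecs {k..j}"
  shows "unflip j d \<in> vecs {rf j..<m - k}"
proof -
  have "d (rf l) = 0" if "l < m" "\<not> (rf j \<le> l \<and> l < m - k)" for l
  proof -
    have "rf l \<notin> {k..j}"
      using that assms by (auto simp: rf_def)
    then show ?thesis using assms(3) by (auto simp: vecs_def)
  qed
  then show ?thesis
    by (auto simp: vecs_def unflip_def)
qed

text \<open>The value c at the last coordinate covers both cases with one bijection: c = 1 gives the
  normalised column vectors, c = 0 the linear ones.\<close>

lemma sum_flip: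
  fixes g :: "'a::{field,finite} mat" and f :: "(nat \<Rightarrow> 'a) \<Rightarrow> complex"
  assumes g: "g \<in> U" and kj: "k \<le> j" "j < m"
  shows "(\<Sum>d\<in>{d \<in> vecs {k..j}. d j = c \<and> (\<forall>l\<in>{k..<m}. colact m g d l = 0)}. f d) =
    (\<Sum>b\<in>{b \<in> vecs {rf j..<m - k}. b (rf j) = c \<and> (\<forall>l<m - k. act g b l = 0)}. f (flip j b))"
    (is "sum f ?D = sum _ ?B")
proof (rule sum.reindex_bij_witness[of _ "flip j" "unflip j"])
  have vm: "d \<in> vecs {..<m}" if "d \<in> vecs {k..j}" for d :: "nat \<Rightarrow> 'a"
    using that kj by (auto simp: vecs_def)
  fix d assume d: "d \<in> ?D"
  then show eq: "flip j (unflip j d) = d"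
    by (intro flip_unflip vm) auto
  have "unflip j d (rf j) = d j"
    using kj by (simp add: unflip_def flip: mult.assoc)
  then show "unflip j d \<in> ?B"
    using d colact_flip_eq_zero_iff[OF g, of k j "unflip j d"] kj unflip_mem_vecs[OF kj, of d]
    by (auto simp: eq)
  show "f (flip j (unflip j d)) = f d"
    by (simp add: eq)
next
  have vm: "d \<in> vecs {..<m}" if "d \<in> vecs {rf j..<m - k}" for d :: "nat \<Rightarrow> 'a"
    by (rule subsetD[OF vecs_mono that]) auto
  fix b assume b: "b \<in> ?B"
  then show "unflip j (flip j b) = b"
    by (intro unflip_flip vm) auto
  have "flip j b j = b (rf j)"
    using kj by (simp add: flip_def flip: mult.assoc)
  then show "flip j b \<in> ?D"
    using b colact_flip_eq_zero_iff[OF g, of k j b] kj flip_mem_vecs[OF kj, of b] by auto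
qed

lemma sum_cofixers_to_flip:
  fixes g :: "'a::{field,finite} mat" and f :: "(nat \<Rightarrow> 'a) \<Rightarrow> complex"
  assumes "g \<in> U" "k \<le> j" "j < m"
  shows "(\<Sum>d\<in>cofixers_to m g k j. f d) = (\<Sum>b\<in>fixers_from g (rf j) (m - k). f (flip j b))"
  using sum_flip[OF assms, where c = 1 and f = f] assms(3)
  by (simp add: cofixers_to_alt fixers_from_def conj_commute conj_left_commute)

lemma sum_cofixers_flip:
  fixes g :: "'a::{field,finite} mat" and f :: "(nat \<Rightarrow> 'a) \<Rightarrow> complex"
  assumes "g \<in> U" "k \<le> j" "j < m"
  shows "(\<Sum>d\<in>cofixers m g k j. f d) = (\<Sum>b\<in>fixers g (rf j) (m - k). f (flip j b))"
proof -
  have "d \<in> vecs {k..<j} \<longleftrightarrow> d \<in> vecs {k..j} \<and> d j = 0" for d :: "nat \<Rightarrow> 'a"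
    using assms(2) by (auto simp: vecs_def) (metis le_neq_implies_less)
  moreover have "b \<in> vecs {rf j<..<m - k} \<longleftrightarrow> b \<in> vecs {rf j..<m - k} \<and> b (rf j) = 0" for b :: "nat \<Rightarrow> 'a"
    by (auto simp: vecs_def) (metis le_neq_implies_less)
  ultimately show ?thesis
    using sum_flip[OF assms, where c = 0 and f = f] assms(3) by (simp add: cofixers_alt fixers_def)
qed

text \<open>Here y is t g t^-1. Pairing row i of y t with row j of t isolates the entry of y at (i,
  rf j); since y t = t g, it is the pairing of A (g - 1) with B for the rows A, B of t. The tails of
  A and B drop out, so the entry depends only on the two prefixes, that is, on the coset of
  t.\<close>

lemma conj_entry:
  fixes g t y :: "'a::field mat"
  assumes g: "g \<in> U" and t: "t \<in> U" and y: "y \<in> U"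
    and yt: "y * t = t * g" and ij: "i < n" "j < n"
    and fix_i: "\<And>l. l < n \<Longrightarrow> act g (row_fun t i) l = 0"
    and fix_j: "\<And>l. l < n + mid \<Longrightarrow> act g (row_fun t j) l = 0"
  shows "y $$ (i, rf j) =
    eps * pairing (act g (truncate n (row_fun t i))) (truncate (n + mid) (row_fun t j))"
proof -
  let ?A = "row_fun t i" and ?B = "row_fun t j"
  let ?a = "truncate n ?A" and ?b = "truncate (n + mid) ?B"
  define a' where "a' = ?A - ?a"
  define b' where "b' = ?B - ?b"
  have A: "?A = ?a + a'" and B: "?B = ?b + b'"
    by (auto simp: a'_def b'_def fun_eq_iff)
  have a'0: "a' k = 0" if "k < n" for k
    using that by (simp add: a'_def truncate_def)
  have b'0: "b' k = 0" if "k < n + mid" for k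
    using that by (simp add: b'_def truncate_def)
  have act_b: "act g ?b k = 0" if "k < n + mid" for k
    using that fix_j by (simp add: act_truncate)
  have act_a': "act g a' k = 0" if "k \<le> n" for k
    using a'0 that by (rule act_prefix_zero)
  have "pairing (row_fun (y * t) i) ?B = pairing (\<lambda>l. \<Sum>k<m. y $$ (i, k) * t $$ (k, l)) ?B"
  proof (rule pairing_cong)
    fix l assume "l < m"
    then show "(y * t) $$ (i, l) = (\<Sum>k<m. y $$ (i, k) * t $$ (k, l))"
      using ij by (intro index_mult_sum[OF U_carrier[OF y] U_carrier[OF t]]) auto
  qed simp
  also have "\<dots> = (\<Sum>k<m. if k = rf j then y $$ (i, rf j) * eps else 0)"
    unfolding pairing_sum_left
  proof (intro sum.cong refl)
    fix k assume "k \<in> {..<m}"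
    then show "y $$ (i, k) * pairing (row_fun t k) ?B = (if k = rf j then y $$ (i, rf j) * eps else 0)"
      using ij rf_ge[of j] by (auto simp: pairing_rows[OF t] sg_def)
  qed
  also have "\<dots> = y $$ (i, rf j) * eps"
    using ij by simp
  also have "pairing (row_fun (y * t) i) ?B = pairing (?A + act g ?A) ?B"
    unfolding yt
    by (rule pairing_cong)
      (use ij mult_row_act[OF U_carrier[OF t] U_unitriangular[OF g]] in auto)
  also have "\<dots> = pairing (act g ?A) ?B"
    using ij rf_ge[of i] by (simp add: pairing_add_left pairing_rows[OF t])
  also have "\<dots> = pairing (act g ?A) ?b + pairing (act g ?A) b'"
    by (subst B) (rule pairing_add_right)
  also have "pairing (act g ?A) b' = 0"
    by (rule pairing_eq_zero[of n _ "n + mid"]) (use fix_i b'0 m_eq in auto)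
  also have "pairing (act g ?A) ?b = pairing (act g ?a) ?b + pairing (act g a') ?b"
  proof -
    have "act g ?A = act g ?a + act g a'"
      by (subst A) (simp add: fun_eq_iff act_add)
    then show ?thesis by (simp add: pairing_add_left)
  qed
  \<comment> \<open>Counting zero coordinates does not suffice here. Invariance moves g - 1 over to
    ?b, which is fixed in the first n + mid columns.\<close>
  also have "pairing (act g a') ?b = 0"
  proof -
    have "pairing (a' + act g a') (act g ?b) = 0"
      by (rule pairing_eq_zero[of n _ "n + mid"]) (use a'0 act_a' act_b m_eq in auto)
    moreover have "pairing (a' + act g a') (?b + act g ?b) = pairing a' ?b"
      by (rule pairing_act[OF g])
    ultimately show ?thesis
      by (simp add: pairing_add_left pairing_add_right)
  qed
  finally have "y $$ (i, rf j) * eps * eps = eps * pairing (act g ?a) ?b"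
    by simp
  then show ?thesis
    by (simp add: mult.assoc)
qed

lemma U_quotient:
  assumes "s \<in> U" "t \<in> U"
  shows "s * inv\<^bsub>G\<^esub> t \<in> U" "s * inv\<^bsub>G\<^esub> t * (t :: 'a::field mat) = s"
proof -
  interpret group "G :: 'a mat monoid" by (rule group_U)
  have st: "s \<in> carrier G" "t \<in> carrier G"
    using assms by simp_all
  then have "s \<otimes>\<^bsub>G\<^esub> inv\<^bsub>G\<^esub> t \<otimes>\<^bsub>G\<^esub> t = s"
    by (simp only: m_assoc inv_closed l_inv r_one)
  then show "s * inv\<^bsub>G\<^esub> t * t = s" by simp
  have "s \<otimes>\<^bsub>G\<^esub> inv\<^bsub>G\<^esub> t \<in> carrier G"
    using st by (intro m_closed inv_closed)
  then show "s * inv\<^bsub>G\<^esub> t \<in> U" by simp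
qed

end

section \<open>Reflection of entry sums and evaluation of the induced characters\<close>

locale classical_characters = classical_type T n + additive_character \<theta>
  for T :: series and n :: nat and \<theta> :: "'a::{field,finite} \<Rightarrow> complex" +
  assumes two_nonzero: "(2 :: 'a) \<noteq> 0"
begin

text \<open>The hybrid formula at k = Suc i turns the row sum into a column sum, and the form turns
  columns back into rows. The scalar picks up the signs of the Gram matrix and one minus sign from
  moving g - 1 across the form.\<close>

lemma entry_sum_reflect:
  fixes g :: "'a mat"
  assumes g: "g \<in> U" and ij: "i < j" "j < m" and r: "r \<noteq> 0"
  shows "entry_sum g i j r = entry_sum g (rf j) (rf i) (- (sg i * sg j * r))"
proof -
  have "entry_sum g i j r = (\<Sum>d\<in>cofixers_to m g (Suc i) j. \<theta> (r * colact m g d i))"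
    using entry_sum_hybrid[of i "Suc i" j m r g] ij r by (simp add: fixers_from_Suc bil_unit_fun)
  also have "\<dots> = (\<Sum>b\<in>fixers_from g (rf j) (rf i). \<theta> (r * colact m g (flip j b) i))"
    using sum_cofixers_to_flip[OF g, of "Suc i" j] ij by (simp add: rf_def)
  also have "\<dots> = (\<Sum>b\<in>fixers_from g (rf j) (rf i). \<theta> (- (sg i * sg j * r) * act g b (rf i)))"
  proof (intro sum.cong refl)
    fix b assume "b \<in> fixers_from g (rf j) (rf i)"
    then have "colact m g (flip j b) i = - (sg i * sg j * act g b (rf i))"
      using ij by (intro colact_flip_last[OF g]) (auto simp: fixers_from_def)
    then show "\<theta> (r * colact m g (flip j b) i) = \<theta> (- (sg i * sg j * r) * act g b (rf i))"
      by (simp add: mult_ac)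
  qed
  finally show ?thesis
    by (simp add: entry_sum_def)
qed

text \<open>The hybrid formula cut at k = n, with the column half reflected. Both halves are then
  row vectors, of lengths n and n + mid, which match the two row conditions defining the subgroup of
  a \<open>Sum\<close> root.\<close>

lemma entry_sum_pairing:
  fixes g :: "'a mat"
  assumes g: "g \<in> U" and ij: "i < n" "j < n" and r: "r \<noteq> 0"
  shows "entry_sum g i (rf j) r = (\<Sum>a\<in>fixers_from g i n. \<Sum>b\<in>fixers_from g j (n + mid).
    \<theta> (r * (eps * pairing (act g a) b)))"
proof -
  have "sg (rf j) = (eps :: 'a)" "n \<le> rf j" "m - n = n + mid"
    using ij rf_ge[of j] by (auto simp: sg_def m_eq)
  then show ?thesis
    using sum_cofixers_to_flip[OF g, of n "rf j"] ij r
    by (subst entry_sum_hybrid[of i n "rf j" m r g]) (auto simp: bil_flip)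
qed

lemma entry_sum_zero_pairing:
  fixes g :: "'a mat"
  assumes g: "g \<in> U" and ij: "i < n" "j < n"
  shows "entry_sum g i (rf j) 0 = (\<Sum>a\<in>fixers_from g i n. \<Sum>b\<in>fixers g j (n + mid).
    \<theta> (eps * pairing (act g a) b))"
proof -
  have "sg (rf j) = (eps :: 'a)" "n \<le> rf j" "rf j < m" "m - n = n + mid"
    using ij rf_ge[of j] by (auto simp: sg_def) (simp add: m_eq)
  then show ?thesis
    using sum_cofixers_flip[OF g, of n "rf j"] ij
    by (subst entry_sum_zero_hybrid[of i n "rf j" m g]) (auto simp: bil_flip less_imp_le)
qed

lemma row_prescribed:
  fixes a b :: "nat \<Rightarrow> 'a"
  assumes "i < n" "j < n" "i \<noteq> j" "p \<le> n + mid" "q \<le> n + mid"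
    "a \<in> row_vecs i p" "b \<in> row_vecs j q" "i < p" "j < q"
  shows "\<exists>t\<in>U. truncate p (row_fun t i) = a \<and> truncate q (row_fun t j) = b"
proof -
  obtain t where t: "t \<in> U"
    "\<And>k l. k < n \<Longrightarrow> l < n + mid \<Longrightarrow> k < l \<Longrightarrow> t $$ (k, l) = (if k = i then a l else b l)"
    using U_prescribed[OF two_nonzero, of "\<lambda>k l. if k = i then a l else b l"] by blast
  note tD = unitriangularD[OF U_unitriangular[OF t(1)]]
  have "truncate p (row_fun t i) k = a k" for k
    using assms t(2)[of i k] tD(2)[of i] tD(3)[of k i]
    by (cases k i rule: linorder_cases) (auto simp: truncate_def row_vecs_def vecs_def)
  moreover have "truncate q (row_fun t j) k = b k" for k
    using assms t(2)[of j k] tD(2)[of j] tD(3)[of k j]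
    by (cases k j rule: linorder_cases) (auto simp: truncate_def row_vecs_def vecs_def)
  ultimately show ?thesis
    using t(1) by blast
qed

lemma single_row_prescribed:
  fixes a :: "nat \<Rightarrow> 'a"
  assumes "i < n" "p \<le> n + mid" "a \<in> row_vecs i p" "i < p"
  shows "\<exists>t\<in>U. truncate p (row_fun t i) = a"
proof -
  obtain t where t: "t \<in> U"
    "\<And>k l. k < n \<Longrightarrow> l < n + mid \<Longrightarrow> k < l \<Longrightarrow> t $$ (k, l) = a l"
    using U_prescribed[OF two_nonzero, of "\<lambda>k l. a l"] by blast
  note tD = unitriangularD[OF U_unitriangular[OF t(1)]]
  have "truncate p (row_fun t i) k = a k" for k
    using assms t(2)[of i k] tD(2)[of i] tD(3)[of k i]
    by (cases k i rule: linorder_cases) (auto simp: truncate_def row_vecs_def vecs_def)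
  then show ?thesis
    using t(1) by blast
qed

lemma truncate_image:
  assumes "i < n" "i < j" "j \<le> n + mid"
  shows "(\<lambda>t. truncate j (row_fun t i)) ` carrier G = (row_vecs i j :: (nat \<Rightarrow> 'a) set)"
proof
  show "(\<lambda>t. truncate j (row_fun t i)) ` carrier G \<subseteq> (row_vecs i j :: (nat \<Rightarrow> 'a) set)"
    using assms m_eq by (auto intro: truncate_row_vecs U_unitriangular)
  show "(row_vecs i j :: (nat \<Rightarrow> 'a) set) \<subseteq> (\<lambda>t. truncate j (row_fun t i)) ` carrier G"
    using single_row_prescribed[OF assms(1,3) _ assms(2)] by fastforce
qed

lemma prefix_condition_iff:
  fixes s t :: "'a mat"
  assumes s: "s \<in> U" and t: "t \<in> U" and "i < j" "j \<le> m"
  shows "(\<forall>k. i < k \<and> k < j \<longrightarrow> (s * inv\<^bsub>G\<^esub> t) $$ (i, k) = 0) \<longleftrightarrow>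
    truncate j (row_fun s i) = truncate j (row_fun t i)"
  using mult_row_prefix_iff[OF U_unitriangular[OF t] U_unitriangular[OF U_quotient(1)[OF s t]] assms(3,4)]
  by (simp add: U_quotient(2)[OF s t] truncate_eq_iff)

lemma prefix_condition_act:
  fixes g t :: "'a mat"
  assumes g: "g \<in> U" and t: "t \<in> U" and ij: "i < j" "j \<le> m"
  shows "(\<forall>k. i < k \<and> k < j \<longrightarrow> (t * g * inv\<^bsub>G\<^esub> t) $$ (i, k) = 0) \<longleftrightarrow>
    (\<forall>l<j. act g (truncate j (row_fun t i)) l = 0)"
proof -
  have "(t * g) $$ (i, l) = t $$ (i, l) + act g (row_fun t i) l" if "l < j" for l
    using mult_row_act[OF U_carrier[OF t] U_unitriangular[OF g], of i l] that ij by simp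
  then show ?thesis
    unfolding prefix_condition_iff[OF U_mult[OF t g] t ij]
    by (auto simp: truncate_eq_iff act_truncate)
qed

text \<open>Serves the roots \<open>Diff\<close> and \<open>Short\<close>. The conjugate of g by t
  lies in the subgroup exactly if the prefix of row i of t is fixed in the columns before j, and its
  entry at (i, j) is then column j of the prefix times g - 1.\<close>

lemma induced_row:
  fixes g :: "'a mat"
  assumes g: "g \<in> U" and ij: "i < n" "i < j" "j \<le> n + mid" "j < m"
  shows "induced G {x \<in> U. \<forall>k. i < k \<and> k < j \<longrightarrow> x $$ (i, k) = 0}
    (\<lambda>x. \<theta> (r * x $$ (i, j))) g = entry_sum g i j r"
proof -
  interpret group "G :: 'a mat monoid" by (rule group_U)
  let ?H = "{x \<in> U. \<forall>k. i < k \<and> k < j \<longrightarrow> x $$ (i, k) = 0}"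
  let ?F = "\<lambda>a. if \<forall>l<j. act g a l = 0 then \<theta> (r * act g a j) else 0"
  have "induced G ?H (\<lambda>x. \<theta> (r * x $$ (i, j))) g = (\<Sum>a\<in>row_vecs i j. ?F a)"
  proof (rule induced_eq_sum[where f = "\<lambda>t. truncate j (row_fun t i)"])
    show "(\<lambda>t. truncate j (row_fun t i)) ` carrier G = (row_vecs i j :: (nat \<Rightarrow> 'a) set)"
      by (rule truncate_image[OF ij(1-3)])
  next
    fix s t :: "'a mat" assume st: "s \<in> carrier G" "t \<in> carrier G"
    then show "truncate j (row_fun s i) = truncate j (row_fun t i) \<longleftrightarrow> s \<otimes>\<^bsub>G\<^esub> inv\<^bsub>G\<^esub> t \<in> ?H"
      using prefix_condition_iff[of s t i j] ij U_quotient[of s t] by simp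
  next
    fix t :: "'a mat" assume "t \<in> carrier G"
    then have t: "t \<in> U" by simp
    let ?y = "t * g * inv\<^bsub>G\<^esub> t"
    note y = U_quotient[OF U_mult[OF t g] t]
    have "?y $$ (i, j) = act g (truncate j (row_fun t i)) j"
      if "\<forall>k. i < k \<and> k < j \<longrightarrow> ?y $$ (i, k) = 0"
    proof -
      have "(?y * t) $$ (i, j) = t $$ (i, j) + ?y $$ (i, j)"
        by (rule mult_row_prefix(2)[OF U_unitriangular[OF t] U_unitriangular[OF y(1)]])
          (use that ij in auto)
      then show ?thesis
        unfolding y(2) using mult_row_act[OF U_carrier[OF t] U_unitriangular[OF g], of i j] ij
        by (simp add: act_truncate)
    qed
    then show "(if t \<otimes>\<^bsub>G\<^esub> g \<otimes>\<^bsub>G\<^esub> inv\<^bsub>G\<^esub> t \<in> ?H then \<theta> (r * (t \<otimes>\<^bsub>G\<^esub> g \<otimes>\<^bsub>G\<^esub> inv\<^bsub>G\<^esub> t) $$ (i, j)) else 0) =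
        ?F (truncate j (row_fun t i))"
      using prefix_condition_act[OF g t, of i j] ij y(1) by simp
  qed (use g finite_U in auto)
  then show ?thesis
    by (simp add: entry_sum_def fixers_from_eq sum.inter_filter)
qed

text \<open>Serves the roots \<open>Sum\<close>. A coset is a pair of row prefixes;
  \<open>conj_entry\<close> evaluates the character on it, and \<open>entry_sum_pairing\<close>
  reassembles the double sum into a single row sum.\<close>

lemma induced_pair:
  fixes g :: "'a mat"
  assumes g: "g \<in> U" and ij: "i < j" "j < n" and r: "r \<noteq> 0"
  shows "induced G {x \<in> U. (\<forall>k. i < k \<and> k < n \<longrightarrow> x $$ (i, k) = 0) \<and>
      (\<forall>k. j < k \<and> k < n + mid \<longrightarrow> x $$ (j, k) = 0)}
    (\<lambda>x. \<theta> (r * x $$ (i, rf j))) g = entry_sum g i (rf j) r"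
proof -
  interpret group "G :: 'a mat monoid" by (rule group_U)
  let ?H = "{x \<in> U. (\<forall>k. i < k \<and> k < n \<longrightarrow> x $$ (i, k) = 0) \<and>
      (\<forall>k. j < k \<and> k < n + mid \<longrightarrow> x $$ (j, k) = 0)}"
  let ?f = "\<lambda>t. (truncate n (row_fun t i), truncate (n + mid) (row_fun t j))"
  let ?P = "\<lambda>a. \<forall>l<n. act g a l = 0" and ?Q = "\<lambda>b. \<forall>l<n + mid. act g b l = 0"
  let ?F = "\<lambda>(a, b). if ?P a \<and> ?Q b then \<theta> (r * (eps * pairing (act g a) b)) else 0"
  have m: "n \<le> m" "n + mid \<le> m" "i < n" "j < n + mid"
    using ij by (auto simp: m_eq)
  have "induced G ?H (\<lambda>x. \<theta> (r * x $$ (i, rf j))) g = (\<Sum>x\<in>row_vecs i n \<times> row_vecs j (n + mid). ?F x)"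
  proof (rule induced_eq_sum[where f = ?f])
    show "?f ` carrier G = (row_vecs i n \<times> row_vecs j (n + mid) :: ((nat \<Rightarrow> 'a) \<times> (nat \<Rightarrow> 'a)) set)"
    proof
      show "?f ` carrier G \<subseteq> (row_vecs i n \<times> row_vecs j (n + mid) :: ((nat \<Rightarrow> 'a) \<times> (nat \<Rightarrow> 'a)) set)"
        using ij m by (auto intro: truncate_row_vecs U_unitriangular)
      show "(row_vecs i n \<times> row_vecs j (n + mid) :: ((nat \<Rightarrow> 'a) \<times> (nat \<Rightarrow> 'a)) set) \<subseteq> ?f ` carrier G"
        using row_prescribed[of i j n "n + mid"] ij m by fastforce
    qed
  next
    fix s t :: "'a mat" assume st: "s \<in> carrier G" "t \<in> carrier G"
    then show "?f s = ?f t \<longleftrightarrow> s \<otimes>\<^bsub>G\<^esub> inv\<^bsub>G\<^esub> t \<in> ?H"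
      using prefix_condition_iff[of s t i n] prefix_condition_iff[of s t j "n + mid"] m
        U_quotient[of s t] by simp
  next
    fix t :: "'a mat" assume "t \<in> carrier G"
    then have t: "t \<in> U" by simp
    let ?y = "t * g * inv\<^bsub>G\<^esub> t"
    note y = U_quotient[OF U_mult[OF t g] t]
    have "?y $$ (i, rf j) = eps * pairing (act g (truncate n (row_fun t i))) (truncate (n + mid) (row_fun t j))"
      if "?P (truncate n (row_fun t i))" "?Q (truncate (n + mid) (row_fun t j))"
      by (rule conj_entry[OF g t y(1) y(2)]) (use that ij m in \<open>auto simp: act_truncate\<close>)
    then show "(if t \<otimes>\<^bsub>G\<^esub> g \<otimes>\<^bsub>G\<^esub> inv\<^bsub>G\<^esub> t \<in> ?H then \<theta> (r * (t \<otimes>\<^bsub>G\<^esub> g \<otimes>\<^bsub>G\<^esub> inv\<^bsub>G\<^esub> t) $$ (i, rf j)) else 0) =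
        ?F (?f t)"
      using prefix_condition_act[OF g t, of i n] prefix_condition_act[OF g t, of j "n + mid"] m y(1)
      by simp
  qed (use g finite_U in auto)
  also have "\<dots> = (\<Sum>x\<in>{x \<in> row_vecs i n \<times> row_vecs j (n + mid). ?P (fst x) \<and> ?Q (snd x)}.
      \<theta> (r * (eps * pairing (act g (fst x)) (snd x))))"
    by (simp add: sum.inter_filter case_prod_beta)
  also have "{x \<in> row_vecs i n \<times> row_vecs j (n + mid). ?P (fst x) \<and> ?Q (snd x)} =
      fixers_from g i n \<times> fixers_from g j (n + mid)"
    by (auto simp: fixers_from_eq)
  finally show ?thesis
    unfolding entry_sum_pairing[OF g m(3) ij(2) r] sum.cartesian_product by (simp add: case_prod_beta)
qed

definition long_sum :: "'a mat \<Rightarrow> nat \<Rightarrow> 'a \<Rightarrow> complex" where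
  "long_sum g i r = (\<Sum>a\<in>fixers_from g i n. \<theta> (r * (eps * pairing (act g a) a)))"

text \<open>The case i = j of the conjugation formula: one prefix occupies both slots, so the
  exponent is quadratic instead of bilinear.\<close>

lemma induced_long:
  fixes g :: "'a mat"
  assumes g: "g \<in> U" and i: "i < n" and mid0: "mid = 0"
  shows "induced G {x \<in> U. \<forall>k. i < k \<and> k < n \<longrightarrow> x $$ (i, k) = 0}
    (\<lambda>x. \<theta> (r * x $$ (i, rf i))) g = long_sum g i r"
proof -
  interpret group "G :: 'a mat monoid" by (rule group_U)
  let ?H = "{x \<in> U. \<forall>k. i < k \<and> k < n \<longrightarrow> x $$ (i, k) = 0}"
  let ?F = "\<lambda>a. if \<forall>l<n. act g a l = 0 then \<theta> (r * (eps * pairing (act g a) a)) else 0"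
  have "n \<le> m" by (simp add: m_eq)
  have "induced G ?H (\<lambda>x. \<theta> (r * x $$ (i, rf i))) g = (\<Sum>a\<in>row_vecs i n. ?F a)"
  proof (rule induced_eq_sum[where f = "\<lambda>t. truncate n (row_fun t i)"])
    show "(\<lambda>t. truncate n (row_fun t i)) ` carrier G = (row_vecs i n :: (nat \<Rightarrow> 'a) set)"
      by (rule truncate_image[OF i i]) simp
  next
    fix s t :: "'a mat" assume st: "s \<in> carrier G" "t \<in> carrier G"
    then show "truncate n (row_fun s i) = truncate n (row_fun t i) \<longleftrightarrow> s \<otimes>\<^bsub>G\<^esub> inv\<^bsub>G\<^esub> t \<in> ?H"
      using prefix_condition_iff[of s t i n] i \<open>n \<le> m\<close> U_quotient[of s t] by simp
  next
    fix t :: "'a mat" assume "t \<in> carrier G"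
    then have t: "t \<in> U" by simp
    let ?y = "t * g * inv\<^bsub>G\<^esub> t"
    let ?a = "truncate n (row_fun t i)"
    note y = U_quotient[OF U_mult[OF t g] t]
    have "?y $$ (i, rf i) = eps * pairing (act g ?a) ?a" if "\<forall>l<n. act g ?a l = 0"
      using conj_entry[OF g t y(1) y(2) i i] that mid0 by (simp add: act_truncate)
    then show "(if t \<otimes>\<^bsub>G\<^esub> g \<otimes>\<^bsub>G\<^esub> inv\<^bsub>G\<^esub> t \<in> ?H then \<theta> (r * (t \<otimes>\<^bsub>G\<^esub> g \<otimes>\<^bsub>G\<^esub> inv\<^bsub>G\<^esub> t) $$ (i, rf i)) else 0) = ?F ?a"
      using prefix_condition_act[OF g t, of i n] i \<open>n \<le> m\<close> y(1) by simp
  qed (use g finite_U in auto)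
  then show ?thesis
    by (simp add: long_sum_def fixers_from_eq sum.inter_filter)
qed

end

section \<open>Product rules\<close>

lemma sum_fixers_from_translate:
  fixes f :: "(nat \<Rightarrow> 'a::{field,finite}) \<Rightarrow> complex"
  assumes "b \<in> fixers_from g i j" "i < j"
  shows "(\<Sum>a\<in>fixers_from g i j. f a) = (\<Sum>w\<in>fixers g i j. f (b + w))"
proof -
  have "(\<lambda>l. if l < j then b l else 0) = b"
    using assms by (auto simp: fixers_from_def vecs_def)
  moreover have "inj_on (\<lambda>w. b + w) (fixers g i j)"
    by (rule inj_onI) simp
  ultimately show ?thesis
    using fixers_from_translate[OF assms order_refl] by (simp add: sum.reindex)
qed

lemma fixers_from_add: "a \<in> fixers_from g i j \<Longrightarrow> w \<in> fixers g i j \<Longrightarrow> a + w \<in> fixers_from g i j"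
  by (auto simp: fixers_from_def fixers_def vecs_def act_add)

lemma sum_fixers_from_shift:
  fixes f :: "(nat \<Rightarrow> 'a::{field,finite}) \<Rightarrow> complex"
  assumes "w \<in> fixers g i j"
  shows "(\<Sum>a\<in>fixers_from g i j. f a) = (\<Sum>a\<in>fixers_from g i j. f (a + w))"
proof (rule sum.reindex_bij_witness[of _ "\<lambda>a. a + w" "\<lambda>a. a - w"])
  have "(\<lambda>k. - 1 * w k) \<in> fixers g i j"
    using assms by (rule fixers_scale)
  moreover have "a - w = a + (\<lambda>k. - 1 * w k)" for a
    by (simp add: fun_eq_iff)
  ultimately show "a - w \<in> fixers_from g i j" if "a \<in> fixers_from g i j" for a
    using that fixers_from_add by metis
qed (use assms fixers_from_add in auto)

lemma sum_fixers_scale: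
  fixes f :: "(nat \<Rightarrow> 'a::{field,finite}) \<Rightarrow> complex"
  assumes "t \<noteq> 0"
  shows "(\<Sum>w\<in>fixers g i j. f w) = (\<Sum>w\<in>fixers g i j. f (\<lambda>k. t * w k))"
proof (rule sum.reindex_bij_witness[of _ "\<lambda>w k. t * w k" "\<lambda>w k. inverse t * w k"])
  show "f (\<lambda>k. t * (inverse t * w k)) = f w" for w
    using assms by (simp flip: mult.assoc)
qed (use assms in \<open>auto simp: fixers_scale mult.assoc[symmetric]\<close>)

context classical_type
begin

text \<open>For symplectic g and on \<open>half_fixers g\<close> this is the symmetric bilinear form
  whose quadratic form is the exponent in \<open>long_sum\<close>.\<close>

definition qform :: "'a::field mat \<Rightarrow> (nat \<Rightarrow> 'a) \<Rightarrow> (nat \<Rightarrow> 'a) \<Rightarrow> 'a" where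
  "qform g a b = eps * pairing (act g a) b"

definition half_fixers :: "'a::field mat \<Rightarrow> (nat \<Rightarrow> 'a) set" where
  "half_fixers g = {a \<in> vecs {..<n}. \<forall>l<n. act g a l = 0}"

lemma fixers_half: "a \<in> fixers g i n \<Longrightarrow> a \<in> half_fixers g"
  and fixers_from_half: "a \<in> fixers_from g i n \<Longrightarrow> a \<in> half_fixers g"
  by (auto simp: half_fixers_def fixers_def fixers_from_def vecs_def)

lemma qform_add_left: "qform g (a + b) c = qform g a c + qform g b c"
proof -
  have "act g (a + b) = act g a + act g b"
    by (simp add: fun_eq_iff act_add)
  then show ?thesis
    by (simp add: qform_def pairing_add_left distrib_left)
qed

lemma qform_add_right: "qform g c (a + b) = qform g c a + qform g c b"
  by (simp add: qform_def pairing_add_right distrib_left)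

lemma qform_scale_left: "qform g (\<lambda>k. t * a k) c = t * qform g a c"
  by (simp add: qform_def pairing_def act_scale sum_distrib_left mult_ac)

lemma qform_scale_right: "qform g c (\<lambda>k. t * a k) = t * qform g c a"
  by (simp add: qform_def pairing_def sum_distrib_left mult_ac)

text \<open>The first n coordinates span a Lagrangian subspace, so a and b are orthogonal; so are a
  (g - 1) and b (g - 1), supported on the other half. Invariance then makes g - 1 skew, and combined
  with the skew form this gives symmetry.\<close>

lemma qform_commute:
  fixes g :: "'a::field mat"
  assumes g: "g \<in> U" and T: "T = Symplectic"
    and a: "a \<in> half_fixers g" and b: "b \<in> half_fixers g"
  shows "qform g a b = qform g b a"
proof -
  have m: "m = n + n"
    unfolding m_eq using T by (simp add: middle_dim_def)
  have "pairing a b = 0"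
    unfolding pairing_def
  proof (intro sum.neutral ballI)
    fix k assume "k \<in> {..<m}"
    then have "\<not> k < n \<or> \<not> rf k < n"
      by (auto simp: rf_def m)
    then show "sg k * a k * b (rf k) = 0"
      using a b by (auto simp: half_fixers_def vecs_def)
  qed
  moreover have "pairing (act g a) (act g b) = 0"
    by (rule pairing_eq_zero[of n _ n]) (use a b m in \<open>auto simp: half_fixers_def\<close>)
  moreover have "pairing a (act g b) = - pairing (act g b) a"
  proof -
    have "eps = (- 1 :: 'a)"
      unfolding eps_def using T by simp
    then show ?thesis
      using pairing_commute[of "act g b" a] by simp
  qed
  ultimately show ?thesis
    using pairing_act[OF g, of a b] by (simp add: qform_def pairing_add_left pairing_add_right)
qed

text \<open>Invariance of the norm of a: a (g - 1) is isotropic, so twice its pairing with a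
  vanishes, and in this pairing only the positions i and \<open>rf i\<close> meet.\<close>

lemma isotropic_entry_zero:
  fixes g :: "'a::field mat"
  assumes g: "g \<in> U" and T: "T \<noteq> Symplectic" and i: "i < n"
    and a: "a \<in> fixers_from g i (rf i)" and two: "(2 :: 'a) \<noteq> 0"
  shows "act g a (rf i) = 0"
proof -
  have eps: "eps = (1 :: 'a)"
    using T by (simp add: eps_def)
  have low: "act g a k = 0" if "k < rf i" for k
    using a that by (simp add: fixers_from_def)
  have "pairing (act g a) (act g a) = 0"
    by (rule pairing_eq_zero[of "rf i" _ "rf i"]) (use low rf_ge[OF i] m_eq in auto)
  moreover have "pairing a (act g a) = sg i * a i * act g a (rf i)"
    by (rule pairing_single) (use a i low in \<open>auto simp: fixers_from_def vecs_def\<close>)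
  moreover have "pairing (act g a) a = pairing a (act g a)"
    using pairing_commute[of "act g a" a] eps by simp
  ultimately have "act g a (rf i) + act g a (rf i) = 0"
    using pairing_act[OF g, of a a] i a
    by (simp add: pairing_add_left pairing_add_right sg_def fixers_from_def)
  then show ?thesis
    using two by (simp flip: mult_2)
qed

end

context classical_characters
begin

lemma entry_sum_fixed:
  assumes "fixers_from g i k \<noteq> {}" "i < j" "j < k"
  shows "entry_sum g i j r = fixer_sum g i j r"
  using assms entry_sum_translate[of _ g i k j r] by (auto simp: fixers_from_def)

text \<open>Where the sum at k is nonzero, some vector with leading coordinate i is fixed in all
  columns before k, in particular in column j. Taken as base point for the sum at j it has exponent
  zero.\<close>

lemma entry_sum_absorb:
  assumes "i < j" "j < k"
  shows "entry_sum g i j r * entry_sum g i k s = fixer_sum g i j r * entry_sum g i k s"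
  using entry_sum_fixed[OF _ assms, of g r]
  by (cases "fixers_from g i k = {}") (auto simp: entry_sum_def[of g i k])

lemma entry_sum_orthogonal:
  fixes g :: "'a mat"
  assumes "g \<in> U" "T \<noteq> Symplectic" "i < n"
  shows "entry_sum g i (rf i) r = entry_sum g i (rf i) 0"
  unfolding entry_sum_def
  by (rule sum.cong) (use isotropic_entry_zero[OF assms _ two_nonzero] in auto)

definition weil_sum :: "'a mat \<Rightarrow> nat \<Rightarrow> 'a \<Rightarrow> complex" where
  "weil_sum g i c = (\<Sum>w\<in>fixers g i n. \<theta> (c * qform g w w))"

lemma long_sum_eq: "long_sum g i r = (\<Sum>a\<in>fixers_from g i n. \<theta> (r * qform g a a))"
  by (simp add: long_sum_def qform_def)

text \<open>Sorted by leading coordinate as in \<open>fixer_sum_expand\<close>, except that a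
  leading scalar v enters a quadratic form as its square.\<close>

lemma weil_sum_expand:
  assumes "i < n"
  shows "weil_sum g i c = 1 + (\<Sum>l\<in>{i<..<n}. \<Sum>v\<in>-{0}. long_sum g l (c * v\<^sup>2))"
  using assms
proof (induction "n - i" arbitrary: i)
  case (Suc d)
  show ?case
  proof (cases "Suc i < n")
    case False
    then have "{i<..<n} = {}" by auto
    then show ?thesis
      using False by (simp add: weil_sum_def fixers_eq_zero qform_def pairing_def)
  next
    case True
    have "weil_sum g i c = weil_sum g (Suc i) c + (\<Sum>v\<in>-{0}. long_sum g (Suc i) (c * v\<^sup>2))"
      unfolding weil_sum_def long_sum_eq
      by (subst sum_split_at_zero[where x = "Suc i"])
        (use True in \<open>auto simp: fixers_Suc fixers_scale qform_scale_left qform_scale_right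
          power2_eq_square mult_ac\<close>)
    also have "\<dots> = 1 + (\<Sum>l\<in>insert (Suc i) {Suc i<..<n}. \<Sum>v\<in>-{0}. long_sum g l (c * v\<^sup>2))"
      using Suc True by simp
    also have "insert (Suc i) {Suc i<..<n} = {i<..<n}"
      using True by auto
    finally show ?thesis .
  qed
qed simp

context
  fixes g :: "'a mat" and i :: nat
  assumes g: "g \<in> U" and T: "T = Symplectic" and i: "i < n"
begin

lemma mid_zero: "n + mid = n"
  using T by (simp add: middle_dim_def)

lemma qform_add:
  assumes "a \<in> half_fixers g" "b \<in> half_fixers g"
  shows "qform g (a + b) (a + b) = qform g a a + 2 * qform g a b + qform g b b"
  using qform_commute[OF g T assms] by (simp add: qform_add_left qform_add_right)

lemma qform_add_scaled:
  assumes "a \<in> half_fixers g" "b \<in> fixers g i n"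
  shows "qform g (a + (\<lambda>k. t * b k)) (a + (\<lambda>k. t * b k)) =
    qform g a a + 2 * t * qform g a b + t * t * qform g b b"
  using qform_add[OF assms(1) fixers_half[OF fixers_scale[OF assms(2)]], of t]
  by (simp add: qform_scale_left qform_scale_right mult_ac)

text \<open>The first vector is written as b + w and b is shifted by t w, with t still free. The
  parameter governs the cross term and the pure w term of the exponent; two different choices of it
  are made below.\<close>

lemma long_sum_product:
  "long_sum g i r * long_sum g i s = (\<Sum>w\<in>fixers g i n. \<Sum>a\<in>fixers_from g i n.
    \<theta> ((r + s) * qform g a a + 2 * (r + (r + s) * t) * qform g a w +
      (r * (1 + t) * (1 + t) + s * t * t) * qform g w w))"
proof -
  let ?q = "\<lambda>a. qform g a a"
  let ?e = "\<lambda>a w. (r + s) * ?q a + 2 * (r + (r + s) * t) * qform g a w +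
    (r * (1 + t) * (1 + t) + s * t * t) * ?q w"
  have "long_sum g i r * long_sum g i s =
      (\<Sum>b\<in>fixers_from g i n. \<Sum>a\<in>fixers_from g i n. \<theta> (r * ?q a + s * ?q b))"
    unfolding long_sum_eq sum_product by (subst sum.swap) (simp add: \<theta>_add)
  also have "\<dots> = (\<Sum>b\<in>fixers_from g i n. \<Sum>w\<in>fixers g i n. \<theta> (r * ?q (b + w) + s * ?q b))"
    by (intro sum.cong refl sum_fixers_from_translate) (use i in auto)
  also have "\<dots> = (\<Sum>w\<in>fixers g i n. \<Sum>b\<in>fixers_from g i n. \<theta> (r * ?q (b + w) + s * ?q b))"
    by (rule sum.swap)
  also have "\<dots> = (\<Sum>w\<in>fixers g i n. \<Sum>a\<in>fixers_from g i n.
    \<theta> (?e a w))"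
  proof (rule sum.cong[OF refl])
    fix w assume w: "w \<in> fixers g i n"
    let ?tw = "\<lambda>k. t * w k"
    have "(\<Sum>b\<in>fixers_from g i n. \<theta> (r * ?q (b + w) + s * ?q b)) =
        (\<Sum>a\<in>fixers_from g i n. \<theta> (r * ?q (a + ?tw + w) + s * ?q (a + ?tw)))"
      by (rule sum_fixers_from_shift[OF fixers_scale[OF w]])
    also have "\<dots> = (\<Sum>a\<in>fixers_from g i n. \<theta> (?e a w))"
    proof (rule sum.cong[OF refl])
      fix a assume a: "a \<in> fixers_from g i n"
      have "a + ?tw + w = a + (\<lambda>k. (1 + t) * w k)"
        by (simp add: fun_eq_iff algebra_simps)
      then have "r * ?q (a + ?tw + w) + s * ?q (a + ?tw) = ?e a w"
        using qform_add_scaled[OF fixers_from_half[OF a] w, of "1 + t"]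
          qform_add_scaled[OF fixers_from_half[OF a] w, of t] by (simp add: algebra_simps)
      then show "\<theta> (r * ?q (a + ?tw + w) + s * ?q (a + ?tw)) = \<theta> (?e a w)"
        by simp
    qed
    finally show "(\<Sum>b\<in>fixers_from g i n. \<theta> (r * ?q (b + w) + s * ?q b)) =
      (\<Sum>a\<in>fixers_from g i n. \<theta> (?e a w))" .
  qed
  finally show ?thesis .
qed

lemma long_sum_mult:
  assumes "r + s \<noteq> 0"
  shows "long_sum g i r * long_sum g i s = long_sum g i (r + s) * weil_sum g i (r * s / (r + s))"
proof -
  \<comment> \<open>This solves r + (r + s) t = 0, so the cross term disappears and the double sum
    factors.\<close>
  define t where "t = - r / (r + s)"
  have t: "r + (r + s) * t = 0"
    using assms by (simp add: t_def)
  have "1 + t = s / (r + s)"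
    using assms by (simp add: t_def field_simps)
  then have "r * (1 + t) * (1 + t) + s * t * t = (r * s * s + s * r * r) / ((r + s) * (r + s))"
    by (simp add: t_def add_divide_distrib)
  also have "r * s * s + s * r * r = (r * s) * (r + s)"
    by (simp add: algebra_simps)
  finally have c: "r * (1 + t) * (1 + t) + s * t * t = r * s / (r + s)"
    using assms by simp
  show ?thesis
    unfolding long_sum_product[of r s t] t c
    unfolding long_sum_eq weil_sum_def sum_product
    by (subst sum.swap) (simp add: \<theta>_add)
qed

text \<open>With s = -r the quadratic term in a is gone and no shift changes the cross term 2 r;
  instead t = -1/2 removes the quadratic term in w. What remains is bilinear and, once w is
  rescaled, counts the vectors fixed up to the antidiagonal.\<close>

lemma long_sum_cancel:
  assumes "r \<noteq> 0"
  shows "long_sum g i r * long_sum g i (- r) = entry_sum g i (rf i) 0"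
proof -
  define t where "t = - 1 / (2 :: 'a)"
  have "2 * t = - 1"
    using two_nonzero by (simp add: t_def)
  then have "1 + t = - t"
    by (metis add.inverse_inverse add.left_inverse eq_neg_iff_add_eq_0 mult_2 add.assoc)
  then have c: "r * (1 + t) * (1 + t) + - r * t * t = 0"
    unfolding \<open>1 + t = - t\<close> by simp
  have "long_sum g i r * long_sum g i (- r) =
      (\<Sum>w\<in>fixers g i n. \<Sum>a\<in>fixers_from g i n. \<theta> (2 * r * qform g a w))"
    unfolding long_sum_product[of r "- r" t] c by simp
  also have "\<dots> = (\<Sum>a\<in>fixers_from g i n. \<Sum>w\<in>fixers g i n. \<theta> (2 * r * qform g a w))"
    by (rule sum.swap)
  also have "\<dots> = (\<Sum>a\<in>fixers_from g i n. \<Sum>w\<in>fixers g i n. \<theta> (qform g a w))"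
  proof (rule sum.cong[OF refl])
    fix a
    show "(\<Sum>w\<in>fixers g i n. \<theta> (2 * r * qform g a w)) = (\<Sum>w\<in>fixers g i n. \<theta> (qform g a w))"
      using sum_fixers_scale[of "2 * r" "\<lambda>w. \<theta> (qform g a w)" g i n] assms two_nonzero
      by (simp add: qform_scale_right)
  qed
  also have "\<dots> = entry_sum g i (rf i) 0"
    unfolding entry_sum_zero_pairing[OF g i i] mid_zero qform_def ..
  finally show ?thesis .
qed

text \<open>Polarization: with b = a + 2 w, q(a, b) = q(a, a) + 2 q(a, w) = q(a + w, a + w) - q(w,
  w), so the bilinear sum separates into two quadratic ones.\<close>

lemma entry_sum_long:
  assumes "t \<noteq> 0"
  shows "entry_sum g i (rf i) t = long_sum g i t * weil_sum g i (- t)"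
proof -
  let ?q = "\<lambda>a. qform g a a"
  have "long_sum g i t * weil_sum g i (- t) =
      (\<Sum>w\<in>fixers g i n. \<Sum>a\<in>fixers_from g i n. \<theta> (t * ?q a - t * ?q w))"
    unfolding long_sum_eq weil_sum_def sum_product
    by (subst sum.swap) (simp flip: \<theta>_add)
  also have "\<dots> = (\<Sum>w\<in>fixers g i n. \<Sum>a\<in>fixers_from g i n. \<theta> (t * ?q a + 2 * t * qform g a w))"
  proof (rule sum.cong[OF refl])
    fix w assume w: "w \<in> fixers g i n"
    have "(\<Sum>a\<in>fixers_from g i n. \<theta> (t * ?q a - t * ?q w)) =
        (\<Sum>a\<in>fixers_from g i n. \<theta> (t * ?q (a + w) - t * ?q w))"
      by (rule sum_fixers_from_shift[OF w])
    also have "\<dots> = (\<Sum>a\<in>fixers_from g i n. \<theta> (t * ?q a + 2 * t * qform g a w))"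
      by (intro sum.cong refl)
        (simp add: qform_add[OF fixers_from_half fixers_half[OF w]] algebra_simps)
    finally show "(\<Sum>a\<in>fixers_from g i n. \<theta> (t * ?q a - t * ?q w)) =
        (\<Sum>a\<in>fixers_from g i n. \<theta> (t * ?q a + 2 * t * qform g a w))" .
  qed
  also have "\<dots> = (\<Sum>a\<in>fixers_from g i n. \<Sum>w\<in>fixers g i n. \<theta> (t * ?q a + 2 * t * qform g a w))"
    by (rule sum.swap)
  also have "\<dots> = (\<Sum>a\<in>fixers_from g i n. \<Sum>b\<in>fixers_from g i n. \<theta> (t * qform g a b))"
  proof (rule sum.cong[OF refl])
    fix a assume a: "a \<in> fixers_from g i n"
    have "(\<Sum>b\<in>fixers_from g i n. \<theta> (t * qform g a b)) =
        (\<Sum>w\<in>fixers g i n. \<theta> (t * qform g a (a + w)))"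
      by (rule sum_fixers_from_translate[OF a i])
    also have "\<dots> = (\<Sum>w\<in>fixers g i n. \<theta> (t * qform g a (a + (\<lambda>k. 2 * w k))))"
      by (rule sum_fixers_scale[OF two_nonzero])
    finally show "(\<Sum>w\<in>fixers g i n. \<theta> (t * ?q a + 2 * t * qform g a w)) =
        (\<Sum>b\<in>fixers_from g i n. \<theta> (t * qform g a b))"
      unfolding qform_add_right qform_scale_right by (simp add: distrib_left mult_ac)
  qed
  also have "\<dots> = entry_sum g i (rf i) t"
    unfolding entry_sum_pairing[OF g i i assms] mid_zero qform_def ..
  finally show ?thesis ..
qed

text \<open>By \<open>long_sum_cancel\<close> the squared absolute value of the long sum counts the
  vectors with leading coordinate i fixed up to the antidiagonal. A nonzero long sum thus provides a
  vector fixed in column j.\<close>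

lemma long_sum_entry_sum:
  assumes "r \<noteq> 0" "i < j" "j < rf i"
  shows "long_sum g i r * entry_sum g i j s = long_sum g i r * fixer_sum g i j s"
proof (cases "long_sum g i r = 0")
  case False
  have "long_sum g i (- r) = cnj (long_sum g i r)"
    by (simp add: long_sum_eq \<theta>_minus)
  then have "entry_sum g i (rf i) 0 \<noteq> 0"
    using False long_sum_cancel[OF assms(1)] by auto
  then have "fixers_from g i (rf i) \<noteq> {}"
    by (auto simp: entry_sum_def)
  then show ?thesis
    using entry_sum_fixed assms by simp
qed simp

text \<open>The first half of a vector fixed beyond the antidiagonal lies in the radical of the
  quadratic form on \<open>half_fixers g\<close> from coordinate i on. With it as base point, only
  the sum over the direction space is left.\<close>

lemma long_sum_fixed:
  assumes b: "b \<in> fixers_from g i h" and h: "rf i < h" "h \<le> m"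
  shows "long_sum g i r = weil_sum g i r"
proof -
  let ?c = "truncate n b"
  define b' where "b' = b - ?c"
  have b_eq: "b = ?c + b'" and b': "b' k = 0" if "k < n" for k
    using that by (auto simp: b'_def truncate_def)
  have nh: "n < h"
    using h rf_ge[OF i] by simp
  have c: "?c \<in> fixers_from g i n"
    using b nh i by (auto simp: fixers_from_def vecs_def act_truncate truncate_def)
  have act_b: "act g b k = 0" if "k < h" for k
    using b that by (simp add: fixers_from_def)
  \<comment> \<open>Invariance for b and x: both terms with b (g - 1) vanish by counting zero
    coordinates, since h exceeds \<open>rf i\<close>. Hence b, and with it its first half ?c, is
    orthogonal to x (g - 1).\<close>
  have zero: "qform g x ?c = 0" if x: "x \<in> half_fixers g" "\<And>k. k < i \<Longrightarrow> x k = 0" for x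
  proof -
    have act_x: "act g x k = 0" if "k < n" for k
      using x(1) that by (simp add: half_fixers_def)
    have "pairing (act g b) (act g x) = 0"
      by (rule pairing_eq_zero[of h _ n]) (use act_b act_x nh mid_zero m_eq in auto)
    moreover have "pairing (act g b) x = 0"
      by (rule pairing_eq_zero[of h _ i]) (use act_b x(2) h in \<open>auto simp: rf_def\<close>)
    moreover have "pairing b' (act g x) = 0"
      by (rule pairing_eq_zero[of n _ n]) (use b' act_x mid_zero m_eq in auto)
    moreover have "pairing b (act g x) = pairing ?c (act g x) + pairing b' (act g x)"
      using pairing_add_left[of ?c b' "act g x"] by (simp add: b'_def)
    ultimately have "pairing ?c (act g x) = 0"
      using pairing_act[OF g, of b x] by (simp add: pairing_add_left pairing_add_right)
    then show ?thesis
      using pairing_commute[of ?c "act g x"] by (simp add: qform_def)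
  qed
  have "long_sum g i r = (\<Sum>w\<in>fixers g i n. \<theta> (r * qform g (?c + w) (?c + w)))"
    unfolding long_sum_eq by (rule sum_fixers_from_translate[OF c i])
  also have "\<dots> = weil_sum g i r"
    unfolding weil_sum_def
  proof (intro sum.cong refl)
    fix w assume w: "w \<in> fixers g i n"
    have "qform g ?c ?c = 0"
      by (rule zero) (use fixers_from_half[OF c] c in \<open>auto simp: fixers_from_def vecs_def\<close>)
    moreover have "qform g w ?c = 0"
      by (rule zero) (use fixers_half[OF w] w in \<open>auto simp: fixers_def vecs_def\<close>)
    ultimately have "qform g (?c + w) (?c + w) = qform g w w"
      using qform_commute[OF g T fixers_from_half[OF c] fixers_half[OF w]]
      by (simp add: qform_add_left qform_add_right)
    then show "\<theta> (r * qform g (?c + w) (?c + w)) = \<theta> (r * qform g w w)"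
      by simp
  qed
  finally show ?thesis .
qed

lemma long_sum_absorb:
  assumes "rf i < h" "h \<le> m"
  shows "long_sum g i r * entry_sum g i h s = weil_sum g i r * entry_sum g i h s"
  using long_sum_fixed[OF _ assms, of _ r]
  by (cases "fixers_from g i h = {}") (auto simp: entry_sum_def[of g i h])

end

end

section \<open>Decomposition into supercharacters\<close>

lemma all_int_interval_iff:
  assumes "1 \<le> i"
  shows "(\<forall>k. i < k \<and> k < j \<longrightarrow> P (nat (k - 1))) \<longleftrightarrow>
    (\<forall>k. nat (i - 1) < k \<and> k < nat (j - 1) \<longrightarrow> P k)"
proof
  assume *: "\<forall>k. i < k \<and> k < j \<longrightarrow> P (nat (k - 1))"
  show "\<forall>k. nat (i - 1) < k \<and> k < nat (j - 1) \<longrightarrow> P k"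
  proof (intro allI impI)
    fix k assume "nat (i - 1) < k \<and> k < nat (j - 1)"
    then have "i < int k + 1 \<and> int k + 1 < j"
      using assms by linarith
    then show "P k"
      using *[rule_format, of "int k + 1"] by simp
  qed
next
  assume *: "\<forall>k. nat (i - 1) < k \<and> k < nat (j - 1) \<longrightarrow> P k"
  show "\<forall>k. i < k \<and> k < j \<longrightarrow> P (nat (k - 1))"
    using * assms by auto
qed

section \<open>Positions, weights and clashes of roots\<close>

context classical_type
begin

fun root_pos :: "root \<Rightarrow> nat \<times> nat" where
  "root_pos (Diff i j) = (nat (i - 1), nat (j - 1))"
| "root_pos (Sum i j) = (nat (i - 1), rf (nat (j - 1)))"
| "root_pos (Long i) = (nat (i - 1), rf (nat (i - 1)))"
| "root_pos (Short i) = (nat (i - 1), n)"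

text \<open>Matrix positions of the labels in \<open>root_entries\<close>, in a form visibly closed
  under reflection; for a long root the two coincide.\<close>

definition pos_entries :: "root \<Rightarrow> (nat \<times> nat) set" where
  "pos_entries \<alpha> = {root_pos \<alpha>, (rf (snd (root_pos \<alpha>)), rf (fst (root_pos \<alpha>)))}"

definition is_long :: "root \<Rightarrow> bool" where
  "is_long \<alpha> \<longleftrightarrow> (\<exists>i. \<alpha> = Long i)"

text \<open>Long roots get half weight, because the entry sum at an antidiagonal position decomposes
  into products of two characters of long roots.\<close>
definition weight :: "root \<Rightarrow> nat" where
  "weight \<alpha> = (if is_long \<alpha> then 1 else 2) * (snd (root_pos \<alpha>) - fst (root_pos \<alpha>))"

lemma long_rootD:
  assumes "\<alpha> \<in> roots T n" "is_long \<alpha>"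
  obtains p where "T = Symplectic" "p < n" "\<alpha> = Long (int p + 1)" "root_pos \<alpha> = (p, rf p)"
proof -
  obtain i where i: "\<alpha> = Long i"
    using assms(2) by (auto simp: is_long_def)
  have T: "T = Symplectic" and "1 \<le> i \<and> i \<le> int n"
    using assms(1) by (auto simp: i roots_def split: series.splits)
  then have "nat (i - 1) < n" "\<alpha> = Long (int (nat (i - 1)) + 1)"
    by (auto simp: i)
  moreover have "root_pos \<alpha> = (nat (i - 1), rf (nat (i - 1)))"
    by (simp add: i)
  ultimately show ?thesis
    using that T by blast
qed

text \<open>In these names, \<open>short\<close> means any root that is not a \<open>Long\<close>
  one. The last inequality is what keeps such roots off the antidiagonal.\<close>

lemma short_rootD:
  assumes "\<alpha> \<in> roots T n" "\<not> is_long \<alpha>" "root_pos \<alpha> = (p, q)"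
  shows "p < n" "p < q" "q < m" "q < rf p"
proof -
  have "p < n \<and> p < q \<and> q < m \<and> q < rf p"
  proof (cases \<alpha>)
    case (Diff i j)
    then have "1 \<le> i" "i < j" "j \<le> int n"
      using assms(1) by (auto simp: roots_def split: series.splits)
    then have i: "nat (i - 1) < n" and j: "nat (i - 1) < nat (j - 1)" "nat (j - 1) < n"
      by auto
    show ?thesis
      using assms(3) i j rf_ge[OF i] n_less[OF j(2)] by (simp add: Diff)
  next
    case (Sum i j)
    then have "1 \<le> i" "i < j" "j \<le> int n"
      using assms(1) by (auto simp: roots_def split: series.splits)
    then have i: "nat (i - 1) < nat (j - 1)" and j: "nat (j - 1) < n"
      by auto
    then have i': "nat (i - 1) < n"
      by (rule less_trans)
    have "rf (nat (j - 1)) < rf (nat (i - 1))"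
      using rf_less_iff[OF n_less[OF j] n_less[OF i']] i by blast
    then show ?thesis
      using assms(3) i j rf_ge[OF j] rf_less[OF n_less[OF j]] by (auto simp: Sum)
  next
    case (Long i)
    then show ?thesis
      using assms(2) by (simp add: is_long_def)
  next
    case (Short i)
    then have i: "1 \<le> i" "i \<le> int n" "T = OddOrthogonal"
      using assms(1) by (auto simp: roots_def split: series.splits)
    have "mid = 1"
      unfolding i(3) by (simp add: middle_dim_def)
    have p: "nat (i - 1) < n"
      using i by simp
    show ?thesis
      using assms(3) p rf_ge[OF p] rf_less[OF n_less[OF p]] \<open>mid = 1\<close> by (auto simp: Short)
  qed
  then show "p < n" "p < q" "q < m" "q < rf p"
    by auto
qed

lemma short_root_exists:
  assumes "p < q" "q < rf p"
  obtains \<alpha> where "\<alpha> \<in> roots T n" "\<not> is_long \<alpha>" "root_pos \<alpha> = (p, q)"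
proof -
  have p: "p < n" and qm: "q < m"
    using assms mid_le by (auto simp: rf_def m_eq)
  show ?thesis
    using qm
  proof (cases rule: index_cases)
    case 1
    then show ?thesis
      using assms(1) that[of "Diff (int p + 1) (int q + 1)"]
      by (auto simp: roots_def is_long_def)
  next
    case (2 k)
    then have "T = OddOrthogonal" "q = n"
      by (auto simp: middle_dim_def split: series.splits)
    have "Short (int p + 1) \<in> roots T n"
      using p by (simp add: roots_def \<open>T = OddOrthogonal\<close>)
    then show ?thesis
      using that \<open>q = n\<close> by (simp add: is_long_def)
  next
    case (3 a)
    then have "p < a"
      using assms(2) p by (simp add: rf_less_iff)
    then show ?thesis
      using 3 that[of "Sum (int p + 1) (int a + 1)"] by (auto simp: roots_def is_long_def)
  qed
qed

lemma long_root_exists: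
  assumes "T = Symplectic" "p < n"
  obtains \<alpha> where "\<alpha> \<in> roots T n" "is_long \<alpha>" "root_pos \<alpha> = (p, rf p)"
proof -
  have "Long (int p + 1) \<in> roots T n"
    using assms(2) by (simp add: roots_def assms(1))
  then show ?thesis
    using that by (simp add: is_long_def)
qed

abbreviation pos :: "int \<Rightarrow> nat" where "pos \<equiv> position T n"

lemma pos_less: "x \<in> labels T n \<Longrightarrow> pos x < m"
  by (auto simp: labels_def position_def m_eq middle_dim_def split: if_splits)

lemma pos_uminus: "x \<in> labels T n \<Longrightarrow> pos (- x) = rf (pos x)"
  by (auto simp: labels_def position_def rf_def m_eq middle_dim_def split: if_splits)

lemma pos_inj: "inj_on pos (labels T n)"
proof (rule inj_onI)
  have int_pos: "int (pos x) = (if 0 < x then x - 1 else if x = 0 then int n else int m + x) \<and>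
      - int n \<le> x \<and> x \<le> int n \<and> (x = 0 \<longrightarrow> mid = 1)" if "x \<in> labels T n" for x
    using that by (auto simp: labels_def position_def middle_dim_def mat_dim_def split: if_splits)
  have m: "int m = 2 * int n + int mid"
    by (simp add: m_eq)
  fix x y assume "x \<in> labels T n" "y \<in> labels T n" "pos x = pos y"
  then have "int (pos x) = int (pos y)" and xy: "x \<in> labels T n" "y \<in> labels T n"
    by auto
  then show "x = y"
    using int_pos[OF xy(1)] int_pos[OF xy(2)] m
    by (cases x "0 :: int" rule: linorder_cases; cases y "0 :: int" rule: linorder_cases) simp_all
qed

lemma root_entries_labels:
  assumes "\<alpha> \<in> roots T n" "(x, y) \<in> root_entries \<alpha>"
  shows "x \<in> labels T n" "y \<in> labels T n" "(pos x, pos y) \<in> pos_entries \<alpha>"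
proof -
  have lab: "i \<in> labels T n" "- i \<in> labels T n" "pos i = nat (i - 1)" "pos (- i) = rf (nat (i - 1))"
    "nat (i - 1) < m" if "1 \<le> i" "i \<le> int n" for i
  proof -
    show "i \<in> labels T n" "- i \<in> labels T n" "pos i = nat (i - 1)"
      using that by (auto simp: labels_def position_def)
    then show "pos (- i) = rf (nat (i - 1))" "nat (i - 1) < m"
      using pos_uminus[of i] pos_less[of i] by simp_all
  qed
  have "x \<in> labels T n \<and> y \<in> labels T n \<and> (pos x, pos y) \<in> pos_entries \<alpha>"
  proof (cases \<alpha>)
    case (Diff i j)
    then have "1 \<le> i" "i \<le> int n" "1 \<le> j" "j \<le> int n"
      using assms by (auto simp: roots_def split: series.splits)
    then show ?thesis
      using assms(2) lab by (auto simp: Diff pos_entries_def)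
  next
    case (Sum i j)
    then have "1 \<le> i" "i \<le> int n" "1 \<le> j" "j \<le> int n"
      using assms by (auto simp: roots_def split: series.splits)
    then show ?thesis
      using assms(2) lab by (auto simp: Sum pos_entries_def)
  next
    case (Long i)
    then have "1 \<le> i" "i \<le> int n"
      using assms by (auto simp: roots_def split: series.splits)
    then show ?thesis
      using assms(2) lab by (auto simp: Long pos_entries_def)
  next
    case (Short i)
    then have i: "1 \<le> i" "i \<le> int n" and T: "T = OddOrthogonal"
      using assms by (auto simp: roots_def split: series.splits)
    have "mid = 1" "0 \<in> labels T n" "pos 0 = n"
      using T by (auto simp: middle_dim_def labels_def position_def)
    moreover have "rf n = n"
      using rf_mid[of 0] \<open>mid = 1\<close> by simp
    ultimately show ?thesis
      using assms(2) lab[OF i] by (auto simp: Short pos_entries_def)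
  qed
  then show "x \<in> labels T n" "y \<in> labels T n" "(pos x, pos y) \<in> pos_entries \<alpha>"
    by auto
qed

text \<open>Off the antidiagonal the two entries of a root lie in different rows; on it they are
  equal.\<close>

lemma pos_entries_row_unique:
  assumes "\<alpha> \<in> roots T n" "(p, q) \<in> pos_entries \<alpha>" "(p, q') \<in> pos_entries \<alpha>"
  shows "q = q'"
proof (cases "is_long \<alpha>")
  case True
  then show ?thesis
    using assms by (auto elim!: long_rootD simp: pos_entries_def)
next
  case False
  obtain p0 q0 where pq: "root_pos \<alpha> = (p0, q0)"
    by fastforce
  note d = short_rootD[OF assms(1) False pq]
  then have "p0 \<noteq> rf q0"
    by (metis rf_rf nat_neq_iff n_less)
  then show ?thesis
    using assms(2,3) by (auto simp: pos_entries_def pq)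
qed

text \<open>Comparing rows is enough: reflection preserves the entries of a root and exchanges rows
  with columns.\<close>

definition clash :: "root \<Rightarrow> root \<Rightarrow> bool" where
  "clash \<alpha> \<beta> \<longleftrightarrow> (\<exists>p q s. (p, q) \<in> pos_entries \<alpha> \<and> (p, s) \<in> pos_entries \<beta>)"

lemma clash_refl: "clash \<alpha> \<alpha>"
  unfolding clash_def pos_entries_def by (cases "root_pos \<alpha>") blast

lemma basic_subsetI:
  assumes D: "D \<subseteq> roots T n"
    and no_clash: "\<And>\<alpha> \<beta>. \<alpha> \<in> D \<Longrightarrow> \<beta> \<in> D \<Longrightarrow> clash \<alpha> \<beta> \<Longrightarrow> \<alpha> = \<beta>"
  shows "basic_subset T n D"
proof -
  have row: "y = z" if "\<alpha> \<in> D" "\<beta> \<in> D" "(x, y) \<in> root_entries \<alpha>" "(x, z) \<in> root_entries \<beta>" for \<alpha> \<beta> x y z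
  proof -
    have "(pos x, pos y) \<in> pos_entries \<alpha>" "(pos x, pos z) \<in> pos_entries \<beta>"
      "y \<in> labels T n" "z \<in> labels T n"
      using that D root_entries_labels by blast+
    moreover from this have "\<alpha> = \<beta>"
      using no_clash that unfolding clash_def by blast
    ultimately have "pos y = pos z"
      using pos_entries_row_unique that D by blast
    then show ?thesis
      using pos_inj \<open>y \<in> labels T n\<close> \<open>z \<in> labels T n\<close> by (auto dest: inj_onD)
  qed
  have reflect: "(- y, - x) \<in> root_entries \<alpha>" if "(x, y) \<in> root_entries \<alpha>" for \<alpha> x y
    using that by (cases \<alpha>) auto
  have col: "x = z" if "\<alpha> \<in> D" "\<beta> \<in> D" "(x, y) \<in> root_entries \<alpha>" "(z, y) \<in> root_entries \<beta>" for \<alpha> \<beta> x y z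
    using row[OF that(1,2) reflect[OF that(3)] reflect[OF that(4)]] by simp
  show ?thesis
    unfolding basic_subset_def basic_entries_def
    using D by (auto intro!: inj_onI dest: row col)
qed

end

section \<open>Elementary characters as entry sums and long sums\<close>

context classical_characters
begin

abbreviation elem :: "root \<Rightarrow> 'a \<Rightarrow> 'a mat \<Rightarrow> complex" where
  "elem \<equiv> elementary_character T n \<theta>"

lemma elementary_short:
  fixes g :: "'a mat"
  assumes g: "g \<in> U" and \<alpha>: "\<alpha> \<in> roots T n" "\<not> is_long \<alpha>" "root_pos \<alpha> = (p, q)" and r: "r \<noteq> 0"
  shows "elem \<alpha> r g = entry_sum g p q r"
proof (cases \<alpha>)
  case (Diff i j)
  then have ij: "1 \<le> i" "i < j" "j \<le> int n" "p = nat (i - 1)" "q = nat (j - 1)"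
    using \<alpha> by (auto simp: roots_def split: series.splits)
  have H: "root_subgroup T n \<alpha> = {x \<in> U. \<forall>k. p < k \<and> k < q \<longrightarrow> (x :: 'a mat) $$ (p, k) = 0}"
  proof -
    have "(\<forall>k. i < k \<and> k < j \<longrightarrow> entry T n x i k = 0) \<longleftrightarrow>
        (\<forall>k. p < k \<and> k < q \<longrightarrow> x $$ (p, k) = 0)" for x :: "'a mat"
      using all_int_interval_iff[OF ij(1), of j "\<lambda>k. x $$ (p, k) = 0"] ij
      by (auto simp: entry_def position_def)
    then show ?thesis
      by (simp add: root_subgroup_def Diff)
  qed
  have "root_character T n \<theta> \<alpha> r = (\<lambda>x. \<theta> (r * x $$ (p, q)))"
    using ij by (simp add: root_character_def Diff main_entry_eqs entry_def position_def fun_eq_iff)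
  then show ?thesis
    unfolding elementary_character_def H
    using induced_row[OF g, of p q r] ij by (simp add: m_eq)
next
  case (Sum i j)
  then have ij: "1 \<le> i" "i < j" "j \<le> int n" "p = nat (i - 1)" "q = rf (nat (j - 1))"
    using \<alpha> by (auto simp: roots_def split: series.splits)
  define s where "s = nat (j - 1)"
  have s: "p < s" "s < n" "q = rf s"
    using ij by (auto simp: s_def)
  have H: "root_subgroup T n \<alpha> = {x \<in> U. (\<forall>k. p < k \<and> k < n \<longrightarrow> (x :: 'a mat) $$ (p, k) = 0) \<and>
      (\<forall>k. s < k \<and> k < n + mid \<longrightarrow> x $$ (s, k) = 0)}"
  proof -
    have "(\<forall>k. i < k \<and> k \<le> int n \<longrightarrow> entry T n x i k = 0) \<longleftrightarrow>
        (\<forall>k. p < k \<and> k < n \<longrightarrow> x $$ (p, k) = 0)" for x :: "'a mat"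
      using all_int_interval_iff[OF ij(1), of "int n + 1" "\<lambda>k. x $$ (p, k) = 0"] ij
      by (auto simp: entry_def position_def)
    \<comment> \<open>The label 0 exists only in the odd orthogonal type and has position n; this
      accounts for the bound n + mid in the second row.\<close>
    moreover have "(\<forall>l\<in>labels T n. j \<prec> l \<and> l \<preceq> 0 \<longrightarrow> entry T n x j l = 0) \<longleftrightarrow>
        (\<forall>k. s < k \<and> k < n + mid \<longrightarrow> x $$ (s, k) = 0)" for x :: "'a mat"
    proof
      assume *: "\<forall>l\<in>labels T n. j \<prec> l \<and> l \<preceq> 0 \<longrightarrow> entry T n x j l = 0"
      show "\<forall>k. s < k \<and> k < n + mid \<longrightarrow> x $$ (s, k) = 0"
      proof (intro allI impI)
        fix k assume k: "s < k \<and> k < n + mid"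
        show "x $$ (s, k) = 0"
        proof (cases "k < n")
          case True
          then show ?thesis
            using *[rule_format, of "int k + 1"] k ij
            by (auto simp: labels_def prec_def preceq_def entry_def position_def s_def)
        next
          case False
          then have "k = n" "T = OddOrthogonal"
            using k by (auto simp: middle_dim_def split: series.splits)
          then show ?thesis
            using *[rule_format, of 0] k ij
            by (auto simp: labels_def prec_def preceq_def entry_def position_def s_def)
        qed
      qed
    next
      assume *: "\<forall>k. s < k \<and> k < n + mid \<longrightarrow> x $$ (s, k) = 0"
      show "\<forall>l\<in>labels T n. j \<prec> l \<and> l \<preceq> 0 \<longrightarrow> entry T n x j l = 0"
      proof (intro ballI impI)
        fix l assume l: "l \<in> labels T n" "j \<prec> l \<and> l \<preceq> 0"
        have "s < pos l \<and> pos l < n + mid"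
          using l ij by (auto simp: labels_def prec_def preceq_def position_def s_def middle_dim_def
            split: if_splits)
        then show "entry T n x j l = 0"
          using * ij by (auto simp: entry_def position_def[of T n j] s_def)
      qed
    qed
    ultimately show ?thesis
      by (auto simp: root_subgroup_def Sum)
  qed
  have pos_j: "pos (- j) = rf s"
    using ij by (auto simp: position_def rf_def s_def)
  have "root_character T n \<theta> \<alpha> r = (\<lambda>x. \<theta> (r * x $$ (p, rf s)))"
    using ij by (simp add: root_character_def Sum main_entry_eqs entry_def pos_j fun_eq_iff)
      (simp add: position_def)
  then show ?thesis
    unfolding elementary_character_def H
    using induced_pair[OF g s(1,2) r] s(3) by simp
next
  case (Long i)
  then show ?thesis using \<alpha> by (simp add: is_long_def)
next
  case (Short i)
  then have ij: "1 \<le> i" "i \<le> int n" "p = nat (i - 1)" "q = n" and T: "T = OddOrthogonal"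
    using \<alpha> by (auto simp: roots_def split: series.splits)
  have mid: "mid = 1"
    using T by (simp add: middle_dim_def)
  have H: "root_subgroup T n \<alpha> = {x \<in> U. \<forall>k. p < k \<and> k < q \<longrightarrow> (x :: 'a mat) $$ (p, k) = 0}"
  proof -
    have "(\<forall>k. i < k \<and> k \<le> int n \<longrightarrow> entry T n x i k = 0) \<longleftrightarrow>
        (\<forall>k. p < k \<and> k < q \<longrightarrow> x $$ (p, k) = 0)" for x :: "'a mat"
      using all_int_interval_iff[OF ij(1), of "int n + 1" "\<lambda>k. x $$ (p, k) = 0"] ij
      by (auto simp: entry_def position_def)
    then show ?thesis
      by (simp add: root_subgroup_def Short)
  qed
  have "root_character T n \<theta> \<alpha> r = (\<lambda>x. \<theta> (r * x $$ (p, q)))"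
    using ij by (simp add: root_character_def Short main_entry_eqs entry_def position_def fun_eq_iff)
  then show ?thesis
    unfolding elementary_character_def H
    using induced_row[OF g, of p q r] ij mid by (simp add: m_eq)
qed

lemma elementary_long:
  fixes g :: "'a mat"
  assumes g: "g \<in> U" and \<alpha>: "\<alpha> \<in> roots T n" "is_long \<alpha>" "root_pos \<alpha> = (p, rf p)"
  shows "elem \<alpha> r g = long_sum g p r"
proof -
  obtain s where s: "T = Symplectic" "s < n" "\<alpha> = Long (int s + 1)" "root_pos \<alpha> = (s, rf s)"
    using long_rootD[OF \<alpha>(1,2)] .
  then have ps: "p = s"
    using \<alpha>(3) by simp
  have mid: "mid = 0"
    unfolding s(1) by (simp add: middle_dim_def)
  have H: "root_subgroup T n \<alpha> = {x \<in> U. \<forall>k. p < k \<and> k < n \<longrightarrow> (x :: 'a mat) $$ (p, k) = 0}"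
  proof -
    have "(\<forall>k. int s + 1 < k \<and> k \<le> int n \<longrightarrow> entry T n x (int s + 1) k = 0) \<longleftrightarrow>
        (\<forall>k. p < k \<and> k < n \<longrightarrow> x $$ (p, k) = 0)" for x :: "'a mat"
      using all_int_interval_iff[of "int s + 1" "int n + 1" "\<lambda>k. x $$ (p, k) = 0"] ps
      by (auto simp: entry_def position_def)
    then show ?thesis
      by (simp add: root_subgroup_def s(3))
  qed
  have "nat (int m + (- int s - 1)) = rf s"
    using s(2) by (auto simp: rf_def)
  then have "root_character T n \<theta> \<alpha> r = (\<lambda>x. \<theta> (r * x $$ (p, rf p)))"
    using s(2) ps by (simp add: root_character_def s(3) main_entry_eqs entry_def fun_eq_iff)
      (simp add: position_def)
  then show ?thesis
    unfolding elementary_character_def H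
    using induced_long[OF g, of p r] s(2) ps mid by simp
qed

text \<open>A clash may occur at either entry of a root. Reflection transfers the sum to the entry
  in the shared row and leaves the weight unchanged, as it preserves column minus row.\<close>

lemma elementary_at_entry:
  assumes \<alpha>: "\<alpha> \<in> roots T n" "\<not> is_long \<alpha>" and pq: "(p, q) \<in> pos_entries \<alpha>" and r: "r \<noteq> 0"
  obtains r' where "r' \<noteq> 0" "\<forall>g\<in>U. elem \<alpha> r g = entry_sum g p q r'"
    "p < q" "q < m" "q \<noteq> rf p" "weight \<alpha> = 2 * (q - p)"
proof -
  obtain p0 q0 where pq0: "root_pos \<alpha> = (p0, q0)"
    by fastforce
  note d = short_rootD[OF \<alpha> pq0]
  have pm: "p0 < m" using d by simp
  have w: "weight \<alpha> = 2 * (q0 - p0)"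
    using \<alpha> by (simp add: weight_def pq0)
  show ?thesis
  proof (cases "(p, q) = (p0, q0)")
    case True
    then show ?thesis
      using that[of r] r elementary_short[OF _ \<alpha> pq0 r] d w by auto
  next
    case False
    then have pq': "p = rf q0" "q = rf p0"
      using pq by (auto simp: pos_entries_def pq0)
    show ?thesis
    proof (rule that[of "- (sg p0 * sg q0 * r)"])
      show "- (sg p0 * sg q0 * r) \<noteq> 0"
        using r by simp
      show "\<forall>g\<in>U. elem \<alpha> r g = entry_sum g p q (- (sg p0 * sg q0 * r))"
        using elementary_short[OF _ \<alpha> pq0 r] entry_sum_reflect[OF _ d(2,3) r] pq' by simp
      show "p < q" "q < m"
        using d pm by (auto simp: pq' rf_less_iff)
      show "q \<noteq> rf p"
        using d pm by (auto simp: pq')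
      show "weight \<alpha> = 2 * (q - p)"
        using d pm by (simp add: w pq') (simp add: rf_def)
    qed
  qed
qed

text \<open>An entry to the right of the antidiagonal is the second entry of a root and is reached
  by reflection.\<close>

lemma entry_sum_as_elementary:
  assumes pq: "p < q" "q < m" "q \<noteq> rf p" and r: "r \<noteq> 0"
  obtains \<alpha> r' where "\<alpha> \<in> roots T n" "r' \<noteq> 0" "weight \<alpha> = 2 * (q - p)"
    "\<forall>g\<in>U. entry_sum g p q r = elem \<alpha> r' g"
proof (cases "q < rf p")
  case True
  obtain \<alpha> where \<alpha>: "\<alpha> \<in> roots T n" "\<not> is_long \<alpha>" "root_pos \<alpha> = (p, q)"
    using short_root_exists[OF pq(1) True] .
  then show ?thesis
    using that[of \<alpha> r] elementary_short[OF _ \<alpha> r] r by (auto simp: weight_def)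
next
  case False
  have pm: "p < m" "rf p < q"
    using pq False by auto
  then have lt: "rf q < rf p" "rf p < rf (rf q)"
    using pq by (auto simp: rf_less_iff)
  obtain \<alpha> where \<alpha>: "\<alpha> \<in> roots T n" "\<not> is_long \<alpha>" "root_pos \<alpha> = (rf q, rf p)"
    using short_root_exists[OF lt] .
  let ?r = "- (sg p * sg q * r)"
  have r': "?r \<noteq> 0"
    using r by simp
  have "weight \<alpha> = 2 * (q - p)"
    using \<alpha> pq by (auto simp: weight_def rf_def)
  moreover have "entry_sum g p q r = elem \<alpha> ?r g" if "g \<in> U" for g
    using elementary_short[OF that \<alpha> r'] entry_sum_reflect[OF that pq(1,2) r] by simp
  ultimately show ?thesis
    using that[of \<alpha> ?r] \<alpha>(1) r' by blast
qed

section \<open>Cones of products of bounded weight\<close>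

definition on_U :: "('a mat \<Rightarrow> complex) \<Rightarrow> 'a mat \<Rightarrow> complex" where
  "on_U f g = (if g \<in> U then f g else 0)"

lemma on_U_mult: "on_U (\<lambda>g. f g * h g) = on_U f * on_U h"
  and on_U_add: "on_U (\<lambda>g. f g + h g) = on_U f + on_U h"
  by (auto simp: on_U_def fun_eq_iff)

lemma on_U_sum: "on_U (\<lambda>g. \<Sum>x\<in>A. f x g) = (\<Sum>x\<in>A. on_U (f x))"
proof (induction A rule: infinite_finite_induct)
  case (insert x F)
  then show ?case by (simp add: on_U_add)
qed (auto simp: on_U_def fun_eq_iff)

lemma on_U_cong: "(\<And>g. g \<in> U \<Longrightarrow> f g = h g) \<Longrightarrow> on_U f = on_U h"
  by (auto simp: on_U_def fun_eq_iff)

definition product_character :: "(root \<times> 'a) multiset \<Rightarrow> 'a mat \<Rightarrow> complex" where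
  "product_character M = on_U (\<lambda>g. \<Prod>x\<in>#M. elem (fst x) (snd x) g)"

definition admissible :: "(root \<times> 'a) multiset \<Rightarrow> bool" where
  "admissible M \<longleftrightarrow> (\<forall>x\<in>#M. fst x \<in> roots T n \<and> snd x \<noteq> 0)"

definition total_weight :: "(root \<times> 'a) multiset \<Rightarrow> nat" where
  "total_weight M = (\<Sum>x\<in>#M. weight (fst x))"

text \<open>Closed under addition but not under subtraction or scaling, so that membership certifies
  nonnegative integer coefficients.\<close>

inductive_set cone :: "nat \<Rightarrow> ('a mat \<Rightarrow> complex) set" for w where
  cone_zero: "0 \<in> cone w"
| cone_product: "admissible M \<Longrightarrow> total_weight M \<le> w \<Longrightarrow> product_character M \<in> cone w"
| cone_add: "f \<in> cone w \<Longrightarrow> h \<in> cone w \<Longrightarrow> f + h \<in> cone w"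

lemma cone_mono:
  assumes "f \<in> cone v" "v \<le> w"
  shows "f \<in> cone w"
  using assms(1)
proof induction
  case (cone_product M)
  then show ?case
    using assms(2) by (intro cone.cone_product) auto
qed (rule cone.intros; assumption?)+

lemma cone_mult:
  assumes "f \<in> cone v" "h \<in> cone w"
  shows "f * h \<in> cone (v + w)"
  using assms(1)
proof induction
  case cone_zero
  show ?case
    unfolding mult_zero_left by (rule cone.cone_zero)
next
  case (cone_product M)
  note M = cone_product
  show ?case
    using assms(2)
  proof induction
    case cone_zero
    show ?case
      unfolding mult_zero_right by (rule cone.cone_zero)
  next
    case (cone_product N)
    have "product_character M * product_character N = product_character (M + N)"
      unfolding product_character_def on_U_mult[symmetric] by simp
    moreover have "admissible (M + N)" "total_weight (M + N) \<le> v + w"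
      using M cone_product by (auto simp: admissible_def total_weight_def)
    ultimately show ?case
      by (metis cone.cone_product)
  next
    case (cone_add f h)
    then show ?case
      unfolding distrib_left by (intro cone.cone_add)
  qed
next
  case (cone_add f h)
  then show ?case
    unfolding distrib_right by (intro cone.cone_add)
qed

lemma cone_multI:
  assumes "on_U f \<in> cone v" "on_U h \<in> cone v'" "v + v' \<le> w"
  shows "on_U (\<lambda>g. f g * h g) \<in> cone w"
  unfolding on_U_mult using cone_mono[OF cone_mult[OF assms(1,2)] assms(3)] .

lemma cone_sum: "(\<And>x. x \<in> A \<Longrightarrow> f x \<in> cone w) \<Longrightarrow> (\<Sum>x\<in>A. f x) \<in> cone w"
proof (induction A rule: infinite_finite_induct)
  case (insert x A)
  have "f x + sum f A \<in> cone w"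
    by (intro cone.cone_add insert) auto
  then show ?case
    using insert(1,2) by (simp del: plus_fun_apply)
next
  case (infinite A)
  show ?case
    unfolding sum.infinite[OF infinite(1)] by (rule cone.cone_zero)
next
  case empty
  show ?case
    unfolding sum.empty by (rule cone.cone_zero)
qed

lemma cone_one: "on_U (\<lambda>_. 1) \<in> cone w"
  using cone_product[of "{#}" w] by (simp add: product_character_def admissible_def total_weight_def)

lemma cone_elementary:
  assumes "\<alpha> \<in> roots T n" "r \<noteq> 0" "weight \<alpha> \<le> w"
  shows "on_U (elem \<alpha> r) \<in> cone w"
  using cone_product[of "{#(\<alpha>, r)#}" w] assms
  by (simp add: product_character_def admissible_def total_weight_def)

lemma cone_one_plus_sum:
  assumes "\<And>x y. x \<in> A \<Longrightarrow> y \<in> B \<Longrightarrow> on_U (f x y) \<in> cone w"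
  shows "on_U (\<lambda>g. 1 + (\<Sum>x\<in>A. \<Sum>y\<in>B. f x y g)) \<in> cone w"
  unfolding on_U_add on_U_sum by (intro cone_add cone_one cone_sum assms)

lemma cone_long_sum:
  assumes "T = Symplectic" "p < n" "r \<noteq> 0" "rf p - p \<le> w"
  shows "on_U (\<lambda>g. long_sum g p r) \<in> cone w"
proof -
  obtain \<alpha> where \<alpha>: "\<alpha> \<in> roots T n" "is_long \<alpha>" "root_pos \<alpha> = (p, rf p)"
    using long_root_exists[OF assms(1,2)] .
  have "on_U (\<lambda>g. long_sum g p r) = on_U (elem \<alpha> r)"
    by (rule on_U_cong) (simp add: elementary_long[OF _ \<alpha>])
  moreover have "weight \<alpha> \<le> w"
    using \<alpha> assms(4) by (simp add: weight_def)
  ultimately show ?thesis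
    using cone_elementary \<alpha>(1) assms(3) by simp
qed

text \<open>One row further down, \<open>rf l - l\<close> drops by 2. All long sums in the expansion
  have l > p, which is the gain of a Weil sum over the long sum of the same row.\<close>

lemma cone_weil_sum:
  assumes "T = Symplectic" "p < n" "c \<noteq> 0" "rf p - p \<le> w + 2"
  shows "on_U (\<lambda>g. weil_sum g p c) \<in> cone w"
proof -
  have "on_U (\<lambda>g. 1 + (\<Sum>l\<in>{p<..<n}. \<Sum>v\<in>-{0}. long_sum g l (c * v\<^sup>2))) \<in> cone w"
  proof (rule cone_one_plus_sum)
    fix l v assume l: "l \<in> {p<..<n}" and v: "v \<in> - {0 :: 'a}"
    have "rf l - l \<le> w"
      using l assms(4) by (auto simp: rf_def)
    moreover have "c * v\<^sup>2 \<noteq> 0"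
      using v assms(3) by simp
    ultimately show "on_U (\<lambda>g. long_sum g l (c * v\<^sup>2)) \<in> cone w"
      using l by (intro cone_long_sum[OF assms(1)]) auto
  qed
  then show ?thesis
    using weil_sum_expand[OF assms(2)] by simp
qed

lemma cone_entry_sum_off:
  assumes "p < q" "q < m" "q \<noteq> rf p" "r \<noteq> 0" "2 * (q - p) \<le> w"
  shows "on_U (\<lambda>g. entry_sum g p q r) \<in> cone w"
proof -
  obtain \<alpha> r' where \<alpha>: "\<alpha> \<in> roots T n" "r' \<noteq> 0" "weight \<alpha> = 2 * (q - p)"
    "\<forall>g\<in>U. entry_sum g p q r = elem \<alpha> r' g"
    using entry_sum_as_elementary[OF assms(1-4)] .
  have "on_U (\<lambda>g. entry_sum g p q r) = on_U (elem \<alpha> r')"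
    by (rule on_U_cong) (use \<alpha>(4) in blast)
  then show ?thesis
    using cone_elementary[OF \<alpha>(1,2)] \<alpha>(3) assms(5) by simp
qed

text \<open>On the antidiagonal the symplectic sum is a long sum times a Weil sum, and the halved
  weights of long roots fit both into the bound. In the orthogonal types the value r = 0 may be
  used, and the expansion runs along row p to the left of q.\<close>

lemma cone_entry_sum:
  assumes pq: "p < q" "q < m" and r: "r \<noteq> 0" and w: "2 * (q - p) \<le> w"
  shows "on_U (\<lambda>g. entry_sum g p q r) \<in> cone w"
proof (cases "q = rf p")
  case False
  then show ?thesis using cone_entry_sum_off assms by blast
next
  case True
  then have p: "p < n"
    using pq mid_le by (auto simp: rf_def m_eq)
  show ?thesis
  proof (cases "T = Symplectic")
    case sympl: True
    have "on_U (\<lambda>g. entry_sum g p q r) = on_U (\<lambda>g. long_sum g p r * weil_sum g p (- r))"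
      unfolding True by (rule on_U_cong) (rule entry_sum_long[OF _ sympl p r])
    also have "\<dots> \<in> cone w"
      by (rule cone_multI[OF cone_long_sum[OF sympl p r order_refl]
            cone_weil_sum[OF sympl p, of "- r" "rf p - p"]]) (use r w True in auto)
    finally show ?thesis .
  next
    case False
    have "on_U (\<lambda>g. entry_sum g p q r) =
        on_U (\<lambda>g. 1 + (\<Sum>l\<in>{p<..<q}. \<Sum>t\<in>-{0}. entry_sum g p l t))"
      by (rule on_U_cong)
        (use entry_sum_orthogonal[OF _ False p] entry_sum_zero_expand[of p q m] pq True in auto)
    also have "\<dots> \<in> cone w"
      by (intro cone_one_plus_sum cone_entry_sum_off) (use pq w True in auto)
    finally show ?thesis .
  qed
qed

text \<open>The expansion uses only rows strictly below p in column q, so each term is lighter than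
  the entry sum at (p, q) by at least 2.\<close>

lemma cone_fixer_sum:
  assumes pq: "p < q" "q < m" and r: "r \<noteq> 0" and w: "2 * (q - p) \<le> w + 2"
  shows "on_U (\<lambda>g. fixer_sum g p q r) \<in> cone w"
  unfolding fixer_sum_expand[OF pq(1) r]
  by (intro cone_one_plus_sum cone_entry_sum) (use pq w in auto)

lemma cone_entry_sum_zero:
  assumes pq: "p < q" "q < m" and w: "2 * (q - p) \<le> w + 2"
  shows "on_U (\<lambda>g. entry_sum g p q 0) \<in> cone w"
  unfolding entry_sum_zero_expand[OF pq(1) less_imp_le[OF pq(2)]]
  by (intro cone_one_plus_sum cone_entry_sum) (use pq w in auto)

text \<open>The bound w + 1 records a strict decrease. In each case one factor is replaced by a
  fixer sum, which is where the weight is lost.\<close>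

lemma cone_entry_sum_product:
  assumes pq: "p < q" "q < m" and ps: "p < s" "s < m" and rt: "r \<noteq> 0" "t \<noteq> 0"
    and w: "2 * (q - p) + 2 * (s - p) \<le> w + 1"
  shows "on_U (\<lambda>g. entry_sum g p q r * entry_sum g p s t) \<in> cone w"
proof (cases q s rule: linorder_cases)
  case less
  have "on_U (\<lambda>g. entry_sum g p q r * entry_sum g p s t) =
      on_U (\<lambda>g. fixer_sum g p q r * entry_sum g p s t)"
    by (rule on_U_cong) (rule entry_sum_absorb[OF pq(1) less])
  also have "\<dots> \<in> cone w"
    by (rule cone_multI[OF cone_fixer_sum[OF pq rt(1), of "2 * (q - p) - 2"]
          cone_entry_sum[OF ps rt(2) order_refl]]) (use pq w in auto)
  finally show ?thesis .
next
  case greater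
  have "on_U (\<lambda>g. entry_sum g p q r * entry_sum g p s t) =
      on_U (\<lambda>g. fixer_sum g p s t * entry_sum g p q r)"
    by (rule on_U_cong, subst mult.commute) (rule entry_sum_absorb[OF ps(1) greater])
  also have "\<dots> \<in> cone w"
    by (rule cone_multI[OF cone_fixer_sum[OF ps rt(2), of "2 * (s - p) - 2"]
          cone_entry_sum[OF pq rt(1) order_refl]]) (use ps w in auto)
  finally show ?thesis .
next
  case equal
  have "on_U (\<lambda>g. entry_sum g p q r * entry_sum g p s t) =
      on_U (\<lambda>g. entry_sum g p q (r + t) * fixer_sum g p q r)"
    by (rule on_U_cong) (simp add: entry_sum_mult[OF pq(1) rt(1)] flip: equal)
  also have "\<dots> \<in> cone w"
  proof (rule cone_multI[OF _ cone_fixer_sum[OF pq rt(1), of "2 * (q - p) - 2"], of _ "2 * (q - p)"])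
    \<comment> \<open>When r + t vanishes, this factor is a count of fixed vectors instead of an
      elementary character.\<close>
    show "on_U (\<lambda>g. entry_sum g p q (r + t)) \<in> cone (2 * (q - p))"
      using cone_entry_sum[OF pq, of "r + t"] cone_entry_sum_zero[OF pq] by (cases "r + t = 0") auto
  qed (use pq w equal in auto)
  finally show ?thesis .
qed

text \<open>The factor reaching further right absorbs the other: left of the antidiagonal the long
  sum turns the entry sum into a fixer sum, right of it the entry sum turns the long sum into a Weil
  sum.\<close>

lemma cone_long_entry_product:
  assumes T: "T = Symplectic" and p: "p < n" and ps: "p < s" "s < m" "s \<noteq> rf p"
    and rt: "r \<noteq> 0" "t \<noteq> 0" and w: "(rf p - p) + 2 * (s - p) \<le> w + 1"
  shows "on_U (\<lambda>g. long_sum g p r * entry_sum g p s t) \<in> cone w"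
proof (cases "s < rf p")
  case True
  have "on_U (\<lambda>g. long_sum g p r * entry_sum g p s t) = on_U (\<lambda>g. long_sum g p r * fixer_sum g p s t)"
    by (rule on_U_cong) (rule long_sum_entry_sum[OF _ T p rt(1) ps(1) True])
  also have "\<dots> \<in> cone w"
    by (rule cone_multI[OF cone_long_sum[OF T p rt(1) order_refl]
          cone_fixer_sum[OF ps(1,2) rt(2), of "2 * (s - p) - 2"]]) (use ps w in auto)
  finally show ?thesis .
next
  case False
  then have s: "rf p < s" "s \<le> m"
    using ps by auto
  have "p < rf p"
    using rf_ge[OF p] p by simp
  have "on_U (\<lambda>g. long_sum g p r * entry_sum g p s t) = on_U (\<lambda>g. weil_sum g p r * entry_sum g p s t)"
    by (rule on_U_cong) (rule long_sum_absorb[OF _ T p s])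
  also have "\<dots> \<in> cone w"
    by (rule cone_multI[OF cone_weil_sum[OF T p rt(1), of "rf p - p - 2"]
          cone_entry_sum[OF ps(1,2) rt(2) order_refl]]) (use w \<open>p < rf p\<close> ps in auto)
  finally show ?thesis .
qed

text \<open>For r + t nonzero, completing the square trades one long sum for a Weil sum. For r + t =
  0 the product is a count of fixed vectors, whose expansion stays strictly left of the
  antidiagonal.\<close>

lemma cone_long_product:
  assumes T: "T = Symplectic" and p: "p < n" and rt: "r \<noteq> 0" "t \<noteq> 0"
    and w: "(rf p - p) + (rf p - p) \<le> w + 1"
  shows "on_U (\<lambda>g. long_sum g p r * long_sum g p t) \<in> cone w"
proof (cases "r + t = 0")
  case True
  then have t: "t = - r"
    by (simp add: eq_neg_iff_add_eq_0 add.commute)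
  have "p < rf p" "rf p < m"
    using rf_ge[OF p] p by auto
  have "on_U (\<lambda>g. long_sum g p r * long_sum g p t) = on_U (\<lambda>g. entry_sum g p (rf p) 0)"
    unfolding t by (rule on_U_cong) (rule long_sum_cancel[OF _ T p rt(1)])
  also have "\<dots> \<in> cone w"
    by (rule cone_entry_sum_zero) (use \<open>p < rf p\<close> \<open>rf p < m\<close> w in auto)
  finally show ?thesis .
next
  case False
  have "p < rf p"
    using rf_ge[OF p] p by simp
  have "on_U (\<lambda>g. long_sum g p r * long_sum g p t) =
      on_U (\<lambda>g. long_sum g p (r + t) * weil_sum g p (r * t / (r + t)))"
    by (rule on_U_cong) (rule long_sum_mult[OF _ T p False])
  also have "\<dots> \<in> cone w"
    by (rule cone_multI[OF cone_long_sum[OF T p False order_refl]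
          cone_weil_sum[OF T p, of _ "rf p - p - 2"]]) (use w rt False \<open>p < rf p\<close> in auto)
  finally show ?thesis .
qed

text \<open>Both factors are rewritten at their entries in the common row p, so that the product
  rules apply. A long root has only its antidiagonal entry, so no reflection occurs for it.\<close>

lemma cone_clash:
  assumes \<alpha>: "\<alpha> \<in> roots T n" and \<beta>: "\<beta> \<in> roots T n" and rt: "r \<noteq> 0" "t \<noteq> 0"
    and clash: "clash \<alpha> \<beta>" and w: "weight \<alpha> + weight \<beta> \<le> w + 1"
  shows "on_U (\<lambda>g. elem \<alpha> r g * elem \<beta> t g) \<in> cone w"
proof -
  obtain p q s where pq: "(p, q) \<in> pos_entries \<alpha>" and ps: "(p, s) \<in> pos_entries \<beta>"
    using clash by (auto simp: clash_def)
  have long: "p < n \<and> T = Symplectic \<and> weight \<gamma> = rf p - p \<and>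
      (\<forall>g\<in>U. \<forall>c. elem \<gamma> c g = long_sum g p c)"
    if \<gamma>: "\<gamma> \<in> roots T n" "is_long \<gamma>" and px: "(p, x) \<in> pos_entries \<gamma>" for \<gamma> x
  proof -
    obtain p0 where p0: "T = Symplectic" "p0 < n" "root_pos \<gamma> = (p0, rf p0)"
      using long_rootD[OF \<gamma>] by metis
    have "p = p0"
      using p0(2,3) px by (auto simp: pos_entries_def)
    then have "root_pos \<gamma> = (p, rf p)"
      using p0 by simp
    moreover from this have "weight \<gamma> = rf p - p"
      using \<gamma>(2) by (simp add: weight_def)
    ultimately show ?thesis
      using p0(1,2) \<open>p = p0\<close> elementary_long[OF _ \<gamma>] by blast
  qed
  show ?thesis
  proof (cases "is_long \<alpha>"; cases "is_long \<beta>")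
    assume L: "is_long \<alpha>" "is_long \<beta>"
    have T: "T = Symplectic" and p: "p < n" and wa: "weight \<alpha> = rf p - p"
      and a: "\<forall>g\<in>U. \<forall>c. elem \<alpha> c g = long_sum g p c"
      using long[OF \<alpha> L(1) pq] by blast+
    have wb: "weight \<beta> = rf p - p" and b: "\<forall>g\<in>U. \<forall>c. elem \<beta> c g = long_sum g p c"
      using long[OF \<beta> L(2) ps] by blast+
    have "on_U (\<lambda>g. elem \<alpha> r g * elem \<beta> t g) = on_U (\<lambda>g. long_sum g p r * long_sum g p t)"
      by (rule on_U_cong) (use a b in simp)
    also have "\<dots> \<in> cone w"
      by (rule cone_long_product[OF T p rt]) (use w wa wb in linarith)
    finally show ?thesis .
  next
    assume L: "is_long \<alpha>" "\<not> is_long \<beta>"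
    have T: "T = Symplectic" and p: "p < n" and wa: "weight \<alpha> = rf p - p"
      and a: "\<forall>g\<in>U. \<forall>c. elem \<alpha> c g = long_sum g p c"
      using long[OF \<alpha> L(1) pq] by blast+
    obtain t' where b: "t' \<noteq> 0" "\<forall>g\<in>U. elem \<beta> t g = entry_sum g p s t'"
      "p < s" "s < m" "s \<noteq> rf p" "weight \<beta> = 2 * (s - p)"
      using elementary_at_entry[OF \<beta> L(2) ps rt(2)] .
    have "on_U (\<lambda>g. elem \<alpha> r g * elem \<beta> t g) = on_U (\<lambda>g. long_sum g p r * entry_sum g p s t')"
      by (rule on_U_cong) (use a b in simp)
    also have "\<dots> \<in> cone w"
      by (rule cone_long_entry_product[OF T p b(3-5) rt(1) b(1)]) (use w wa b(6) in linarith)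
    finally show ?thesis .
  next
    assume L: "\<not> is_long \<alpha>" "is_long \<beta>"
    have T: "T = Symplectic" and p: "p < n" and wb: "weight \<beta> = rf p - p"
      and b: "\<forall>g\<in>U. \<forall>c. elem \<beta> c g = long_sum g p c"
      using long[OF \<beta> L(2) ps] by blast+
    obtain r' where a: "r' \<noteq> 0" "\<forall>g\<in>U. elem \<alpha> r g = entry_sum g p q r'"
      "p < q" "q < m" "q \<noteq> rf p" "weight \<alpha> = 2 * (q - p)"
      using elementary_at_entry[OF \<alpha> L(1) pq rt(1)] .
    have "on_U (\<lambda>g. elem \<alpha> r g * elem \<beta> t g) = on_U (\<lambda>g. long_sum g p t * entry_sum g p q r')"
      by (rule on_U_cong) (use a b in \<open>simp add: mult.commute\<close>)
    also have "\<dots> \<in> cone w"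
      by (rule cone_long_entry_product[OF T p a(3-5) rt(2) a(1)]) (use w wb a(6) in linarith)
    finally show ?thesis .
  next
    assume L: "\<not> is_long \<alpha>" "\<not> is_long \<beta>"
    obtain r' where a: "r' \<noteq> 0" "\<forall>g\<in>U. elem \<alpha> r g = entry_sum g p q r'"
      "p < q" "q < m" "q \<noteq> rf p" "weight \<alpha> = 2 * (q - p)"
      using elementary_at_entry[OF \<alpha> L(1) pq rt(1)] .
    obtain t' where b: "t' \<noteq> 0" "\<forall>g\<in>U. elem \<beta> t g = entry_sum g p s t'"
      "p < s" "s < m" "s \<noteq> rf p" "weight \<beta> = 2 * (s - p)"
      using elementary_at_entry[OF \<beta> L(2) ps rt(2)] .
    have "on_U (\<lambda>g. elem \<alpha> r g * elem \<beta> t g) = on_U (\<lambda>g. entry_sum g p q r' * entry_sum g p s t')"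
      by (rule on_U_cong) (use a b in simp)
    then show ?thesis
      using cone_entry_sum_product[of p q s r' t' w] a b w by simp
  qed
qed

section \<open>Resolving clashes into sums of supercharacters\<close>

abbreviation super_sum :: "('a mat \<Rightarrow> complex) \<Rightarrow> bool" where
  "super_sum \<equiv> sum_of_supercharacters T n \<theta>"

lemma super_sum_zero: "super_sum 0"
  unfolding sum_of_supercharacters_def by (rule exI[of _ "\<lambda>_. 0"]) simp

lemma super_sum_add:
  assumes "super_sum f" "super_sum h"
  shows "super_sum (f + h)"
proof -
  obtain c d where "f = (\<Sum>(D, \<phi>)\<in>super_indices T n. of_nat (c (D, \<phi>)) * supercharacter T n \<theta> D \<phi>)"
    "h = (\<Sum>(D, \<phi>)\<in>super_indices T n. of_nat (d (D, \<phi>)) * supercharacter T n \<theta> D \<phi>)"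
    using assms unfolding sum_of_supercharacters_def by blast
  then have "f + h = (\<Sum>(D, \<phi>)\<in>super_indices T n.
      of_nat (c (D, \<phi>) + d (D, \<phi>)) * supercharacter T n \<theta> D \<phi>)"
    by (simp add: case_prod_beta distrib_right sum.distrib)
  then show ?thesis
    unfolding sum_of_supercharacters_def by (intro exI[of _ "\<lambda>x. c x + d x"])
qed

lemma super_sum_supercharacter:
  assumes "(D, \<phi>) \<in> super_indices T n"
  shows "super_sum (supercharacter T n \<theta> D \<phi>)"
proof -
  have "(\<Sum>x\<in>super_indices T n. of_nat (if x = (D, \<phi>) then 1 else 0) * supercharacter T n \<theta> (fst x) (snd x)) =
      (\<Sum>x\<in>super_indices T n. if x = (D, \<phi>) then supercharacter T n \<theta> D \<phi> else 0)"
    by (rule sum.cong) auto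
  also have "\<dots> = supercharacter T n \<theta> D \<phi>"
    by (subst sum.delta[OF finite_super_indices]) (simp add: assms)
  finally show ?thesis
    unfolding sum_of_supercharacters_def
    by (intro exI[of _ "\<lambda>x. if x = (D, \<phi>) then 1 else 0"])
      (simp only: case_prod_unfold prod.collapse)
qed

lemma prod_fun_apply: "(\<Prod>x\<in>A. f x) g = (\<Prod>x\<in>A. f x (g :: 'b) :: complex)"
  by (induction A rule: infinite_finite_induct) auto

lemma supercharacter_eq:
  "supercharacter T n \<theta> D \<phi> = on_U (\<lambda>g. \<Prod>\<alpha>\<in>D. elem \<alpha> (\<phi> \<alpha>) g)"
  by (auto simp: supercharacter_def trivial_character_def on_U_def fun_eq_iff prod_fun_apply)

text \<open>Every root clashes with itself, so without clashes no root occurs twice, whether with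
  equal or with different scalars. The multiset is then the graph of a function on a basic
  subset.\<close>

lemma product_character_basic:
  assumes M: "admissible M"
    and no_clash: "\<And>x y M'. M = add_mset x (add_mset y M') \<Longrightarrow> \<not> clash (fst x) (fst y)"
  shows "super_sum (product_character M)"
proof -
  let ?S = "set_mset M"
  have no_clash': "x = y" if x: "x \<in># M" and y: "y \<in># M" and c: "clash (fst x) (fst y)" for x y
  proof (rule ccontr)
    assume "x \<noteq> y"
    obtain A where A: "M = add_mset x A"
      using x by (meson multi_member_split)
    then obtain B where "A = add_mset y B"
      using y \<open>x \<noteq> y\<close> by (auto dest: multi_member_split)
    then have "M = add_mset x (add_mset y B)"
      by (simp add: A)
    then show False
      using no_clash c by blast
  qed
  have "count M x \<le> 1" for x
  proof (rule ccontr)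
    assume "\<not> count M x \<le> 1"
    then have "x \<in># M" "x \<in># M - {#x#}"
      by (auto simp: in_diff_count count_greater_zero_iff[symmetric] simp del: count_greater_zero_iff)
    then obtain A where "M = add_mset x (add_mset x A)"
      by (metis insert_DiffM)
    then show False
      using no_clash clash_refl by blast
  qed
  then have M_eq: "M = mset_set ?S"
    by (intro multiset_eqI) (metis count_mset_set(1,3) finite_set_mset le_antisym less_one
      linorder_not_le count_eq_zero_iff nat_less_le)
  have inj: "inj_on fst ?S"
    using no_clash' clash_refl by (intro inj_onI) metis
  define D where "D = fst ` ?S"
  define \<phi> where "\<phi> = restrict (\<lambda>\<alpha>. snd (the_inv_into ?S fst \<alpha>)) D"
  have \<phi>: "\<phi> (fst x) = snd x" if "x \<in># M" for x
    using that inj by (simp add: \<phi>_def D_def the_inv_into_f_f)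
  have "basic_subset T n D"
  proof (rule basic_subsetI)
    show "D \<subseteq> roots T n"
      using M by (auto simp: D_def admissible_def)
    show "\<alpha> = \<beta>" if "\<alpha> \<in> D" "\<beta> \<in> D" "clash \<alpha> \<beta>" for \<alpha> \<beta>
      using that no_clash' by (auto simp: D_def)
  qed
  moreover have "\<phi> \<in> D \<rightarrow>\<^sub>E - {0}"
  proof (rule PiE_I)
    show "\<phi> \<alpha> \<in> - {0}" if "\<alpha> \<in> D" for \<alpha>
      using that M \<phi> by (auto simp: D_def admissible_def)
  qed (simp add: \<phi>_def)
  ultimately have "(D, \<phi>) \<in> super_indices T n"
    by (simp add: super_indices_def)
  moreover have "product_character M = supercharacter T n \<theta> D \<phi>"
    unfolding supercharacter_eq product_character_def
  proof (rule on_U_cong)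
    fix g
    have "(\<Prod>x\<in>#M. elem (fst x) (snd x) g) = (\<Prod>x\<in>?S. elem (fst x) (snd x) g)"
      by (subst M_eq) (simp add: prod_unfold_prod_mset)
    also have "\<dots> = (\<Prod>x\<in>?S. elem (fst x) (\<phi> (fst x)) g)"
      by (intro prod.cong refl) (simp add: \<phi>)
    also have "\<dots> = (\<Prod>\<alpha>\<in>D. elem \<alpha> (\<phi> \<alpha>) g)"
      unfolding D_def by (simp add: prod.reindex[OF inj])
    finally show "(\<Prod>x\<in>#M. elem (fst x) (snd x) g) = (\<Prod>\<alpha>\<in>D. elem \<alpha> (\<phi> \<alpha>) g)" .
  qed
  ultimately show ?thesis
    using super_sum_supercharacter by simp
qed

lemma weight_pos:
  assumes "\<alpha> \<in> roots T n"
  shows "0 < weight \<alpha>"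
proof (cases "is_long \<alpha>")
  case True
  then obtain p where "p < n" "root_pos \<alpha> = (p, rf p)"
    using long_rootD[OF assms] by metis
  then show ?thesis
    using rf_ge[of p] by (simp add: weight_def)
next
  case False
  obtain p q where pq: "root_pos \<alpha> = (p, q)"
    by fastforce
  then show ?thesis
    using short_rootD[OF assms False pq] by (simp add: weight_def)
qed

lemma cone_super_sum: "f \<in> cone w \<Longrightarrow> super_sum f"
proof (induction w arbitrary: f rule: less_induct)
  case (less w)
  from less.prems show ?case
  proof induction
    case (cone_product M)
    show ?case
    proof (cases "\<exists>x y M'. M = add_mset x (add_mset y M') \<and> clash (fst x) (fst y)")
      case False
      then show ?thesis
        using product_character_basic[OF cone_product(1)] by blast
    next
      case True
      then obtain x y M' where M: "M = add_mset x (add_mset y M')" and c: "clash (fst x) (fst y)"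
        by blast
      \<comment> \<open>The subtraction is exact because weights of roots are positive; this drop by
        one feeds the outer induction.\<close>
      let ?v = "weight (fst x) + weight (fst y) - 1"
      have xy: "fst x \<in> roots T n" "fst y \<in> roots T n" "snd x \<noteq> 0" "snd y \<noteq> 0" "admissible M'"
        using cone_product(1) by (auto simp: M admissible_def)
      have "on_U (\<lambda>g. elem (fst x) (snd x) g * elem (fst y) (snd y) g) \<in> cone ?v"
        by (rule cone_clash[OF xy(1-4) c]) simp
      moreover have "product_character M' \<in> cone (total_weight M')"
        by (rule cone.cone_product) (use xy in auto)
      ultimately have "product_character M \<in> cone (?v + total_weight M')"
        using cone_mult by (fastforce simp: product_character_def M on_U_mult[symmetric] mult.assoc)
      moreover have "?v + total_weight M' \<le> w - 1" "w - 1 < w"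
        using cone_product(2) weight_pos[OF xy(1)] weight_pos[OF xy(2)]
        by (auto simp: M total_weight_def)
      ultimately show ?thesis
        using less.IH cone_mono by blast
    qed
  next
    case cone_zero
    show ?case by (rule super_sum_zero)
  next
    case (cone_add f h)
    then show ?case by (intro super_sum_add)
  qed
qed

lemma supercharacter_cone:
  assumes "\<chi> \<in> supercharacters T n \<theta>"
  obtains w where "\<chi> \<in> cone w"
proof -
  obtain D \<phi> where \<chi>: "\<chi> = supercharacter T n \<theta> D \<phi>" and D: "basic_subset T n D" "\<phi> \<in> D \<rightarrow>\<^sub>E - {0}"
    using assms by (auto simp: supercharacters_def super_indices_def)
  let ?M = "image_mset (\<lambda>\<alpha>. (\<alpha>, \<phi> \<alpha>)) (mset_set D)"
  have "finite D"
    using D(1) finite_roots finite_subset by (auto simp: basic_subset_def)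
  then have "admissible ?M"
    using D by (auto simp: admissible_def basic_subset_def PiE_def Pi_def)
  moreover have "product_character ?M = \<chi>"
    unfolding \<chi> supercharacter_eq product_character_def
    by (simp add: prod_unfold_prod_mset image_mset.compositionality o_def)
  ultimately show ?thesis
    using that cone_product[of ?M "total_weight ?M"] by simp
qed

section \<open>The span of the supercharacters as a subalgebra\<close>

lemma super_sum_scf: 
  assumes "super_sum f"
  shows "f \<in> scf T n \<theta>"
proof -
  obtain c :: "root set \<times> (root \<Rightarrow> 'a) \<Rightarrow> nat"
    where f: "f = (\<Sum>(D, \<phi>)\<in>super_indices T n. of_nat (c (D, \<phi>)) * supercharacter T n \<theta> D \<phi>)"
    using assms unfolding sum_of_supercharacters_def by blast
  \<comment> \<open>In a sum of supercharacters the coefficient is the constant function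
    \<open>of_nat k\<close>, whose pointwise product agrees with the scalar action.\<close>
  have scale: "of_nat k * h = fun_scale (of_nat k) h" for k and h :: "'a mat \<Rightarrow> complex"
    by (induction k) (auto simp: fun_scale_def fun_eq_iff algebra_simps)
  show ?thesis
    unfolding f scf_def
  proof (intro cfun.span_sum)
    fix x :: "root set \<times> (root \<Rightarrow> 'a)" assume x: "x \<in> super_indices T n"
    obtain D \<phi> where D: "x = (D, \<phi>)" by fastforce
    then have "supercharacter T n \<theta> D \<phi> \<in> supercharacters T n \<theta>"
      using x by (auto simp: supercharacters_def)
    then show "(case x of (D, \<phi>) \<Rightarrow> of_nat (c (D, \<phi>)) * supercharacter T n \<theta> D \<phi>)
        \<in> cfun.span (supercharacters T n \<theta>)"
      unfolding D prod.case scale by (intro cfun.span_scale cfun.span_base)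
  qed
qed

lemma class_functions_subspace: "cfun.subspace (class_functions H)"
  by (auto simp: cfun.subspace_def class_functions_def fun_scale_def)

lemma class_functions_mult:
  "f \<in> class_functions H \<Longrightarrow> h \<in> class_functions H \<Longrightarrow> f * h \<in> class_functions H"
  by (auto simp: class_functions_def)

lemma trivial_class_function: "trivial_character G \<in> class_functions (G :: 'a mat monoid)"
proof -
  interpret group "G :: 'a mat monoid" by (rule group_U)
  have "t \<otimes>\<^bsub>G\<^esub> g \<otimes>\<^bsub>G\<^esub> inv\<^bsub>G\<^esub> t \<in> carrier G" if "g \<in> carrier G" "t \<in> carrier G" for g t :: "'a mat"
    using that by (intro m_closed inv_closed)
  then show ?thesis
    by (auto simp: class_functions_def trivial_character_def)
qed

text \<open>Stated for an arbitrary set S in order to serve twice: for the class functions, and for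
  each subalgebra competing in the hull.\<close>

lemma supercharacters_subset:
  assumes one: "trivial_character G \<in> S" and mult: "\<And>f h. f \<in> S \<Longrightarrow> h \<in> S \<Longrightarrow> f * h \<in> S"
    and elem: "elementary_characters T n \<theta> \<subseteq> S"
  shows "supercharacters T n \<theta> \<subseteq> S"
proof
  fix \<chi> assume "\<chi> \<in> supercharacters T n \<theta>"
  then obtain D \<phi> where \<chi>: "\<chi> = supercharacter T n \<theta> D \<phi>" and D: "D \<subseteq> roots T n" "\<phi> \<in> D \<rightarrow> - {0}"
    by (auto simp: supercharacters_def super_indices_def basic_subset_def PiE_def)
  have "finite D"
    using D(1) finite_roots by (rule finite_subset)
  then have "trivial_character G * (\<Prod>\<alpha>\<in>D. elem \<alpha> (\<phi> \<alpha>)) \<in> S"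
    using D
  proof (induction D rule: finite_induct)
    case (insert \<alpha> D)
    have "elem \<alpha> (\<phi> \<alpha>) \<in> S"
      using insert.prems elem by (auto simp: elementary_characters_def)
    moreover have "trivial_character G * (\<Prod>\<alpha>\<in>D. elem \<alpha> (\<phi> \<alpha>)) \<in> S"
      using insert.prems by (intro insert.IH) auto
    ultimately show ?case
      unfolding prod.insert[OF insert.hyps] mult.left_commute[of "trivial_character G"] by (rule mult)
  qed (use one in simp)
  then show "\<chi> \<in> S"
    by (simp add: \<chi> supercharacter_def)
qed

lemma elementary_class_function: "elementary_characters T n \<theta> \<subseteq> class_functions (G :: 'a mat monoid)"
proof -
  interpret group "G :: 'a mat monoid" by (rule group_U)
  show ?thesis
    by (auto simp: elementary_characters_def elementary_character_def induced_class_function)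
qed

lemma elementary_scf: "elementary_characters T n \<theta> \<subseteq> scf T n \<theta>"
proof
  fix \<chi> assume "\<chi> \<in> elementary_characters T n \<theta>"
  then obtain \<alpha> r where \<alpha>: "\<chi> = elem \<alpha> r" "\<alpha> \<in> roots T n" "r \<noteq> 0"
    by (auto simp: elementary_characters_def)
  have "on_U (elem \<alpha> r) = elem \<alpha> r"
    by (auto simp: on_U_def elementary_character_def induced_def fun_eq_iff)
  then show "\<chi> \<in> scf T n \<theta>"
    using cone_elementary[OF \<alpha>(2,3) order_refl] \<alpha>(1) cone_super_sum super_sum_scf by simp
qed

lemma supercharacters_mult:
  assumes "\<chi> \<in> supercharacters T n \<theta>" "\<psi> \<in> supercharacters T n \<theta>"
  shows "super_sum (\<chi> * \<psi>)"
proof -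
  obtain v where v: "\<chi> \<in> cone v"
    using supercharacter_cone[OF assms(1)] .
  obtain w where w: "\<psi> \<in> cone w"
    using supercharacter_cone[OF assms(2)] .
  show ?thesis
    using cone_super_sum[OF cone_mult[OF v w]] .
qed

lemma scf_mult:
  assumes "f \<in> scf T n \<theta>" "h \<in> scf T n \<theta>"
  shows "f * h \<in> scf T n \<theta>"
proof -
  have scale: "fun_scale c f * h = fun_scale c (f * h)" "h * fun_scale c f = fun_scale c (h * f)"
    for c and f h :: "'a mat \<Rightarrow> complex"
    by (auto simp: fun_scale_def fun_eq_iff)
  have right: "\<chi> * h \<in> scf T n \<theta>" if "\<chi> \<in> supercharacters T n \<theta>" for \<chi>
    using assms(2) unfolding scf_def
  proof (induction rule: cfun.span_induct_alt)
    case base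
    show ?case
      unfolding mult_zero_right by (rule cfun.span_zero)
  next
    case (step c \<psi> h)
    then have "\<chi> * \<psi> \<in> cfun.span (supercharacters T n \<theta>)"
      using super_sum_scf[OF supercharacters_mult[OF that]] by (simp add: scf_def)
    then show ?case
      unfolding distrib_left scale using step by (intro cfun.span_add cfun.span_scale)
  qed
  show ?thesis
    using assms(1) unfolding scf_def
  proof (induction rule: cfun.span_induct_alt)
    case base
    show ?case
      unfolding mult_zero_left by (rule cfun.span_zero)
  next
    case (step c \<chi> f)
    then show ?case
      unfolding distrib_right scale using right[of \<chi>, unfolded scf_def]
      by (intro cfun.span_add cfun.span_scale)
  qed
qed

lemma trivial_scf: "trivial_character G \<in> scf T n \<theta>"
proof -
  have "on_U (\<lambda>_. 1) = trivial_character G"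
    by (auto simp: on_U_def trivial_character_def fun_eq_iff)
  then show ?thesis
    using cone_super_sum[OF cone_one] super_sum_scf by metis
qed

lemma scf_subalgebra: "cf_subalgebra G (scf T n \<theta>)"
proof -
  have "supercharacters T n \<theta> \<subseteq> class_functions G"
    by (intro supercharacters_subset trivial_class_function class_functions_mult elementary_class_function)
  then have "scf T n \<theta> \<subseteq> class_functions G"
    unfolding scf_def by (intro cfun.span_minimal class_functions_subspace)
  then show ?thesis
    unfolding cf_subalgebra_def using trivial_scf scf_mult
    by (simp add: scf_def)
qed

lemma finite_elementary: "finite (elementary_characters T n \<theta>)"
proof (rule finite_subset)
  show "elementary_characters T n \<theta> \<subseteq> (\<lambda>(\<alpha>, r). elem \<alpha> r) ` (roots T n \<times> UNIV)"
    by (auto simp: elementary_characters_def)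
  show "finite ((\<lambda>(\<alpha>, r). elem \<alpha> r) ` (roots T n \<times> UNIV))"
    by (simp add: finite_roots)
qed

text \<open>That the hull lies in \<open>scf\<close> needs closure of \<open>scf\<close> under
  products, the content of the product rules; the reverse inclusion only needs that supercharacters
  are products of elementary characters.\<close>

lemma scf_generated: "scf T n \<theta> = generated_cf_subalgebra G (elementary_characters T n \<theta>)"
proof
  show "generated_cf_subalgebra G (elementary_characters T n \<theta>) \<subseteq> scf T n \<theta>"
    unfolding generated_cf_subalgebra_def
    by (intro hull_minimal elementary_scf scf_subalgebra)
  show "scf T n \<theta> \<subseteq> generated_cf_subalgebra G (elementary_characters T n \<theta>)"
    unfolding generated_cf_subalgebra_def hull_def
  proof (intro Inter_greatest)
    fix S assume "S \<in> {S. cf_subalgebra G S \<and> elementary_characters T n \<theta> \<subseteq> S}"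
    then have S: "cfun.subspace S" "trivial_character G \<in> S" "\<And>f h. f \<in> S \<Longrightarrow> h \<in> S \<Longrightarrow> f * h \<in> S"
      "elementary_characters T n \<theta> \<subseteq> S"
      by (auto simp: cf_subalgebra_def)
    show "scf T n \<theta> \<subseteq> S"
      unfolding scf_def by (intro cfun.span_minimal supercharacters_subset S)
  qed
qed

end

text \<open>If 2 were 0, the characteristic would be 2 and divide the order of the field, a power of
  p.\<close>

lemma two_nonzero_of_card:
  assumes "prime p" "p \<ge> 3" "card (UNIV :: 'a::{field,finite} set) = p ^ e"
  shows "(2 :: 'a) \<noteq> 0"
proof
  assume "(2 :: 'a) = 0"
  then have "CHAR('a) dvd 2"
    using of_nat_eq_0_iff_char_dvd[of 2, where ?'a = 'a] by simp
  moreover have "CHAR('a) \<noteq> 1"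
    by simp
  ultimately have "CHAR('a) = 2"
    by (metis prime_nat_iff two_is_prime_nat)
  then have "2 dvd p ^ e"
    using CHAR_dvd_CARD[where ?'a = 'a] assms(3) by simp
  then have "p = 2"
    using assms(1) prime_dvd_power primes_dvd_imp_eq two_is_prime_nat by blast
  with assms(2) show False by simp
qed

theorem theorem4p3:
  fixes \<theta> :: "'a::{field,finite} \<Rightarrow> complex"
    and p e n :: nat
    and T :: series
  assumes "prime p" and "p \<ge> 3" and "e \<ge> 1" and "card (UNIV :: 'a set) = p ^ e"
    and "n \<ge> 1"
    and "nontrivial_additive_character \<theta>"
  shows "(\<forall>\<chi>\<in>supercharacters T n \<theta>. \<forall>\<psi>\<in>supercharacters T n \<theta>.
            sum_of_supercharacters T n \<theta> (\<chi> * \<psi>)) \<and>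
         cf_subalgebra (U_group T n) (scf T n \<theta>) \<and>
         finite (elementary_characters T n \<theta>) \<and>
         scf T n \<theta> = generated_cf_subalgebra (U_group T n) (elementary_characters T n \<theta>)"
proof -
  interpret classical_characters T n \<theta>
    using two_nonzero_of_card[OF assms(1,2,4)] assms(6) by unfold_locales
  show ?thesis
    using supercharacters_mult scf_subalgebra finite_elementary scf_generated by blast
qed

end
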